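(* Let $n\ge 2$ and let $d_1,\dots,d_n$ be positive integers with $\xi:=\sum_{i=1}^n 1/d_i<1$. Put $K=\max_i d_i$. (a) Case $p=1$. There exists $s^*>0$ (depending on $n,d_1,\dots,d_n$) such that the following holds for every $s_1\in(0,s^* )$. Let $a_1,\dots,a_{n-1}\in\mathbb{C}$ have moduli $|a_{n-1}|=(s_1K^{-2})^{1/d_n}$ and $|a_i|=(s_1K^{-5})^{1/d_{i+1}}|a_{i+1}|$ for $1\le i\le n-2$, with arbitrary arguments. Then the Julia set of $f_{1,d_1,\dots,d_n}$ is a Cantor set of circles. (b) Case $p=0$. There exists $s^*>0$ (depending on $n,d_1,\dots,d_n$) such that the following holds for every $s_0\in(0,s^* )$. Let $a_1,\dots,a_{n-1}\in\mathbb{C}$ have moduli $|a_{n-1}|=\big(s_0^{1/d_n+(1-\xi)/3}\big)^{1/d_n}$ and $|a_i|=\big(s_0^{1+1/d_n+2(1-\xi)/3}\big)^{1/d_{i+1}}|a_{i+1}|$ for $1\le i\le n-2$, with arbitrary arguments. Then the Julia set of $f_{0,d_1,\dots,d_n}$ is a Cantor set of circles. In particular, for every $p\in\{0,1\}$, every $n\ge2$ and every $d_1,\dots,d_n$ with $\sum 1/d_i<1$, there exist parameters $a_1,\dots,a_{n-1}$ such that the Julia set of $f_{p,d_1,\dots,d_n}$ is a Cantor set of circles.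
   Context: A subset of the Riemann sphere $\overline{\mathbb{C}}$ is a Cantor set of circles if it is homeomorphic to $\mathcal{C}\times\mathbb{S}^1$, where $\mathcal{C}$ is the middle-third Cantor set and $\mathbb{S}^1$ the unit circle. For $p\in\{0,1\}$, an integer $n\ge2$, positive integers $d_1,\dots,d_n$ with $\sum_{i=1}^n 1/d_i<1$, and complex numbers $a_1,\dots,a_{n-1}$ with $0<|a_1|<\dots<|a_{n-1}|<1$, define the rational map $$f_{p,d_1,\dots,d_n}(z)=z^{(-1)^{n-p}d_1}\prod_{i=1}^{n-1}\big(z^{d_i+d_{i+1}}-a_i^{d_i+d_{i+1}}\big)^{(-1)^{n-i-p}}.$$ (The parameter moduli in the claim automatically satisfy $0<|a_1|<\dots<|a_{n-1}|<1$ for small $s_1$, $s_0$.) *)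

theory Defs
  imports "HOL-Analysis.Analysis" "HOL-Computational_Algebra.Polynomial"
begin

text \<open>Points of the Riemann sphere are represented as complex option
(None = infinity). They are embedded into the unit sphere of complex x real
(= R^3, Euclidean norm) by inverse stereographic projection, None going to the
north pole. The chordal metric is the Euclidean distance of the images.\<close>

definition to_sphere :: "complex option \<Rightarrow> complex \<times> real" where
  "to_sphere w = (case w of
      None \<Rightarrow> (0, 1)
    | Some z \<Rightarrow> (of_real (2 / ((norm z)^2 + 1)) * z,
                 ((norm z)^2 - 1) / ((norm z)^2 + 1)))"

definition chordal_dist :: "complex option \<Rightarrow> complex option \<Rightarrow> real" where
  "chordal_dist x y = dist (to_sphere x) (to_sphere y)"

text \<open>The rational map P/Q (P, Q coprime, Q nonzero) extended to the Riemann sphere.\<close>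
definition rat_ext :: "complex poly \<Rightarrow> complex poly \<Rightarrow> complex option \<Rightarrow> complex option" where
  "rat_ext P Q w = (case w of
      Some z \<Rightarrow> (if poly Q z = 0 then None else Some (poly P z / poly Q z))
    | None \<Rightarrow> (if degree P > degree Q then None
               else if degree P = degree Q then Some (lead_coeff P / lead_coeff Q)
               else Some 0))"

section \<open>Fatou and Julia sets (Beardon: equicontinuity in the chordal metric)\<close>

definition fatou_set :: "(complex option \<Rightarrow> complex option) \<Rightarrow> complex option set" where
  "fatou_set F = {z. \<exists>r>0. \<forall>w. chordal_dist w z < r \<longrightarrow>
      (\<forall>e>0. \<exists>\<delta>>0. \<forall>k::nat. \<forall>v. chordal_dist v w < \<delta> \<longrightarrow>
          chordal_dist ((F ^^ k) v) ((F ^^ k) w) < e)}"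

definition julia_set :: "(complex option \<Rightarrow> complex option) \<Rightarrow> complex option set" where
  "julia_set F = UNIV - fatou_set F"

fun cantor_approx :: "nat \<Rightarrow> real set" where
  "cantor_approx 0 = {0..1}"
| "cantor_approx (Suc k) = (\<lambda>x. x / 3) ` cantor_approx k \<union> (\<lambda>x. x / 3 + 2 / 3) ` cantor_approx k"

definition middle_third_cantor :: "real set" where
  "middle_third_cantor = (\<Inter>k. cantor_approx k)"

definition cantor_set_of_circles :: "complex option set \<Rightarrow> bool" where
  "cantor_set_of_circles J \<longleftrightarrow>
     (to_sphere ` J) homeomorphic (middle_third_cantor \<times> sphere (0::complex) 1)"

text \<open>d is indexed by 1..n, a by 1..n-1. Factors with exponent +1 go to the
numerator, those with exponent -1 to the denominator.\<close>

definition fac :: "(nat \<Rightarrow> nat) \<Rightarrow> (nat \<Rightarrow> complex) \<Rightarrow> nat \<Rightarrow> complex poly" where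
  "fac d a i = monom 1 (d i + d (Suc i)) - [:a i ^ (d i + d (Suc i)):]"

definition f_num :: "nat \<Rightarrow> nat \<Rightarrow> (nat \<Rightarrow> nat) \<Rightarrow> (nat \<Rightarrow> complex) \<Rightarrow> complex poly" where
  "f_num p n d a = (if even (n - p) then monom 1 (d 1) else 1) *
      (\<Prod>i\<in>{i\<in>{1..<n}. even (n - i - p)}. fac d a i)"

definition f_den :: "nat \<Rightarrow> nat \<Rightarrow> (nat \<Rightarrow> nat) \<Rightarrow> (nat \<Rightarrow> complex) \<Rightarrow> complex poly" where
  "f_den p n d a = (if odd (n - p) then monom 1 (d 1) else 1) *
      (\<Prod>i\<in>{i\<in>{1..<n}. odd (n - i - p)}. fac d a i)"

definition fmap :: "nat \<Rightarrow> nat \<Rightarrow> (nat \<Rightarrow> nat) \<Rightarrow> (nat \<Rightarrow> complex) \<Rightarrow> complex option \<Rightarrow> complex option" where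
  "fmap p n d a = rat_ext (f_num p n d a) (f_den p n d a)"

end

theory Submission
  imports Defs
begin

text \<open>
  Fix an annulus \<open>A = {r \<le> \<bar>z\<bar> \<le> R}\<close> such that \<open>f\<close> maps the complement of \<open>A\<close> into itself without expanding
  scaled distances. If moreover the preimage of \<open>A\<close> in \<open>A\<close> consists of \<open>n\<close> essential annuli on which \<open>f\<close> is, in the
  coordinate \<open>log z\<close>, a small Lipschitz perturbation of an affine map with slope \<open>\<plusminus>d i\<close>, then its inverse branches \<open>G i\<close>
  are contractions of a strip. With \<open>E\<close> a full shift on \<open>n\<close> symbols acting on the Cantor set, the fixed point
  \<open>\<Gamma> (x, t) = G (sym x) (\<Gamma> (E x, \<plusminus>d t))\<close> semiconjugates \<open>(x, t) \<mapsto> (E x, \<plusminus>d t)\<close> to the dynamics; \<open>exp \<circ> \<Gamma>\<close> identifies the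
  product of the Cantor set and the circle with the set of points that never leave \<open>A\<close>. This set is the Julia set, since the
  parameter \<open>t\<close> is expanded on it and points leaving \<open>A\<close> are points of equicontinuity.

  For the given maps, \<open>\<bar>f\<bar>\<close> is close to a piecewise monomial function of \<open>\<bar>z\<bar>\<close> with breaks at the \<open>\<bar>a i\<bar>\<close>; the moduli
  are chosen so that its values at the breaks alternate between a level below \<open>r\<close> and a level above \<open>R\<close>, and
  \<open>\<Sum> 1 / d i < 1\<close> makes the disc \<open>\<bar>z\<bar> < r\<close> escape as well.
\<close>

section \<open>Cantor sets and full shifts\<close>

text \<open>The Julia set is defined by equicontinuity, so no normal-family argument enters:
  escaping points are handled by Lipschitz bounds in disc coordinates, the others by explicit pairs
  of nearby points that separate. On a strip each inverse branch is single-valued, and its degree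
  survives only as the equivariance \<open>G_shift\<close>. The obstacle is the ring around each
  circle |z| = |a j|, where one factor has zeros and no monomial approximates the map. The ring must
  be wide enough that outside it the logarithmic derivative is perturbed by less than half the
  degree (degrees are at least 2, so the branches contract), yet narrow enough that on it the map
  passes the value \<open>V j\<close> by at most a factor comparable to K^2, which the gap between
  levels and annulus absorbs. A radius ratio of K^(2/d) on each side serves both. The condition sum
  1/d i < 1 enters at the innermost monomial: with r of order s and |a 1| of order s^\<gamma>, its
  values on |z| = r carry the factor (r/|a 1|)^(d 1), of order s^((1-\<gamma>) d 1), and the
  condition lifts this exponent far enough above 1.\<close>

lemma homeomorphic_same_fibres:
  fixes q :: "'a::t2_space \<Rightarrow> 'b::t2_space" and g :: "'a \<Rightarrow> 'c::t2_space"
  assumes "compact P" "continuous_on P q" "continuous_on P g"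
    and fib: "\<And>x y. x \<in> P \<Longrightarrow> y \<in> P \<Longrightarrow> q x = q y \<longleftrightarrow> g x = g y"
  shows "q ` P homeomorphic g ` P"
proof -
  \<comment> \<open>The joint image projects injectively to both factors because the fibres agree,
    and a continuous injection of a compact set is a homeomorphism onto its image.\<close>
  let ?M = "(\<lambda>x. (q x, g x)) ` P"
  have M: "compact ?M"
    by (intro compact_continuous_image continuous_intros assms)
  have "?M homeomorphic q ` P"
    by (rule homeomorphic_compact[OF M, of fst])
       (use fib in \<open>auto simp: inj_on_def image_image intro!: continuous_intros\<close>)
  moreover have "?M homeomorphic g ` P"
    by (rule homeomorphic_compact[OF M, of snd])
       (use fib in \<open>auto simp: inj_on_def image_image intro!: continuous_intros\<close>)
  ultimately show ?thesis
    using homeomorphic_sym homeomorphic_trans by blast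
qed

abbreviation "cantor \<equiv> middle_third_cantor"

lemma cantor_approx_subset: "cantor_approx k \<subseteq> {0..1}"
  by (induction k) fastforce+

lemma cantor_approx_Suc_subset: "cantor_approx (Suc k) \<subseteq> cantor_approx k"
proof (induction k)
  case 0
  then show ?case using cantor_approx_subset[of 1] by simp
next
  case (Suc k)
  show ?case
    unfolding cantor_approx.simps(2)[of "Suc k"] cantor_approx.simps(2)[of k]
    by (intro Un_mono image_mono Suc[unfolded cantor_approx.simps(2)[of k]])
qed

lemma cantor_subset: "cantor \<subseteq> {0..1}"
  unfolding middle_third_cantor_def by (rule INF_lower2[of 0]) (simp_all only: UNIV_I cantor_approx.simps subset_refl)

lemma compact_cantor: "compact cantor"
proof -
  have "compact (cantor_approx k)" for k
    by (induction k) (auto intro!: compact_Un compact_continuous_image continuous_intros)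
  then have "closed cantor"
    unfolding middle_third_cantor_def by (intro closed_INT) (auto intro: compact_imp_closed)
  then show ?thesis
    by (metis bounded_closed_interval bounded_subset cantor_subset compact_eq_bounded_closed)
qed

lemma zero_in_cantor: "0 \<in> cantor"
proof -
  have "0 \<in> cantor_approx k" for k
    by (induction k) (auto simp: image_iff)
  then show ?thesis by (simp add: middle_third_cantor_def)
qed

text \<open>The cut at 1/2 lies in the removed middle third, so only the left branch of the
  recursion can produce \<open>x\<close>. Level 0 may be dropped from the intersection because the
  levels decrease.\<close>

lemma cantor_left_iff:
  assumes "x \<le> 1/2" shows "x \<in> cantor \<longleftrightarrow> 3 * x \<in> cantor"
proof -
  have *: "x \<in> cantor_approx (Suc k) \<longleftrightarrow> 3 * x \<in> cantor_approx k" for k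
  proof -
    have "x \<noteq> y / 3 + 2 / 3" if "y \<in> cantor_approx k" for y
      using that cantor_approx_subset[of k] assms by fastforce
    moreover have "x = y / 3 \<longleftrightarrow> y = 3 * x" for y by auto
    ultimately show ?thesis by (auto simp: image_iff)
  qed
  have "x \<in> cantor \<longleftrightarrow> (\<forall>k. x \<in> cantor_approx (Suc k))"
    unfolding middle_third_cantor_def using cantor_approx_Suc_subset by blast
  then show ?thesis
    unfolding * by (simp add: middle_third_cantor_def)
qed

lemma cantor_right_iff:
  assumes "x > 1/2" shows "x \<in> cantor \<longleftrightarrow> 3 * x - 2 \<in> cantor"
proof -
  have *: "x \<in> cantor_approx (Suc k) \<longleftrightarrow> 3 * x - 2 \<in> cantor_approx k" for k
  proof -
    have "x \<noteq> y / 3" if "y \<in> cantor_approx k" for y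
      using that cantor_approx_subset[of k] assms by fastforce
    moreover have "x = y / 3 + 2 / 3 \<longleftrightarrow> y = 3 * x - 2" for y by (auto simp: field_simps)
    ultimately show ?thesis by (auto simp: image_iff)
  qed
  have "x \<in> cantor \<longleftrightarrow> (\<forall>k. x \<in> cantor_approx (Suc k))"
    unfolding middle_third_cantor_def using cantor_approx_Suc_subset by blast
  then show ?thesis
    unfolding * by (simp add: middle_third_cantor_def)
qed

lemma cantor_gap: "x \<in> cantor \<Longrightarrow> x \<le> 1/3 \<or> x \<ge> 2/3"
proof -
  assume "x \<in> cantor"
  then have "x \<in> cantor_approx (Suc 0)"
    unfolding middle_third_cantor_def by blast
  then show ?thesis by auto
qed

text \<open>The gap separates the two pieces into disjoint closed sets, so nothing has to match at
  the cut.\<close>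

lemma continuous_on_cantor_split:
  fixes f g :: "real \<Rightarrow> 'a::topological_space"
  assumes "continuous_on (cantor \<inter> {..1/3}) f" "continuous_on (cantor \<inter> {2/3..}) g"
  shows "continuous_on cantor (\<lambda>x. if x \<le> 1/2 then f x else g x)"
proof -
  have 1: "cantor = (cantor \<inter> {..1/3}) \<union> (cantor \<inter> {2/3..})"
    using cantor_gap by force
  show ?thesis
    by (subst 1, rule continuous_on_cases)
       (use assms compact_imp_closed[OF compact_cantor] in \<open>auto intro!: closed_Int\<close>)
qed

text \<open>A prefix code with \<open>n\<close> words turns the ternary shift into a full shift on \<open>n\<close> symbols, so the
  Cantor set itself can serve as the space of itineraries.\<close>

lemma cantor_full_shift:
  assumes "n \<ge> (2::nat)"
  obtains sym :: "real \<Rightarrow> nat" and E :: "real \<Rightarrow> real" where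
    "continuous_on cantor sym" "continuous_on cantor E"
    "\<And>x. x \<in> cantor \<Longrightarrow> sym x \<in> {1..n} \<and> E x \<in> cantor"
    "\<And>i y. i \<in> {1..n} \<Longrightarrow> y \<in> cantor \<Longrightarrow> \<exists>x\<in>cantor. sym x = i \<and> E x = y"
    "\<And>x x'. x \<in> cantor \<Longrightarrow> x' \<in> cantor \<Longrightarrow> sym x = sym x' \<Longrightarrow> 3 * \<bar>x - x'\<bar> \<le> \<bar>E x - E x'\<bar>"
proof -
  define P where "P n sym E \<longleftrightarrow>
      continuous_on cantor sym \<and> continuous_on cantor E \<and>
      (\<forall>x\<in>cantor. sym x \<in> {1..n} \<and> E x \<in> cantor) \<and>
      (\<forall>i\<in>{1..n}. \<forall>y\<in>cantor. \<exists>x\<in>cantor. sym x = i \<and> E x = y) \<and>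
      (\<forall>x\<in>cantor. \<forall>x'\<in>cantor. sym x = sym x' \<longrightarrow> 3 * \<bar>x - x'\<bar> \<le> \<bar>E x - E x'\<bar>)"
    for n :: nat and sym :: "real \<Rightarrow> nat" and E :: "real \<Rightarrow> real"
  have cont: "continuous_on (cantor \<inter> {2/3..}) (\<lambda>x. g (3 * x - 2))"
    if "continuous_on cantor g" for g :: "real \<Rightarrow> 'z::topological_space"
    proof (rule continuous_on_compose2[OF that])
    show "(\<lambda>x. 3 * x - 2) ` (cantor \<inter> {2/3..}) \<subseteq> cantor"
      using cantor_right_iff by fastforce
  qed (intro continuous_intros)
  have "\<exists>sym E. P n sym E"
    using assms
  proof (induction n rule: dec_induct)
    case base
    let ?s = "\<lambda>x::real. if x \<le> 1/2 then 1 else 2 :: nat"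
    let ?E = "\<lambda>x::real. if x \<le> 1/2 then 3 * x else 3 * x - 2"
    have "P 2 ?s ?E"
      unfolding P_def
    proof (intro conjI ballI)
      show "continuous_on cantor ?s" "continuous_on cantor ?E"
        by (intro continuous_on_cantor_split continuous_intros)+
    next
      fix i y assume i: "i \<in> {1..2::nat}" and y: "y \<in> cantor"
      have y': "0 \<le> y" "y \<le> 1" using y cantor_subset by auto
      from i have "i = 1 \<or> i = 2" by auto
      then show "\<exists>x\<in>cantor. ?s x = i \<and> ?E x = y"
      proof
        assume "i = 1"
        then show ?thesis using y y' by (intro bexI[of _ "y/3"]) (auto simp: cantor_left_iff[of "y/3"])
      next
        assume "i = 2"
        then show ?thesis using y y' by (intro bexI[of _ "y/3 + 2/3"]) (auto simp: cantor_right_iff[of "y/3 + 2/3"])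
      qed
    next
      fix x assume "x \<in> cantor"
      then show "?s x \<in> {1..2}" "?E x \<in> cantor"
        using cantor_right_iff[of x] cantor_left_iff[of x] by auto
    next
      fix x x' :: real
      show "?s x = ?s x' \<longrightarrow> 3 * \<bar>x - x'\<bar> \<le> \<bar>?E x - ?E x'\<bar>"
        by (auto simp: abs_if)
    qed
    then show ?case by blast
  next
    case (step n)
    then obtain sym E where "P n sym E" by blast
    then have c: "continuous_on cantor sym" "continuous_on cantor E"
      and m: "\<And>x. x \<in> cantor \<Longrightarrow> sym x \<in> {1..n} \<and> E x \<in> cantor"
      and s: "\<And>i y. i \<in> {1..n} \<Longrightarrow> y \<in> cantor \<Longrightarrow> \<exists>x\<in>cantor. sym x = i \<and> E x = y"
      and e: "\<And>x x'. x \<in> cantor \<Longrightarrow> x' \<in> cantor \<Longrightarrow> sym x = sym x' \<Longrightarrow> 3 * \<bar>x - x'\<bar> \<le> \<bar>E x - E x'\<bar>"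
      unfolding P_def by blast+
    \<comment> \<open>The new symbol takes the left third and the old code is copied into the right
      third: every old word is prefixed by one digit, which only increases its expansion.\<close>
    let ?s = "\<lambda>x::real. if x \<le> 1/2 then Suc n else sym (3 * x - 2)"
    let ?E = "\<lambda>x::real. if x \<le> 1/2 then 3 * x else E (3 * x - 2)"
    have "P (Suc n) ?s ?E"
      unfolding P_def
    proof (intro conjI ballI)
      show "continuous_on cantor ?s" "continuous_on cantor ?E"
        by (intro continuous_on_cantor_split continuous_intros cont c)+
    next
      fix i y assume i: "i \<in> {1..Suc n}" and y: "y \<in> cantor"
      have y': "0 \<le> y" "y \<le> 1" using y cantor_subset by auto
      show "\<exists>x\<in>cantor. ?s x = i \<and> ?E x = y"
      proof (cases "i = Suc n")
        case True
        then show ?thesis using y y' by (intro bexI[of _ "y/3"]) (auto simp: cantor_left_iff[of "y/3"])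
      next
        case False
        then obtain x where x: "x \<in> cantor" "sym x = i" "E x = y" using s[of i y] i y by auto
        then have "0 \<le> x" using cantor_subset by auto
        then show ?thesis using x by (intro bexI[of _ "x/3 + 2/3"]) (auto simp: cantor_right_iff[of "x/3 + 2/3"])
      qed
    next
      fix x x' assume x: "x \<in> cantor" "x' \<in> cantor"
      \<comment> \<open>Old symbols never equal the new one, so equal symbols force both points into
        the same third.\<close>
      have n0: "x > 1/2 \<Longrightarrow> sym (3 * x - 2) \<noteq> Suc n" "x' > 1/2 \<Longrightarrow> sym (3 * x' - 2) \<noteq> Suc n"
        using m[of "3 * x - 2"] m[of "3 * x' - 2"] x cantor_right_iff[of x] cantor_right_iff[of x'] by auto
      show "?s x = ?s x' \<longrightarrow> 3 * \<bar>x - x'\<bar> \<le> \<bar>?E x - ?E x'\<bar>"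
        using n0 e[of "3 * x - 2" "3 * x' - 2"] x cantor_right_iff[of x] cantor_right_iff[of x']
        by (cases "x \<le> 1/2"; cases "x' \<le> 1/2") (auto simp: abs_if split: if_splits)
    next
      fix x assume x: "x \<in> cantor"
      show "?s x \<in> {1..Suc n}" "?E x \<in> cantor"
        using m[of "3 * x - 2"] x cantor_right_iff[of x] cantor_left_iff[of x] by force+
    qed
    then show ?case by blast
  qed
  then show thesis using that unfolding P_def by blast
qed

section \<open>The chordal metric and attracting ends\<close>

lemma chordal_dist_refl [simp]: "chordal_dist x x = 0"
  by (simp add: chordal_dist_def)

section \<open>Inversion as a chordal isometry; chordal versus Euclidean neighbourhoods\<close>

definition inv_pt :: "complex option \<Rightarrow> complex option" where
  "inv_pt w = (case w of None \<Rightarrow> Some 0 | Some z \<Rightarrow> if z = 0 then None else Some (1 / z))"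

lemma inv_pt_inv_pt [simp]: "inv_pt (inv_pt w) = w"
  by (auto simp: inv_pt_def split: option.splits)

text \<open>Inversion acts on the sphere as the half-turn about the real axis. Being an isometry, it
  reduces statements about infinity and poles to statements about finite values.\<close>

lemma to_sphere_inv_pt:
  "to_sphere (inv_pt w) = (cnj (fst (to_sphere w)), - snd (to_sphere w))"
proof (cases w)
  case None
  then show ?thesis by (simp add: inv_pt_def to_sphere_def)
next
  case (Some z)
  show ?thesis
  proof (cases "z = 0")
    case True
    then show ?thesis using Some by (simp add: inv_pt_def to_sphere_def)
  next
    case False
    have z: "1 / z = cnj z / of_real ((norm z)^2)"
      using False complex_norm_square[of z] by (simp add: field_simps)
    have n: "norm (1 / z) = 1 / norm z" by (simp add: norm_divide)
    have pos: "(norm z)^2 > 0" using False by simp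
    have 1: "2 / ((1 / norm z)^2 + 1) = 2 * (norm z)^2 / ((norm z)^2 + 1)"
      "((1 / norm z)^2 - 1) / ((1 / norm z)^2 + 1) = - (((norm z)^2 - 1) / ((norm z)^2 + 1))"
    proof -
      have "2 / (1 / a + 1) = 2 * a / (a + 1)" "(1 / a - 1) / (1 / a + 1) = - ((a - 1) / (a + 1))"
        if "a > 0" for a :: real
        using that by (auto simp: divide_simps)
      from this[OF pos] show "2 / ((1 / norm z)^2 + 1) = 2 * (norm z)^2 / ((norm z)^2 + 1)"
        "((1 / norm z)^2 - 1) / ((1 / norm z)^2 + 1) = - (((norm z)^2 - 1) / ((norm z)^2 + 1))"
        by (simp_all add: power_divide)
    qed
    have "of_real (2 * (norm z)^2 / ((norm z)^2 + 1)) * (cnj z / of_real ((norm z)^2))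
        = cnj (of_real (2 / ((norm z)^2 + 1)) * z)"
      using pos by (simp add: field_simps)
    moreover have "to_sphere (inv_pt w) = (of_real (2 / ((1 / norm z)^2 + 1)) * (1 / z),
        ((1 / norm z)^2 - 1) / ((1 / norm z)^2 + 1))"
      using Some False by (simp add: inv_pt_def to_sphere_def norm_divide)
    ultimately show ?thesis
      unfolding 1 z using Some by (simp add: to_sphere_def)
  qed
qed

lemma chordal_dist_inv_pt [simp]: "chordal_dist (inv_pt v) (inv_pt w) = chordal_dist v w"
proof -
  have "dist (cnj a) (cnj b) = dist a b" for a b
    by (metis complex_cnj_diff complex_mod_cnj dist_norm)
  moreover have "dist (- a) (- b) = dist a b" for a b :: real
    by (simp add: dist_real_def)
  ultimately show ?thesis
    by (simp add: chordal_dist_def to_sphere_inv_pt dist_prod_def)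
qed

lemma continuous_on_to_sphere_Some: "continuous_on A (\<lambda>z. to_sphere (Some z))"
proof -
  have *: "(norm z)^2 + 1 \<noteq> 0" for z :: complex
    by (metis add.commute power_one sum_power2_eq_zero_iff zero_neq_one)
  show ?thesis
    unfolding to_sphere_def option.case
    by (intro continuous_intros) (use * in auto)
qed

text \<open>Stereographic projection from the north pole; its continuity away from the pole turns
  chordal closeness into Euclidean closeness.\<close>

definition proj_pt :: "complex \<times> real \<Rightarrow> complex" where
  "proj_pt q = fst q / of_real (1 - snd q)"

lemma one_minus_snd_to_sphere: "1 - snd (to_sphere (Some z)) = 2 / ((norm z)^2 + 1)"
proof -
  have "(norm z)^2 + 1 > 0" by (simp add: add_nonneg_pos)
  then show ?thesis by (simp add: to_sphere_def field_simps)
qed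

lemma proj_pt_to_sphere [simp]: "proj_pt (to_sphere (Some z)) = z"
proof -
  have "(norm z)^2 + 1 > 0" by (simp add: add_nonneg_pos)
  then have "complex_of_real (2 / ((norm z)^2 + 1)) \<noteq> 0"
    by (simp only: of_real_eq_0_iff) simp
  then show ?thesis
    unfolding proj_pt_def one_minus_snd_to_sphere by (simp add: to_sphere_def)
qed

lemma to_sphere_Some_inject [simp]: "to_sphere (Some z) = to_sphere (Some w) \<longleftrightarrow> z = w"
  by (metis proj_pt_to_sphere)

lemma chordal_near_Some:
  assumes "e > 0"
  obtains \<delta> where "\<delta> > 0" "\<And>v. chordal_dist v (Some z) < \<delta> \<Longrightarrow> \<exists>w. v = Some w \<and> dist w z < e"
proof -
  have ne: "1 - snd (to_sphere (Some z)) > 0"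
    unfolding one_minus_snd_to_sphere by (simp add: add_nonneg_pos)
  have "isCont proj_pt (to_sphere (Some z))"
    unfolding proj_pt_def using ne by (intro continuous_intros) auto
  then obtain d where d: "d > 0"
    "\<And>y. dist y (to_sphere (Some z)) < d \<Longrightarrow> dist (proj_pt y) (proj_pt (to_sphere (Some z))) < e"
    using assms unfolding continuous_at_eps_delta by blast
  have "to_sphere None \<noteq> to_sphere (Some z)"
    using ne by (metis (mono_tags, lifting) to_sphere_def diff_self less_irrefl option.simps(4) snd_conv)
  then have "chordal_dist None (Some z) > 0"
    by (simp add: chordal_dist_def)
  show thesis
  proof
    \<comment> \<open>The second bound keeps infinity out of the neighbourhood.\<close>
    show "min d (chordal_dist None (Some z)) > 0" using d \<open>chordal_dist None (Some z) > 0\<close> by simp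
  next
    fix v assume v: "chordal_dist v (Some z) < min d (chordal_dist None (Some z))"
    then obtain w where w: "v = Some w" by (cases v) auto
    then have "dist (to_sphere (Some w)) (to_sphere (Some z)) < d"
      using v by (simp add: chordal_dist_def)
    from d(2)[OF this] show "\<exists>w. v = Some w \<and> dist w z < e" using w by simp
  qed
qed

section \<open>Pointwise equicontinuity and its transport along orbits\<close>

definition chordal_cont :: "(complex option \<Rightarrow> complex option) \<Rightarrow> complex option \<Rightarrow> bool" where
  "chordal_cont F z \<longleftrightarrow> (\<forall>e>0. \<exists>\<delta>>0. \<forall>v. chordal_dist v z < \<delta> \<longrightarrow> chordal_dist (F v) (F z) < e)"

definition chordal_equicont :: "(complex option \<Rightarrow> complex option) \<Rightarrow> complex option \<Rightarrow> bool" where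
  "chordal_equicont F z \<longleftrightarrow> (\<forall>e>0. \<exists>\<delta>>0. \<forall>k::nat. \<forall>v. chordal_dist v z < \<delta> \<longrightarrow>
     chordal_dist ((F ^^ k) v) ((F ^^ k) z) < e)"

lemma fatou_set_iff:
  "z \<in> fatou_set F \<longleftrightarrow> (\<exists>r>0. \<forall>w. chordal_dist w z < r \<longrightarrow> chordal_equicont F w)"
  by (simp add: fatou_set_def chordal_equicont_def)

lemma chordal_equicont_pullback:
  assumes "chordal_cont F z" "chordal_equicont F (F z)"
  shows "chordal_equicont F z"
  unfolding chordal_equicont_def
proof (intro allI impI)
  fix e :: real assume e: "e > 0"
  then obtain d1 where d1: "d1 > 0"
    "\<And>k v. chordal_dist v (F z) < d1 \<Longrightarrow> chordal_dist ((F ^^ k) v) ((F ^^ k) (F z)) < e"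
    using assms(2) unfolding chordal_equicont_def by blast
  obtain d2 where d2: "d2 > 0" "\<And>v. chordal_dist v z < d2 \<Longrightarrow> chordal_dist (F v) (F z) < d1"
    using assms(1) d1(1) unfolding chordal_cont_def by blast
  \<comment> \<open>The zeroth iterate at \<open>z\<close> is not an iterate applied to
    \<open>F z\<close>; the bound by \<open>e\<close> takes care of it.\<close>
  have "chordal_dist ((F ^^ k) v) ((F ^^ k) z) < e" if "chordal_dist v z < min d2 e" for k v
    using that d1(2) d2(2) by (cases k) (simp_all add: funpow_Suc_right del: funpow.simps(2))
  then show "\<exists>\<delta>>0. \<forall>k v. chordal_dist v z < \<delta> \<longrightarrow> chordal_dist ((F ^^ k) v) ((F ^^ k) z) < e"
    using d2(1) e by (intro exI[of _ "min d2 e"]) simp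
qed

lemma chordal_cont_funpow:
  assumes "\<And>z. chordal_cont F z"
  shows "chordal_cont (F ^^ k) z"
proof (induction k)
  case 0
  then show ?case by (auto simp: chordal_cont_def)
next
  case (Suc k)
  then show ?case using assms[of "(F ^^ k) z"] unfolding chordal_cont_def funpow.simps o_apply by meson
qed

text \<open>\<open>chart r R\<close> parametrises \<open>\<bar>z\<bar> < r\<close> (for \<open>True\<close>) and \<open>\<bar>z\<bar> > R\<close> together with infinity (for \<open>False\<close>) by the unit disc.\<close>

definition chart :: "real \<Rightarrow> real \<Rightarrow> bool \<Rightarrow> complex \<Rightarrow> complex option" where
  "chart r R b u = (if b then Some (of_real r * u) else inv_pt (Some (u / of_real R)))"

text \<open>Measuring distances in unit-disc coordinates on both sides makes the property closed
  under composition, whatever sequence of ends an orbit visits, so one bound serves all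
  iterates.\<close>

definition nonexp_between :: "real \<Rightarrow> real \<Rightarrow> (complex option \<Rightarrow> complex option) \<Rightarrow> bool \<Rightarrow> bool \<Rightarrow> bool" where
  "nonexp_between r R F b b' \<longleftrightarrow> (\<exists>g. (\<forall>u\<in>ball 0 1. g u \<in> ball 0 1 \<and> F (chart r R b u) = chart r R b' (g u)) \<and>
     (\<forall>u\<in>ball 0 1. \<forall>v\<in>ball 0 1. dist (g u) (g v) \<le> dist u v))"

lemma chart_near:
  assumes "r > 0" "R > 0" "u \<in> ball 0 1" "e > 0"
  obtains \<delta> where "\<delta> > 0"
    "\<And>v. chordal_dist v (chart r R b u) < \<delta> \<Longrightarrow> \<exists>u'\<in>ball 0 1. v = chart r R b u' \<and> dist u' u < e"
proof -
  \<comment> \<open>Staying within \<open>1 - norm u\<close> of \<open>u\<close> keeps the new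
    coordinate in the unit disc.\<close>
  define e' where "e' = min e (1 - norm u)"
  have e': "e' > 0" using assms by (simp add: e'_def)
  \<comment> \<open>After inversion the outer end is the disc of radius 1 / R, so both ends become
    scaled discs.\<close>
  define s where "s = (if b then r else 1 / R)"
  have s: "s > 0" using assms by (simp add: s_def)
  obtain \<delta> where \<delta>: "\<delta> > 0"
    "\<And>v. chordal_dist v (Some (of_real s * u)) < \<delta> \<Longrightarrow> \<exists>w. v = Some w \<and> dist w (of_real s * u) < s * e'"
    using chordal_near_Some[of "s * e'"] e' s by (metis mult_pos_pos)
  have key: "\<exists>u'\<in>ball 0 1. v = Some (of_real s * u') \<and> dist u' u < e"
    if v: "chordal_dist v (Some (of_real s * u)) < \<delta>" for v
  proof -
    obtain w where w: "v = Some w" "dist w (of_real s * u) < s * e'" using \<delta>(2)[OF v] by blast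
    define u' where "u' = w / of_real s"
    have wu: "w = of_real s * u'" using s by (simp add: u'_def)
    have "dist w (of_real s * u) = s * dist u' u"
      unfolding wu dist_norm using s by (simp flip: right_diff_distrib add: norm_mult)
    then have d: "dist u' u < e'" using w(2) s by simp
    then have "norm u' < 1" unfolding e'_def using norm_triangle_sub[of u' u] by (simp add: dist_norm)
    then show ?thesis using d w(1) wu e'_def by (intro bexI[of _ u']) auto
  qed
  show thesis
  proof (cases b)
    case True
    then show ?thesis using that[of \<delta>] \<delta>(1) key by (simp add: chart_def s_def)
  next
    case False
    have "\<exists>u'\<in>ball 0 1. v = chart r R b u' \<and> dist u' u < e"
      if v: "chordal_dist v (chart r R b u) < \<delta>" for v
    proof -
      have "chordal_dist (inv_pt v) (Some (of_real s * u)) < \<delta>"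
        using v False chordal_dist_inv_pt[of v "inv_pt (Some (u / of_real R))"]
        by (simp add: chart_def s_def)
      then obtain u' where u': "u' \<in> ball 0 1" "inv_pt v = Some (of_real s * u')" "dist u' u < e"
        using key by blast
      then have "v = inv_pt (Some (of_real s * u'))" by (metis inv_pt_inv_pt)
      then show ?thesis using u' False by (intro bexI[of _ u']) (auto simp: chart_def s_def)
    qed
    then show ?thesis using that[of \<delta>] \<delta>(1) by blast
  qed
qed

text \<open>Both charts extend continuously to the closed disc, and compactness yields a modulus of
  continuity independent of the point; equicontinuity on the ends needs one that does not depend on
  where an iterate lands.\<close>

lemma chart_uniform:
  assumes "e > 0"
  obtains \<eta> where "\<eta> > 0"
    "\<And>b u v. u \<in> ball 0 1 \<Longrightarrow> v \<in> ball 0 1 \<Longrightarrow> dist u v < \<eta> \<Longrightarrow>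
       chordal_dist (chart r R b u) (chart r R b v) < e"
proof -
  have "\<exists>\<eta>>0. \<forall>u\<in>ball 0 1. \<forall>v\<in>ball 0 1. dist u v < \<eta> \<longrightarrow>
      chordal_dist (Some (s * u)) (Some (s * v)) < e" for s
  proof -
    have "continuous_on (cball 0 1) (\<lambda>u. to_sphere (Some (s * u)))"
      by (rule continuous_on_compose2[OF continuous_on_to_sphere_Some[of UNIV]]) (auto intro!: continuous_intros)
    then have "uniformly_continuous_on (cball 0 1) (\<lambda>u. to_sphere (Some (s * u)))"
      by (simp add: compact_uniformly_continuous)
    then obtain d where "d > 0" "\<forall>x\<in>cball 0 1. \<forall>x'\<in>cball 0 1. dist x' x < d \<longrightarrow>
        dist (to_sphere (Some (s * x'))) (to_sphere (Some (s * x))) < e"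
      using assms unfolding uniformly_continuous_on_def by meson
    then show ?thesis by (intro exI[of _ d]) (auto simp: chordal_dist_def)
  qed
  then obtain \<eta> where \<eta>: "\<And>s. \<eta> s > 0" "\<And>s u v. u \<in> ball 0 1 \<Longrightarrow> v \<in> ball 0 1 \<Longrightarrow> dist u v < \<eta> s \<Longrightarrow>
      chordal_dist (Some (s * u)) (Some (s * v)) < e"
    by metis
  have "chordal_dist (chart r R b u) (chart r R b v) < e"
    if "u \<in> ball 0 1" "v \<in> ball 0 1" "dist u v < min (\<eta> (of_real r)) (\<eta> (1 / of_real R))" for b u v
    using \<eta>(2)[of u v "of_real r"] \<eta>(2)[of u v "1 / of_real R"] that by (auto simp: chart_def)
  then show thesis using that \<eta>(1) by (metis min_less_iff_conj)
qed

text \<open>Continuity is assumed on the closed annulus only. On the ends it follows from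
  non-expansion (\<open>chordal_cont_F\<close>), so infinity requires no separate argument.\<close>

locale attracting_ends =
  fixes F :: "complex option \<Rightarrow> complex option" and r R :: real
  assumes r_pos: "0 < r" and r_less_R: "r < R"
    and ends: "\<And>b. \<exists>b'. nonexp_between r R F b b'"
    and cont_annulus: "\<And>z. r \<le> norm z \<Longrightarrow> norm z \<le> R \<Longrightarrow> chordal_cont F (Some z)"
begin

definition X :: "complex option set" where "X = (\<Union>b. chart r R b ` ball 0 1)"

lemma R_pos: "R > 0" using r_pos r_less_R by simp

lemma Some_in_X_iff: "Some z \<in> X \<longleftrightarrow> norm z < r \<or> norm z > R"
proof -
  have "Some z \<in> chart r R True ` ball 0 1 \<longleftrightarrow> norm z < r"
  proof
    assume "norm z < r"
    then show "Some z \<in> chart r R True ` ball 0 1"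
      using r_pos by (intro image_eqI[of _ _ "z / of_real r"]) (auto simp: chart_def norm_divide)
  qed (use r_pos in \<open>auto simp: chart_def norm_mult\<close>)
  moreover have "Some z \<in> chart r R False ` ball 0 1 \<longleftrightarrow> norm z > R"
  proof
    assume z: "norm z > R"
    then have "z \<noteq> 0" using R_pos by auto
    then show "Some z \<in> chart r R False ` ball 0 1"
      using R_pos z by (intro image_eqI[of _ _ "of_real R / z"]) (auto simp: chart_def norm_divide inv_pt_def)
  next
    assume "Some z \<in> chart r R False ` ball 0 1"
    then obtain u where u: "norm u < 1" "u \<noteq> 0" "z = of_real R / u"
      by (auto simp: chart_def inv_pt_def split: if_splits)
    then have "norm z = R / norm u" using R_pos by (simp add: norm_divide)
    then show "norm z > R" using R_pos u by (simp add: pos_less_divide_eq)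
  qed
  ultimately show ?thesis by (auto simp: X_def UNIV_bool)
qed

lemma None_in_X: "None \<in> X"
proof -
  have "chart r R False 0 = None" by (simp add: chart_def inv_pt_def)
  then show ?thesis unfolding X_def by (metis UN_iff UNIV_I centre_in_ball image_eqI zero_less_one)
qed

lemma ends_funpow: "\<exists>b'. nonexp_between r R (F ^^ k) b b'"
proof (induction k)
  case 0
  have "nonexp_between r R (F ^^ 0) b b"
    unfolding nonexp_between_def by (intro exI[of _ id]) auto
  then show ?case by blast
next
  case (Suc k)
  then obtain b' g where g: "\<forall>u\<in>ball 0 1. g u \<in> ball 0 1 \<and> (F ^^ k) (chart r R b u) = chart r R b' (g u)"
     "\<forall>u\<in>ball 0 1. \<forall>v\<in>ball 0 1. dist (g u) (g v) \<le> dist u v"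
    unfolding nonexp_between_def by blast
  obtain b'' h where h: "\<forall>u\<in>ball 0 1. h u \<in> ball 0 1 \<and> F (chart r R b' u) = chart r R b'' (h u)"
     "\<forall>u\<in>ball 0 1. \<forall>v\<in>ball 0 1. dist (h u) (h v) \<le> dist u v"
    using ends[of b'] unfolding nonexp_between_def by blast
  have "nonexp_between r R (F ^^ Suc k) b b''"
    unfolding nonexp_between_def
  proof (intro exI[of _ "h \<circ> g"] conjI ballI)
    fix u v :: complex assume "u \<in> ball 0 1" "v \<in> ball 0 1"
    then show "dist ((h \<circ> g) u) ((h \<circ> g) v) \<le> dist u v"
      using g h by (metis comp_apply order_trans)
  qed (use g h in auto)
  then show ?case by blast
qed

lemma equicont_X: assumes "w \<in> X" shows "chordal_equicont F w"
  unfolding chordal_equicont_def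
proof (intro allI impI)
  fix e :: real assume "e > 0"
  obtain b u where u: "u \<in> ball 0 1" "w = chart r R b u" using assms by (auto simp: X_def)
  obtain \<eta> where \<eta>: "\<eta> > 0" "\<And>b u v. u \<in> ball 0 1 \<Longrightarrow> v \<in> ball 0 1 \<Longrightarrow> dist u v < \<eta> \<Longrightarrow>
       chordal_dist (chart r R b u) (chart r R b v) < e"
    using chart_uniform[OF \<open>e > 0\<close>] by blast
  obtain \<delta> where \<delta>: "\<delta> > 0"
    "\<And>v. chordal_dist v (chart r R b u) < \<delta> \<Longrightarrow> \<exists>u'\<in>ball 0 1. v = chart r R b u' \<and> dist u' u < \<eta>"
    using chart_near[OF r_pos R_pos u(1) \<eta>(1), where b = b] by blast
  have "chordal_dist ((F ^^ k) v) ((F ^^ k) w) < e" if v: "chordal_dist v w < \<delta>" for k v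
  proof -
    obtain u' where u': "u' \<in> ball 0 1" "v = chart r R b u'" "dist u' u < \<eta>" using \<delta>(2) v u by blast
    obtain b' g where g: "\<forall>u\<in>ball 0 1. g u \<in> ball 0 1 \<and> (F ^^ k) (chart r R b u) = chart r R b' (g u)"
       "\<forall>u\<in>ball 0 1. \<forall>v\<in>ball 0 1. dist (g u) (g v) \<le> dist u v"
      using ends_funpow[of k b] unfolding nonexp_between_def by blast
    have "dist (g u') (g u) < \<eta>" using g(2) u'(1,3) u(1) by (meson order.strict_trans1)
    then show ?thesis using \<eta>(2)[of "g u'" "g u" b'] g(1) u u' by auto
  qed
  then show "\<exists>\<delta>>0. \<forall>k v. chordal_dist v w < \<delta> \<longrightarrow> chordal_dist ((F ^^ k) v) ((F ^^ k) w) < e"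
    using \<delta>(1) by blast
qed

lemma chordal_cont_F: "chordal_cont F w"
proof (cases "w \<in> X")
  case True
  show ?thesis
    unfolding chordal_cont_def
  proof (intro allI impI)
    fix e :: real assume "e > 0"
    then obtain \<delta> where "\<delta> > 0" "\<forall>k v. chordal_dist v w < \<delta> \<longrightarrow> chordal_dist ((F ^^ k) v) ((F ^^ k) w) < e"
      using equicont_X[OF True] unfolding chordal_equicont_def by blast
    from this(1) this(2)[rule_format, of _ 1]
    show "\<exists>\<delta>>0. \<forall>v. chordal_dist v w < \<delta> \<longrightarrow> chordal_dist (F v) (F w) < e" by auto
  qed
next
  case False
  then obtain z where "w = Some z" "r \<le> norm z" "norm z \<le> R"
    using None_in_X Some_in_X_iff by (cases w) (auto simp: not_less)
  then show ?thesis using cont_annulus by simp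
qed

lemma open_X: assumes "w \<in> X" shows "\<exists>\<delta>>0. \<forall>v. chordal_dist v w < \<delta> \<longrightarrow> v \<in> X"
proof -
  obtain b u where u: "u \<in> ball 0 1" "w = chart r R b u" using assms by (auto simp: X_def)
  obtain \<delta> where "\<delta> > 0"
    "\<And>v. chordal_dist v (chart r R b u) < \<delta> \<Longrightarrow> \<exists>u'\<in>ball 0 1. v = chart r R b u' \<and> dist u' u < 1"
    using chart_near[OF r_pos R_pos u(1) zero_less_one, where b = b] by blast
  then show ?thesis unfolding X_def using u by blast
qed

text \<open>Equicontinuity is pulled back along the finite orbit segment. Openness of
  \<open>X\<close> and continuity of the k-th iterate provide the whole neighbourhood that the Fatou
  set demands.\<close>

lemma escaping_fatou: assumes "(F ^^ k) z \<in> X" shows "z \<in> fatou_set F"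
proof -
  have eq: "chordal_equicont F w" if "(F ^^ k) w \<in> X" for k w
    using that
  proof (induction k arbitrary: w)
    case 0
    then show ?case by (simp add: equicont_X)
  next
    case (Suc k)
    then show ?case by (simp add: chordal_equicont_pullback chordal_cont_F funpow_Suc_right del: funpow.simps(2))
  qed
  obtain \<delta> where \<delta>: "\<delta> > 0" "\<And>v. chordal_dist v ((F ^^ k) z) < \<delta> \<Longrightarrow> v \<in> X"
    using open_X[OF assms] by blast
  obtain \<delta>' where "\<delta>' > 0" "\<And>v. chordal_dist v z < \<delta>' \<Longrightarrow> chordal_dist ((F ^^ k) v) ((F ^^ k) z) < \<delta>"
    using chordal_cont_funpow[OF chordal_cont_F, of k z] \<delta>(1) unfolding chordal_cont_def by blast
  then show ?thesis unfolding fatou_set_iff using eq \<delta>(2) by blast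
qed

lemma not_equicont_julia: "\<not> chordal_equicont F z \<Longrightarrow> z \<in> julia_set F"
  unfolding julia_set_def using fatou_set_iff[of z F] by auto

end

section \<open>Circles from an annular iterated function system\<close>

definition vstrip :: "real \<Rightarrow> real \<Rightarrow> complex set" where
  "vstrip lo hi = {w. lo \<le> Re w \<and> Re w \<le> hi}"

lemma closed_vstrip: "closed (vstrip lo hi)"
  unfolding vstrip_def by (intro closed_Collect_conj closed_Collect_le continuous_intros)

lemma convex_vstrip: "convex (vstrip lo hi)"
proof -
  have "vstrip lo hi = Re -` {lo..hi}" by (auto simp: vstrip_def)
  then show ?thesis using convex_linear_vimage[OF bounded_linear.linear[OF bounded_linear_Re]] by simp
qed

abbreviation tau :: complex where "tau \<equiv> 2 * of_real pi * \<i>"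

lemma exp_shift: "exp (w + tau * of_int m) = exp w"
  using exp_plus_2pin[of w m] by (simp add: mult_ac)

lemma exp_eq_shift: "exp w = exp z \<Longrightarrow> \<exists>m::int. w = z + tau * of_int m"
  using exp_eq[of w z] by (auto simp: mult_ac)

text \<open>In logarithmic coordinates the annulus \<open>r \<le> \<bar>z\<bar> \<le> R\<close> is a vertical strip, and \<open>G i\<close> is an inverse branch
  of the \<open>i\<close>-th covering, of signed degree \<open>D i\<close>. The data \<open>sym\<close> and \<open>E\<close> are a full shift on the Cantor set.\<close>

locale annular_ifs = attracting_ends F r R
  for F :: "complex option \<Rightarrow> complex option" and r R :: real +
  fixes n :: nat and D :: "nat \<Rightarrow> int" and G :: "nat \<Rightarrow> complex \<Rightarrow> complex" and c B :: real
    and sym :: "real \<Rightarrow> nat" and E :: "real \<Rightarrow> real"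
  assumes D_ge: "\<And>i. i \<in> {1..n} \<Longrightarrow> 2 \<le> \<bar>D i\<bar>"
    and c_range: "0 \<le> c" "c < 1"
    and G_in: "\<And>i v. i \<in> {1..n} \<Longrightarrow> v \<in> vstrip (ln r) (ln R) \<Longrightarrow> G i v \<in> vstrip (ln r) (ln R)"
    and G_lip: "\<And>i v v'. i \<in> {1..n} \<Longrightarrow> v \<in> vstrip (ln r) (ln R) \<Longrightarrow> v' \<in> vstrip (ln r) (ln R) \<Longrightarrow>
       dist (G i v) (G i v') \<le> c * dist v v'"
    and G_inj: "\<And>i. i \<in> {1..n} \<Longrightarrow> inj_on (G i) (vstrip (ln r) (ln R))"
    and G_shift: "\<And>i v m. i \<in> {1..n} \<Longrightarrow> v \<in> vstrip (ln r) (ln R) \<Longrightarrow>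
       G i (v + tau * of_int (D i * m)) = G i v + tau * of_int m"
    and G_near: "\<And>i v. i \<in> {1..n} \<Longrightarrow> v \<in> vstrip (ln r) (ln R) \<Longrightarrow> norm (G i v - v / of_int (D i)) \<le> B"
    and F_G: "\<And>i v. i \<in> {1..n} \<Longrightarrow> v \<in> vstrip (ln r) (ln R) \<Longrightarrow> F (Some (exp (G i v))) = Some (exp v)"
    and G_disj: "\<And>i j v v'. i \<in> {1..n} \<Longrightarrow> j \<in> {1..n} \<Longrightarrow> v \<in> vstrip (ln r) (ln R) \<Longrightarrow>
       v' \<in> vstrip (ln r) (ln R) \<Longrightarrow> Re (G i v) = Re (G j v') \<Longrightarrow> i = j"
    and G_cover: "\<And>w. w \<in> vstrip (ln r) (ln R) \<Longrightarrow> F (Some (exp w)) \<notin> X \<Longrightarrow>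
       \<exists>i\<in>{1..n}. \<exists>v\<in>vstrip (ln r) (ln R). w = G i v"
    and sym_cont: "continuous_on cantor sym" and E_cont: "continuous_on cantor E"
    and shift_in: "\<And>x. x \<in> cantor \<Longrightarrow> sym x \<in> {1..n} \<and> E x \<in> cantor"
    and shift_onto: "\<And>i y. i \<in> {1..n} \<Longrightarrow> y \<in> cantor \<Longrightarrow> \<exists>x\<in>cantor. sym x = i \<and> E x = y"
    and shift_exp: "\<And>x x'. x \<in> cantor \<Longrightarrow> x' \<in> cantor \<Longrightarrow> sym x = sym x' \<Longrightarrow> 3 * \<bar>x - x'\<bar> \<le> \<bar>E x - E x'\<bar>"
begin

abbreviation "S \<equiv> vstrip (ln r) (ln R)"
abbreviation "Dom \<equiv> cantor \<times> (UNIV :: real set)"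

definition st :: "real \<times> real \<Rightarrow> real \<times> real" where
  "st p = (E (fst p), of_int (D (sym (fst p))) * snd p)"

lemma st_in: "p \<in> Dom \<Longrightarrow> st p \<in> Dom"
  using shift_in by (auto simp: st_def)

lemma st_funpow_in: "p \<in> Dom \<Longrightarrow> (st ^^ k) p \<in> Dom"
  by (induction k) (auto simp del: mem_Times_iff intro: st_in)

text \<open>\<open>Gam k\<close> lifts \<open>t \<mapsto> exp (2 \<pi> i t)\<close> through \<open>k\<close> steps of the itinerary, so that in the limit
  \<open>t \<mapsto> exp (Gamma (x, t))\<close> parametrises the Julia component with itinerary \<open>x\<close>.\<close>

primrec Gam :: "nat \<Rightarrow> real \<times> real \<Rightarrow> complex" where
  "Gam 0 p = of_real (ln r) + tau * of_real (snd p)"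
| "Gam (Suc k) p = G (sym (fst p)) (Gam k (st p))"

lemma sym_in: "p \<in> Dom \<Longrightarrow> sym (fst p) \<in> {1..n}"
  using shift_in by force

lemma Gam_in: "p \<in> Dom \<Longrightarrow> Gam k p \<in> S"
proof (induction k arbitrary: p)
  case 0
  then show ?case using r_pos r_less_R by (simp add: vstrip_def)
next
  case (Suc k)
  then show ?case using G_in[OF sym_in] st_in by simp
qed

lemma Gam_shift: "x \<in> cantor \<Longrightarrow> Gam k (x, t + of_int m) = Gam k (x, t) + tau * of_int m"
proof (induction k arbitrary: x t m)
  case 0
  then show ?case by (simp add: algebra_simps)
next
  case (Suc k)
  have E: "E x \<in> cantor" using shift_in[OF Suc.prems] by simp
  have "st (x, t + of_int m) = (E x, of_int (D (sym x)) * t + of_int (D (sym x) * m))"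
    by (simp add: st_def algebra_simps)
  then have "Gam k (st (x, t + of_int m)) = Gam k (st (x, t)) + tau * of_int (D (sym x) * m)"
    using Suc.IH[OF E] by (simp only: st_def fst_conv snd_conv)
  then show ?case
    using G_shift[OF sym_in Gam_in[OF st_in], of "(x, t)" "(x, t)" k m] Suc.prems by simp
qed

text \<open>A step of the recursion at least halves the previous error, since degrees are at least
  2, and adds \<open>B\<close>; every bound from 2 B upwards is therefore preserved. The second
  summand covers the start at real part ln r.\<close>

definition B1 :: real where "B1 = 2 * B + \<bar>ln r\<bar>"

lemma B_nonneg: "i \<in> {1..n} \<Longrightarrow> 0 \<le> B"
  by (rule order_trans[OF norm_ge_zero G_near[of i "of_real (ln r)"]])
     (use r_pos r_less_R in \<open>auto simp: vstrip_def\<close>)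

lemma Gam_near: "p \<in> Dom \<Longrightarrow> norm (Gam k p - tau * of_real (snd p)) \<le> B1"
proof (induction k arbitrary: p)
  case 0
  then show ?case using B_nonneg[OF sym_in] by (simp add: B1_def)
next
  case (Suc k)
  define d where "d = D (sym (fst p))"
  define v where "v = Gam k (st p)"
  have s: "sym (fst p) \<in> {1..n}" by (rule sym_in[OF Suc.prems])
  have d2: "2 \<le> norm (of_int d :: complex)"
    using D_ge[OF s] unfolding d_def norm_of_int by linarith
  then have d0: "(of_int d :: complex) \<noteq> 0" by auto
  have B1: "0 \<le> B1" using B_nonneg[OF s] by (simp add: B1_def)
  have "norm (v - tau * of_real (snd (st p))) \<le> B1"
    unfolding v_def by (rule Suc.IH[OF st_in[OF Suc.prems]])
  then have "norm (v - tau * of_real (snd (st p))) / norm (of_int d :: complex) \<le> B1 / 2"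
    using d2 B1 by (intro frac_le) auto
  moreover have "(v - tau * of_real (snd (st p))) / of_int d = v / of_int d - tau * of_real (snd p)"
    using d0 by (simp add: st_def d_def diff_divide_distrib)
  ultimately have "norm (v / of_int d - tau * of_real (snd p)) \<le> B1 / 2"
    by (metis norm_divide)
  moreover have "norm (G (sym (fst p)) v - v / of_int d) \<le> B"
    unfolding d_def v_def by (rule G_near[OF s Gam_in[OF st_in[OF Suc.prems]]])
  ultimately have "norm (G (sym (fst p)) v - tau * of_real (snd p)) \<le> B + B1 / 2"
    by (rule norm_diff_triangle_le[rotated])
  moreover have "B + B1 / 2 \<le> B1" by (simp add: B1_def)
  ultimately show ?case by (simp add: v_def)
qed

text \<open>Both initial curves stay within \<open>B1\<close> of the same line, which bounds their
  distance uniformly although the parameter ranges over all reals; every further step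
  contracts.\<close>

lemma Gam_step: "p \<in> Dom \<Longrightarrow> norm (Gam (Suc k) p - Gam k p) \<le> c ^ k * (2 * B1)"
proof (induction k arbitrary: p)
  case 0
  have "norm (Gam 1 p - tau * of_real (snd p)) \<le> B1" "norm (Gam 0 p - tau * of_real (snd p)) \<le> B1"
    by (rule Gam_near[OF 0])+
  then have "norm (Gam 1 p - Gam 0 p) \<le> B1 + B1"
    by (metis norm_diff_triangle_le norm_minus_commute)
  then show ?case by simp
next
  case (Suc k)
  have "norm (Gam (Suc (Suc k)) p - Gam (Suc k) p) \<le> c * norm (Gam (Suc k) (st p) - Gam k (st p))"
    using G_lip[OF sym_in[OF Suc.prems] Gam_in[OF st_in[OF Suc.prems], of "Suc k"] Gam_in[OF st_in[OF Suc.prems], of k]]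
    by (simp add: dist_norm)
  also have "\<dots> \<le> c * (c ^ k * (2 * B1))"
    using c_range Suc.IH[OF st_in[OF Suc.prems]] by (intro mult_left_mono) auto
  finally show ?case by simp
qed

lemma G_cont: "i \<in> {1..n} \<Longrightarrow> continuous_on S (G i)"
  using G_lip c_range by (intro lipschitz_on_continuous_on[of c] lipschitz_onI) auto

lemma Gam_cont: "continuous_on Dom (Gam k)"
proof (induction k)
  case 0
  have "Gam 0 = (\<lambda>p. of_real (ln r) + tau * of_real (snd p))" by (simp add: fun_eq_iff)
  moreover have "continuous_on Dom (\<lambda>p. of_real (ln r) + tau * of_real (snd p))"
    by (rule continuous_on_add[OF continuous_on_const continuous_on_mult[OF continuous_on_const
        continuous_on_of_real[OF continuous_on_snd[OF continuous_on_id]]]])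
  ultimately show ?case by simp
next
  case (Suc k)
  \<comment> \<open>The symbol is locally constant, so the domain is a finite union of closed pieces
    on each of which a single branch \<open>G i\<close> is applied.\<close>
  define U where "U i = (cantor \<inter> sym -` {i}) \<times> (UNIV :: real set)" for i
  have cov: "Dom = (\<Union>i\<in>{1..n}. U i)"
    using shift_in by (auto simp: U_def)
  have "closed (U i)" for i
    unfolding U_def
    by (intro closed_Times continuous_closed_preimage[OF sym_cont compact_imp_closed[OF compact_cantor]]) auto
  moreover have "continuous_on (U i) (Gam (Suc k))" if i: "i \<in> {1..n}" for i
  proof -
    have UD: "U i \<subseteq> Dom" by (auto simp: U_def)
    have "continuous_on (U i) (\<lambda>p. (E (fst p), of_int (D i) * snd p))"
      by (intro continuous_intros continuous_on_compose2[OF E_cont]) (auto simp: U_def)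
    moreover have "(E (fst p), of_int (D i) * snd p) = st p" if "p \<in> U i" for p
      using that by (auto simp: st_def U_def)
    ultimately have "continuous_on (U i) st"
      by (simp cong: continuous_on_cong)
    then have "continuous_on (U i) (\<lambda>p. Gam k (st p))"
      by (rule continuous_on_compose2[OF Suc]) (use UD st_in in blast)
    then have "continuous_on (U i) (\<lambda>p. G i (Gam k (st p)))"
      by (rule continuous_on_compose2[OF G_cont[OF i]]) (use UD st_in Gam_in in blast)
    then show ?thesis
      by (rule continuous_on_eq) (auto simp: U_def)
  qed
  ultimately show ?case
    unfolding cov by (intro continuous_on_closed_Union) auto
qed

text \<open>The limit of \<open>Gam k\<close>, written as a telescoping series so that the geometric
  bound of \<open>Gam_step\<close> gives uniform convergence.\<close>

definition Gamma :: "real \<times> real \<Rightarrow> complex" where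
  "Gamma p = Gam 0 p + (\<Sum>k. Gam (Suc k) p - Gam k p)"

lemma Gam_uniform_limit: "uniform_limit Dom Gam Gamma sequentially"
proof -
  have "summable (\<lambda>k. c ^ k * (2 * B1))"
    using c_range by (intro summable_mult2 summable_geometric) auto
  then have "uniform_limit Dom (\<lambda>k p. \<Sum>i<k. Gam (Suc i) p - Gam i p) (\<lambda>p. \<Sum>i. Gam (Suc i) p - Gam i p) sequentially"
    using Gam_step by (intro Weierstrass_m_test) blast
  then have "uniform_limit Dom (\<lambda>k p. Gam 0 p + (\<Sum>i<k. Gam (Suc i) p - Gam i p)) Gamma sequentially"
    unfolding Gamma_def by (intro uniform_limit_add uniform_limit_const) auto
  moreover have "(\<lambda>k p. Gam 0 p + (\<Sum>i<k. Gam (Suc i) p - Gam i p)) = Gam"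
  proof (intro ext)
    show "Gam 0 p + (\<Sum>i<k. Gam (Suc i) p - Gam i p) = Gam k p" for k p
      unfolding sum_lessThan_telescope[of "\<lambda>i. Gam i p" k] by (simp del: Gam.simps)
  qed
  ultimately show ?thesis by simp
qed

lemma Gam_tendsto: "p \<in> Dom \<Longrightarrow> (\<lambda>k. Gam k p) \<longlonglongrightarrow> Gamma p"
  using Gam_uniform_limit by (rule tendsto_uniform_limitI)

lemma Gamma_in: "p \<in> Dom \<Longrightarrow> Gamma p \<in> S"
  by (rule closed_sequentially[OF closed_vstrip _ Gam_tendsto]) (use Gam_in in auto)

lemma Gamma_shift: assumes "x \<in> cantor" shows "Gamma (x, t + of_int m) = Gamma (x, t) + tau * of_int m"
proof -
  have "(\<lambda>k. Gam k (x, t) + tau * of_int m) \<longlonglongrightarrow> Gamma (x, t) + tau * of_int m"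
    by (intro tendsto_intros Gam_tendsto) (use assms in auto)
  moreover have "(\<lambda>k. Gam k (x, t + of_int m)) \<longlonglongrightarrow> Gamma (x, t + of_int m)"
    by (rule Gam_tendsto) (use assms in auto)
  ultimately show ?thesis
    unfolding Gam_shift[OF assms] using LIMSEQ_unique by blast
qed

lemma Gamma_near: "p \<in> Dom \<Longrightarrow> norm (Gamma p - tau * of_real (snd p)) \<le> B1"
  by (rule LIMSEQ_le_const2[OF tendsto_norm[OF tendsto_diff[OF Gam_tendsto tendsto_const]]])
     (use Gam_near in auto)

lemma Gamma_cont: "continuous_on Dom Gamma"
  by (rule uniform_limit_theorem[OF _ Gam_uniform_limit]) (auto simp: Gam_cont)

lemma Gamma_eq: assumes "p \<in> Dom" shows "Gamma p = G (sym (fst p)) (Gamma (st p))"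
proof -
  have "(\<lambda>k. G (sym (fst p)) (Gam k (st p))) \<longlonglongrightarrow> G (sym (fst p)) (Gamma (st p))"
    by (rule continuous_on_tendsto_compose[OF G_cont[OF sym_in[OF assms]] Gam_tendsto[OF st_in[OF assms]]])
       (use Gamma_in Gam_in st_in assms in auto)
  moreover have "(\<lambda>k. Gam (Suc k) p) \<longlonglongrightarrow> Gamma p"
    using Gam_tendsto[OF assms] by (rule LIMSEQ_Suc)
  ultimately show ?thesis using LIMSEQ_unique by (metis (no_types, lifting) Gam.simps(2) ext)
qed

definition pt :: "real \<times> real \<Rightarrow> complex option" where
  "pt p = Some (exp (Gamma p))"

lemma F_pt: "p \<in> Dom \<Longrightarrow> F (pt p) = pt (st p)"
  unfolding pt_def using Gamma_eq F_G sym_in Gamma_in st_in by metis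

lemma F_funpow_pt: "p \<in> Dom \<Longrightarrow> (F ^^ k) (pt p) = pt ((st ^^ k) p)"
  by (induction k) (auto simp: F_pt st_funpow_in simp del: mem_Times_iff)

lemma pt_shift: "x \<in> cantor \<Longrightarrow> pt (x, t + of_int m) = pt (x, t)"
  by (simp only: pt_def Gamma_shift exp_shift)

text \<open>The signed degree of the k-th iterate on the circle with itinerary
  \<open>x\<close>.\<close>

primrec P :: "nat \<Rightarrow> real \<Rightarrow> int" where
  "P 0 x = 1"
| "P (Suc k) x = D (sym ((E ^^ k) x)) * P k x"

lemma E_funpow_in: "x \<in> cantor \<Longrightarrow> (E ^^ k) x \<in> cantor"
  by (induction k) (use shift_in in auto)

lemma st_funpow: "(st ^^ k) (x, t) = ((E ^^ k) x, of_int (P k x) * t)"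
  by (induction k) (auto simp: st_def)

lemma P_ge: assumes "x \<in> cantor" shows "2 ^ k \<le> \<bar>P k x\<bar>"
proof (induction k)
  case (Suc k)
  have "2 \<le> \<bar>D (sym ((E ^^ k) x))\<bar>" using D_ge shift_in E_funpow_in[OF assms] by blast
  then show ?case using Suc by (simp add: abs_mult mult_mono)
qed simp

lemma P_ge_real: assumes "x \<in> cantor" shows "(2::real) ^ k \<le> \<bar>of_int (P k x)\<bar>"
proof -
  have "of_int (2 ^ k) \<le> (of_int \<bar>P k x\<bar> :: real)"
    using P_ge[OF assms] by (simp only: of_int_le_iff)
  then show ?thesis by simp
qed

lemma P_nonzero: "x \<in> cantor \<Longrightarrow> P k x \<noteq> 0"
  using P_ge_real[of x k] by (metis abs_zero not_le of_int_0 zero_less_numeral zero_less_power)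

lemma pt_eq_itinerary:
  assumes "p \<in> Dom" "q \<in> Dom" "pt p = pt q"
  shows "sym (fst p) = sym (fst q)"
proof -
  have "exp (Gamma p) = exp (Gamma q)" using assms(3) by (simp add: pt_def)
  \<comment> \<open>Equal exponentials determine the logarithm only up to a period, which leaves the
    real part intact; this is why \<open>G_disj\<close> speaks about real parts.\<close>
  then have "Re (Gamma p) = Re (Gamma q)" by (metis exp_eq_polar norm_exp_eq_Re exp_inj_iff)
  then show ?thesis
    using Gamma_eq[OF assms(1)] Gamma_eq[OF assms(2)] G_disj[OF sym_in[OF assms(1)] sym_in[OF assms(2)]]
      Gamma_in st_in assms(1,2) by metis
qed

text \<open>Equal points have equal itineraries. Along a common itinerary \<open>E\<close> triples
  distances at each step, while the Cantor set has diameter at most 1.\<close>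

lemma pt_eq_fst:
  assumes "p \<in> Dom" "q \<in> Dom" "pt p = pt q"
  shows "fst p = fst q"
proof -
  have sy: "sym ((E ^^ k) (fst p)) = sym ((E ^^ k) (fst q))" for k
  proof -
    have "pt ((st ^^ k) p) = pt ((st ^^ k) q)" using assms F_funpow_pt by metis
    then show ?thesis
      using pt_eq_itinerary[OF st_funpow_in[OF assms(1)] st_funpow_in[OF assms(2)]]
      by (metis st_funpow fst_conv prod.collapse)
  qed
  have x: "fst p \<in> cantor" "fst q \<in> cantor" using assms by auto
  have le: "3 ^ k * \<bar>fst p - fst q\<bar> \<le> \<bar>(E ^^ k) (fst p) - (E ^^ k) (fst q)\<bar>" for k
  proof (induction k)
    case (Suc k)
    then have "3 ^ Suc k * \<bar>fst p - fst q\<bar> \<le> 3 * \<bar>(E ^^ k) (fst p) - (E ^^ k) (fst q)\<bar>" by simp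
    also have "\<dots> \<le> \<bar>(E ^^ Suc k) (fst p) - (E ^^ Suc k) (fst q)\<bar>"
      using shift_exp[OF E_funpow_in[OF x(1)] E_funpow_in[OF x(2)] sy] by simp
    finally show ?case .
  qed simp
  have "3 ^ k * \<bar>fst p - fst q\<bar> \<le> 1" for k
  proof -
    have "(E ^^ k) (fst p) \<in> {0..1}" "(E ^^ k) (fst q) \<in> {0..1}"
      using E_funpow_in x cantor_subset by blast+
    then show ?thesis using le[of k] by auto
  qed
  then have small: "\<bar>fst p - fst q\<bar> \<le> (1/3) ^ k" for k
    by (simp add: power_one_over field_simps)
  have "\<bar>fst p - fst q\<bar> \<le> 0"
    by (rule LIMSEQ_le_const[OF LIMSEQ_realpow_zero[of "1/3"]]) (use small in auto)
  then show ?thesis by simp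
qed

text \<open>Under iteration the difference of the arguments grows by the product of the degrees, while \<open>Gamma\<close>
  stays within \<open>B1\<close> of a linear function.\<close>

lemma Gamma_inj:
  assumes "x \<in> cantor" "Gamma (x, t) = Gamma (x, u)"
  shows "t = u"
proof (rule ccontr)
  assume "t \<noteq> u"
  have eq: "Gamma ((st ^^ k) (x, t)) = Gamma ((st ^^ k) (x, u))" for k
  proof (induction k)
    case (Suc k)
    have D: "(st ^^ k) (x, t) \<in> Dom" "(st ^^ k) (x, u) \<in> Dom" using assms(1) by (auto intro!: st_funpow_in simp del: mem_Times_iff)
    have "fst ((st ^^ k) (x, t)) = fst ((st ^^ k) (x, u))" by (simp add: st_funpow)
    then have "G (sym (fst ((st ^^ k) (x, t)))) (Gamma (st ((st ^^ k) (x, t)))) = G (sym (fst ((st ^^ k) (x, t)))) (Gamma (st ((st ^^ k) (x, u))))"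
      using Gamma_eq[OF D(1)] Gamma_eq[OF D(2)] Suc by simp
    from inj_onD[OF G_inj[OF sym_in[OF D(1)]] this Gamma_in[OF st_in[OF D(1)]] Gamma_in[OF st_in[OF D(2)]]]
    show ?case by simp
  qed (use assms in simp)
  have le: "2 * pi * 2 ^ k * \<bar>t - u\<bar> \<le> 2 * B1" for k
  proof -
    have D: "(st ^^ k) (x, t) \<in> Dom" "(st ^^ k) (x, u) \<in> Dom" using assms(1) by (auto intro!: st_funpow_in simp del: mem_Times_iff)
    have "norm (tau * of_real (of_int (P k x) * t) - tau * of_real (of_int (P k x) * u)) \<le> B1 + B1"
      using Gamma_near[OF D(1)] Gamma_near[OF D(2)] eq[of k] unfolding st_funpow snd_conv
      by (metis norm_diff_triangle_le norm_minus_commute)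
    also have "tau * of_real (of_int (P k x) * t) - tau * of_real (of_int (P k x) * u) = tau * of_real (of_int (P k x) * (t - u))"
      by (simp add: algebra_simps)
    finally have "2 * pi * \<bar>of_int (P k x) * (t - u)\<bar> \<le> 2 * B1"
      by (simp only: norm_mult norm_of_real) simp
    then have "2 * pi * (\<bar>of_int (P k x)\<bar> * \<bar>t - u\<bar>) \<le> 2 * B1"
      by (simp only: abs_mult)
    moreover have "2 ^ k * \<bar>t - u\<bar> \<le> \<bar>of_int (P k x)\<bar> * \<bar>t - u\<bar>"
      using P_ge_real[OF assms(1), of k] by (intro mult_right_mono) auto
    then have "2 * pi * (2 ^ k * \<bar>t - u\<bar>) \<le> 2 * pi * (\<bar>of_int (P k x)\<bar> * \<bar>t - u\<bar>)"
      by (intro mult_left_mono) auto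
    ultimately show ?thesis by linarith
  qed
  have "0 < 2 * pi * \<bar>t - u\<bar>" using \<open>t \<noteq> u\<close> by simp
  moreover obtain k where "2 * B1 / (2 * pi * \<bar>t - u\<bar>) < 2 ^ k"
    using real_arch_pow[of 2 "2 * B1 / (2 * pi * \<bar>t - u\<bar>)"] by auto
  ultimately have "2 * B1 < 2 ^ k * (2 * pi * \<bar>t - u\<bar>)" by (simp only: pos_divide_less_eq)
  then show False using le[of k] by (simp add: mult_ac)
qed

lemma pt_eq_iff:
  assumes "x \<in> cantor" "y \<in> cantor"
  shows "pt (x, t) = pt (y, u) \<longleftrightarrow> x = y \<and> (\<exists>m::int. t = u + of_int m)"
proof
  assume e: "pt (x, t) = pt (y, u)"
  then have xy: "x = y" using pt_eq_fst[of "(x, t)" "(y, u)"] assms by simp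
  obtain m :: int where "Gamma (x, t) = Gamma (y, u) + tau * of_int m"
    using e exp_eq_shift by (auto simp: pt_def)
  then have "Gamma (x, t) = Gamma (x, u + of_int m)" using xy Gamma_shift assms by simp
  then show "x = y \<and> (\<exists>m::int. t = u + of_int m)" using xy Gamma_inj assms by blast
qed (use assms pt_shift in auto)

lemma pt_cont: "continuous_on Dom (\<lambda>p. to_sphere (pt p))"
  unfolding pt_def
  by (rule continuous_on_compose2[OF continuous_on_to_sphere_Some[of UNIV]])
     (auto intro!: continuous_intros Gamma_cont)

section \<open>The set of non-escaping points is the Julia set\<close>

definition Lam :: "complex option set" where "Lam = pt ` (cantor \<times> {0..1})"

lemma Lam_eq: "Lam = pt ` Dom"
proof -
  have "pt (x, t) \<in> Lam" if "x \<in> cantor" for x t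
  proof -
    have "pt (x, t) = pt (x, frac t)"
      using pt_shift[OF that, of "frac t" "\<lfloor>t\<rfloor>"] by (simp add: frac_def)
    then show ?thesis unfolding Lam_def using that frac_ge_0[of t] frac_lt_1[of t] by (auto intro!: imageI)
  qed
  then show ?thesis unfolding Lam_def by auto
qed

text \<open>The orbit lifts to points \<open>w k\<close> linked by inverse branches. A parameter
  point sharing the first m symbols, whose m-th iterate lies at bounded distance from
  \<open>w m\<close>, is contracted to within c^m M of \<open>w 0\<close>; the image of
  \<open>Lam\<close> on the sphere is closed, so the limit belongs to it.\<close>

lemma stay_in_Lam:
  assumes stay: "\<And>k. (F ^^ k) z \<notin> X"
  shows "z \<in> Lam"
proof -
  have "\<exists>w. w \<in> S \<and> z = Some (exp w)"
  proof -
    obtain y where y: "z = Some y" using stay[of 0] None_in_X by (cases z) auto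
    then have n: "r \<le> norm y" "norm y \<le> R" using stay[of 0] by (auto simp: Some_in_X_iff)
    then have y0: "y \<noteq> 0" using r_pos by auto
    then show ?thesis
      using n y r_pos by (intro exI[of _ "Ln y"]) (simp add: vstrip_def ln_le_cancel_iff)
  qed
  then obtain w0 where w0: "w0 \<in> S" "z = Some (exp w0)" by blast
  \<comment> \<open>Each lift is chosen as the argument of the branch through the preceding one, so
    that consecutive lifts satisfy the branch equation exactly and not merely up to a
    period.\<close>
  have "\<exists>w. \<forall>k. (w k \<in> S \<and> (F ^^ k) z = Some (exp (w k))) \<and> (\<exists>i\<in>{1..n}. w k = G i (w (Suc k)))"
  proof (rule dependent_nat_choice)
    show "\<exists>w. w \<in> S \<and> (F ^^ 0) z = Some (exp w)" using w0 by auto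
  next
    fix w k assume w: "w \<in> S \<and> (F ^^ k) z = Some (exp w)"
    then have F: "(F ^^ Suc k) z = F (Some (exp w))" by simp
    then obtain i v where v: "i \<in> {1..n}" "v \<in> S" "w = G i v" using G_cover[of w] w stay[of "Suc k"] by metis
    then show "\<exists>v. (v \<in> S \<and> (F ^^ Suc k) z = Some (exp v)) \<and> (\<exists>i\<in>{1..n}. w = G i v)"
      unfolding F using F_G[OF v(1,2)] by blast
  qed
  then obtain w where "\<forall>k. (w k \<in> S \<and> (F ^^ k) z = Some (exp (w k))) \<and> (\<exists>i\<in>{1..n}. w k = G i (w (Suc k)))" ..
  then obtain i where w: "\<And>k. w k \<in> S" "\<And>k. (F ^^ k) z = Some (exp (w k))"
    and i: "\<And>k. i k \<in> {1..n}" "\<And>k. w k = G (i k) (w (Suc k))"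
    by metis
  have "\<exists>x\<in>cantor. \<forall>k<m. sym ((E ^^ k) x) = j k" if "\<And>k. j k \<in> {1..n}" for m and j :: "nat \<Rightarrow> nat"
    using that
  proof (induction m arbitrary: j)
    case 0
    then show ?case using zero_in_cantor by auto
  next
    case (Suc m)
    obtain y where y: "y \<in> cantor" "\<forall>k<m. sym ((E ^^ k) y) = j (Suc k)"
      using Suc.IH[of "\<lambda>k. j (Suc k)"] Suc.prems by blast
    obtain x where x: "x \<in> cantor" "sym x = j 0" "E x = y" using shift_onto[OF Suc.prems y(1)] by blast
    have "sym ((E ^^ k) x) = j k" if "k < Suc m" for k
      using that x y(2) by (cases k) (simp_all add: funpow_Suc_right del: funpow.simps(2))
    then show ?case using x(1) by blast
  qed
  then have "\<exists>x\<in>cantor. \<forall>k<m. sym ((E ^^ k) x) = i k" for m using i(1) by blast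
  then obtain x where x: "\<And>m. x m \<in> cantor" "\<And>m k. k < m \<Longrightarrow> sym ((E ^^ k) (x m)) = i k"
    by metis
  define t where "t m = Im (w m) / (2 * pi * of_int (P m (x m)))" for m
  define M where "M = B1 + (\<bar>ln r\<bar> + \<bar>ln R\<bar>)"
  define p where "p m = (x m, t m)" for m
  have pD: "p m \<in> Dom" for m using x(1) by (simp add: p_def)
  have close: "dist (Gamma ((st ^^ m) (p m))) (w m) \<le> M" for m
  proof -
    have "P m (x m) \<noteq> 0" by (rule P_nonzero[OF x(1)])
    then have "of_int (P m (x m)) * t m = Im (w m) / (2 * pi)" by (simp add: t_def)
    then have "tau * of_real (snd ((st ^^ m) (p m))) = \<i> * of_real (Im (w m))"
      by (simp add: p_def st_funpow)
    then have "norm (Gamma ((st ^^ m) (p m)) - \<i> * of_real (Im (w m))) \<le> B1"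
      using Gamma_near[OF st_funpow_in[OF pD]] by metis
    moreover have "norm (\<i> * of_real (Im (w m)) - w m) \<le> \<bar>ln r\<bar> + \<bar>ln R\<bar>"
    proof -
      have "\<i> * of_real (Im (w m)) - w m = of_real (- Re (w m))" by (simp add: complex_eq_iff)
      then have "norm (\<i> * of_real (Im (w m)) - w m) = \<bar>Re (w m)\<bar>" by (metis norm_of_real abs_minus)
      then show ?thesis using w(1)[of m] by (auto simp: vstrip_def)
    qed
    ultimately show ?thesis unfolding M_def dist_norm by (rule norm_diff_triangle_le)
  qed
  have contr: "dist (Gamma (p m)) (w 0) \<le> c ^ k * dist (Gamma ((st ^^ k) (p m))) (w k)" if "k \<le> m" for k m
    using that
  proof (induction k)
    case (Suc k)
    let ?q = "(st ^^ k) (p m)"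
    have q: "?q \<in> Dom" by (rule st_funpow_in[OF pD])
    have "sym (fst ?q) = i k" using x(2)[of k m] Suc.prems by (simp add: p_def st_funpow)
    then have "dist (Gamma ?q) (w k) \<le> c * dist (Gamma (st ?q)) (w (Suc k))"
      using Gamma_eq[OF q] i(2)[of k] G_lip[OF i(1)[of k] Gamma_in[OF st_in[OF q]] w(1)[of "Suc k"]] by metis
    then have "c ^ k * dist (Gamma ?q) (w k) \<le> c ^ k * (c * dist (Gamma (st ?q)) (w (Suc k)))"
      using c_range by (intro mult_left_mono) auto
    then show ?case using Suc by (simp add: mult_ac)
  qed simp
  have bnd: "dist (Gamma (p m)) (w 0) \<le> c ^ m * M" for m
    using contr[of m m] mult_left_mono[OF close[of m], of "c ^ m"] c_range by force
  have "(\<lambda>m. c ^ m * M) \<longlonglongrightarrow> 0"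
    using c_range by (intro tendsto_mult_left_zero LIMSEQ_power_zero) auto
  then have "(\<lambda>m. dist (Gamma (p m)) (w 0)) \<longlonglongrightarrow> 0"
    by (rule Lim_null_comparison[rotated]) (use bnd in auto)
  then have "(\<lambda>m. Gamma (p m)) \<longlonglongrightarrow> w 0" by (rule tendsto_dist_iff[THEN iffD2])
  then have "(\<lambda>m. exp (Gamma (p m))) \<longlonglongrightarrow> exp (w 0)" by (rule tendsto_exp)
  then have lim: "(\<lambda>m. to_sphere (pt (p m))) \<longlonglongrightarrow> to_sphere (Some (exp (w 0)))"
    unfolding pt_def by (rule continuous_on_tendsto_compose[OF continuous_on_to_sphere_Some[of UNIV]]) auto
  have "closed (to_sphere ` Lam)"
    unfolding Lam_def image_image
    by (intro compact_imp_closed compact_continuous_image continuous_on_subset[OF pt_cont] compact_Times compact_cantor) auto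
  moreover have "to_sphere (pt (p m)) \<in> to_sphere ` Lam" for m unfolding Lam_eq using pD by blast
  ultimately have "to_sphere (Some (exp (w 0))) \<in> to_sphere ` Lam"
    using lim by (meson closed_sequentially)
  then have "Some (exp (w 0)) \<in> Lam" by (auto simp: Lam_def pt_def)
  then show ?thesis using w(2)[of 0] by simp
qed

text \<open>Points on one circle at parameter distance \<open>1 / (2 P)\<close> are moved to antipodal parameters.\<close>

lemma not_equicont_Lam: assumes "z \<in> Lam" shows "\<not> chordal_equicont F z"
proof -
  \<comment> \<open>The distance between points with antipodal parameters. They are always distinct,
    so compactness bounds it away from 0 over all circles at once.\<close>
  define h where "h p = dist (to_sphere (pt p)) (to_sphere (pt (fst p, snd p + 1/2)))" for p
  have "continuous_on (cantor \<times> {0..1}) h"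
    unfolding h_def
    by (intro continuous_on_dist continuous_on_subset[OF pt_cont] continuous_on_compose2[OF pt_cont] continuous_intros) auto
  moreover have "compact (cantor \<times> {0..1::real})" "cantor \<times> {0..1::real} \<noteq> {}"
    using zero_in_cantor by (auto intro!: compact_Times compact_cantor)
  ultimately obtain p0 where p0: "p0 \<in> cantor \<times> {0..1}" "\<And>p. p \<in> cantor \<times> {0..1} \<Longrightarrow> h p0 \<le> h p"
    using continuous_attains_inf[of "cantor \<times> {0..1}" h] by blast
  have "h p0 \<noteq> 0"
  proof
    assume "h p0 = 0"
    then have "pt (fst p0, snd p0) = pt (fst p0, snd p0 + 1/2)" by (simp add: h_def pt_def)
    then obtain m :: int where "snd p0 = snd p0 + 1/2 + of_int m" using pt_eq_iff p0(1) by fastforce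
    then have "of_int (2 * m + 1) = (0 :: real)" by simp
    then have "2 * m + 1 = 0" by (simp only: of_int_eq_0_iff)
    then show False by presburger
  qed
  then have h0: "h p0 > 0" by (simp add: h_def)
  have h_ge: "h p0 \<le> h (x, t)" if "x \<in> cantor" for x t
  proof -
    have "h (x, t) = h (x, frac t)"
      using pt_shift[OF that, of "frac t" "\<lfloor>t\<rfloor>"] pt_shift[OF that, of "frac t + 1/2" "\<lfloor>t\<rfloor>"]
      by (simp add: h_def frac_def algebra_simps)
    then show ?thesis using p0(2)[of "(x, frac t)"] that frac_ge_0[of t] frac_lt_1[of t] by simp
  qed
  obtain x t where xt: "x \<in> cantor" "z = pt (x, t)" using assms by (auto simp: Lam_def)
  define u where "u k = t + 1 / (2 * of_int (P k x))" for k
  have P0: "P k x \<noteq> 0" for k by (rule P_nonzero[OF xt(1)])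
  have "\<bar>u k - t\<bar> \<le> (1/2) ^ k" for k
  proof -
    define a :: real where "a = 1 / \<bar>of_int (P k x)\<bar>"
    have "a \<le> 1 / (2::real) ^ k"
      unfolding a_def using P_ge_real[OF xt(1), of k] by (intro divide_left_mono) (auto simp: P0)
    moreover have "\<bar>u k - t\<bar> = a / 2" by (simp add: u_def abs_mult a_def)
    moreover have "0 \<le> a" by (simp add: a_def)
    ultimately show ?thesis unfolding power_one_over by linarith
  qed
  then have "(\<lambda>k. u k - t) \<longlonglongrightarrow> 0"
    by (intro Lim_null_comparison[OF _ LIMSEQ_realpow_zero[of "1/2"]]) auto
  then have "u \<longlonglongrightarrow> t" by (simp add: LIM_zero_cancel)
  then have "(\<lambda>k. (x, u k)) \<longlonglongrightarrow> (x, t)" by (intro tendsto_intros)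
  then have lim: "(\<lambda>k. to_sphere (pt (x, u k))) \<longlonglongrightarrow> to_sphere (pt (x, t))"
    by (rule continuous_on_tendsto_compose[OF pt_cont]) (use xt in auto)
  have far: "h p0 \<le> chordal_dist ((F ^^ k) (pt (x, u k))) ((F ^^ k) z)" for k
  proof -
    have "(F ^^ k) (pt (x, u k)) = pt ((E ^^ k) x, of_int (P k x) * t + 1/2)"
      using P0[of k] xt by (simp add: F_funpow_pt st_funpow u_def distrib_left)
    moreover have "(F ^^ k) z = pt ((E ^^ k) x, of_int (P k x) * t)"
      using xt by (simp add: F_funpow_pt st_funpow)
    ultimately show ?thesis
      using h_ge[OF E_funpow_in[OF xt(1)], of k "of_int (P k x) * t"]
      by (simp add: h_def chordal_dist_def dist_commute)
  qed
  show ?thesis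
  proof
    assume "chordal_equicont F z"
    then obtain \<delta> where \<delta>: "\<delta> > 0"
      "\<And>k v. chordal_dist v z < \<delta> \<Longrightarrow> chordal_dist ((F ^^ k) v) ((F ^^ k) z) < h p0"
      using h0 unfolding chordal_equicont_def by blast
    have "\<forall>\<^sub>F k in sequentially. chordal_dist (pt (x, u k)) z < \<delta>"
      using tendstoD[OF lim \<delta>(1)] xt by (simp add: chordal_dist_def)
    then obtain k where "chordal_dist (pt (x, u k)) z < \<delta>"
      by (meson eventually_sequentially order_refl)
    then show False using \<delta>(2)[of "pt (x, u k)" k] far[of k] by simp
  qed
qed

lemma julia_eq_Lam: "julia_set F = Lam"
proof
  show "Lam \<subseteq> julia_set F" using not_equicont_Lam not_equicont_julia by blast
  show "julia_set F \<subseteq> Lam" using stay_in_Lam escaping_fatou unfolding julia_set_def by blast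
qed

text \<open>Both spaces are quotients of the Cantor set times [0,1] by the same relation: equal
  first coordinates, second coordinates differing by an integer.\<close>

lemma cantor_circles: "cantor_set_of_circles (julia_set F)"
proof -
  define q where "q p = (fst p, exp (tau * of_real (snd p)))" for p :: "real \<times> real"
  let ?P = "cantor \<times> {0..1::real}"
  have "q ` ?P homeomorphic (\<lambda>p. to_sphere (pt p)) ` ?P"
  proof (rule homeomorphic_same_fibres)
    show "compact ?P" by (intro compact_Times compact_cantor) auto
    show "continuous_on ?P q" unfolding q_def by (intro continuous_intros)
    show "continuous_on ?P (\<lambda>p. to_sphere (pt p))" by (rule continuous_on_subset[OF pt_cont]) auto
  next
    fix p p' assume p: "p \<in> ?P" "p' \<in> ?P"
    have "exp (tau * of_real (snd p)) = exp (tau * of_real (snd p')) \<longleftrightarrow> (\<exists>m::int. snd p = snd p' + of_int m)"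
    proof
      assume "exp (tau * of_real (snd p)) = exp (tau * of_real (snd p'))"
      then obtain m :: int where "tau * of_real (snd p) = tau * of_real (snd p') + tau * of_int m"
        using exp_eq_shift by blast
      then have "tau * of_real (snd p) = tau * of_real (snd p' + of_int m)" by (simp add: distrib_left)
      then have "complex_of_real (snd p) = of_real (snd p' + of_int m)"
        by (subst (asm) mult_cancel_left) simp
      then show "\<exists>m::int. snd p = snd p' + of_int m" by (simp only: of_real_eq_iff) blast
    next
      assume "\<exists>m::int. snd p = snd p' + of_int m"
      then obtain m :: int where "tau * of_real (snd p) = tau * of_real (snd p') + tau * of_int m"
        by (auto simp: distrib_left)
      then show "exp (tau * of_real (snd p)) = exp (tau * of_real (snd p'))" by (simp only: exp_shift)
    qed
    moreover have "to_sphere (pt p) = to_sphere (pt p') \<longleftrightarrow> pt p = pt p'" by (simp add: pt_def)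
    ultimately show "q p = q p' \<longleftrightarrow> to_sphere (pt p) = to_sphere (pt p')"
      using pt_eq_iff[of "fst p" "fst p'" "snd p" "snd p'"] p by (auto simp: q_def)
  qed
  moreover have "(\<lambda>p. to_sphere (pt p)) ` ?P = to_sphere ` Lam" by (simp add: Lam_def image_image)
  moreover have "q ` ?P = cantor \<times> sphere 0 1"
  proof
    show "q ` ?P \<subseteq> cantor \<times> sphere 0 1" by (auto simp: q_def norm_exp_eq_Re)
    show "cantor \<times> sphere 0 1 \<subseteq> q ` ?P"
    proof clarify
      fix x :: real and \<zeta> :: complex assume x: "x \<in> cantor" and "\<zeta> \<in> sphere 0 1"
      then have "\<zeta> = exp (\<i> * of_real (Arg2pi \<zeta>))" using Arg2pi_eq[of \<zeta>] by simp
      then have "\<zeta> = exp (tau * of_real (Arg2pi \<zeta> / (2 * pi)))" by (simp add: mult_ac)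
      moreover have "Arg2pi \<zeta> / (2 * pi) \<in> {0..1}"
        using Arg2pi_ge_0[of \<zeta>] Arg2pi_lt_2pi[of \<zeta>] by (simp add: divide_simps)
      ultimately show "(x, \<zeta>) \<in> q ` ?P"
        using x by (intro image_eqI[of _ _ "(x, Arg2pi \<zeta> / (2 * pi))"]) (auto simp: q_def)
    qed
  qed
  ultimately show ?thesis
    unfolding cantor_set_of_circles_def julia_eq_Lam using homeomorphic_sym by metis
qed

end

section \<open>Perturbed monomials\<close>

text \<open>The induction splits t into x = |y j| and t - x and uses (1 - x)(1 - (t - x)) >= 1 - t.
  Exponent -1 costs no more than +1, as 1 - x <= 1 / (1 + x) and 1 + x <= 1 / (1 - x).\<close>

lemma norm_prod_one_minus_powi:
  fixes y :: "'i \<Rightarrow> complex" and s :: "'i \<Rightarrow> int"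
  assumes "finite J" "\<And>j. j \<in> J \<Longrightarrow> s j = 1 \<or> s j = -1" "(\<Sum>j\<in>J. norm (y j)) \<le> t" "t < 1"
  shows "1 - t \<le> norm (\<Prod>j\<in>J. (1 - y j) powi s j)"
    and "norm (\<Prod>j\<in>J. (1 - y j) powi s j) \<le> 1 / (1 - t)"
proof -
  have "1 - t \<le> norm (\<Prod>j\<in>J. (1 - y j) powi s j) \<and> norm (\<Prod>j\<in>J. (1 - y j) powi s j) \<le> 1 / (1 - t)"
    using assms
  proof (induction J arbitrary: t rule: finite_induct)
    case empty
    then show ?case by simp
  next
    case (insert j J)
    let ?P = "norm (\<Prod>j\<in>J. (1 - y j) powi s j)"
    define x where "x = norm (y j)"
    have x: "0 \<le> x" "x < 1" "x \<le> t" and s: "s j = 1 \<or> s j = -1"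
      using insert.prems insert.hyps sum_nonneg[of J "\<lambda>j. norm (y j)"] by (auto simp: x_def)
    have P: "1 - (t - x) \<le> ?P" "?P \<le> 1 / (1 - (t - x))"
    proof -
      have "t - x < 1" using x(1) insert.prems(3) by linarith
      moreover have "(\<Sum>j\<in>J. norm (y j)) \<le> t - x"
        using insert.prems(2) insert.hyps by (simp add: x_def)
      ultimately show "1 - (t - x) \<le> ?P" "?P \<le> 1 / (1 - (t - x))"
        using insert.IH[of "t - x"] insert.prems(1) by auto
    qed
    have lo: "1 - x \<le> norm (1 - y j)" "norm (1 - y j) \<le> 1 + x"
      using norm_triangle_ineq2[of 1 "y j"] norm_triangle_ineq4[of 1 "y j"] by (simp_all add: x_def)
    have "1 + x \<le> 1 / (1 - x)" "1 - x \<le> 1 / (1 + x)" using x by (auto simp: field_simps)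
    moreover have "1 / (1 + x) \<le> 1 / norm (1 - y j)" "1 / norm (1 - y j) \<le> 1 / (1 - x)"
      using lo x by (auto intro!: divide_left_mono mult_pos_pos)
    ultimately have q: "1 - x \<le> norm ((1 - y j) powi s j)" "norm ((1 - y j) powi s j) \<le> 1 / (1 - x)"
      using s lo by (auto simp: norm_inverse divide_inverse power_int_minus norm_power_int)
    have m: "1 - t \<le> (1 - x) * (1 - (t - x))"
      using x mult_nonneg_nonneg[of x "t - x"] by (simp add: algebra_simps)
    have "norm ((1 - y j) powi s j) * ?P \<le> 1 / (1 - x) * (1 / (1 - (t - x)))"
      using q P x by (intro mult_mono) auto
    also have "\<dots> \<le> 1 / (1 - t)"
      using m insert.prems(3) x by (simp add: divide_left_mono)
    finally have "norm ((1 - y j) powi s j) * ?P \<le> 1 / (1 - t)" .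
    moreover have "(1 - x) * (1 - (t - x)) \<le> norm ((1 - y j) powi s j) * ?P"
      using q P x insert.prems(3) by (intro mult_mono) auto
    ultimately show ?case using insert.hyps m by (simp add: norm_mult)
  qed
  then show "1 - t \<le> norm (\<Prod>j\<in>J. (1 - y j) powi s j)"
    "norm (\<Prod>j\<in>J. (1 - y j) powi s j) \<le> 1 / (1 - t)" by auto
qed

lemma exp_sum_Ln:
  fixes y :: "'i \<Rightarrow> complex" and s :: "'i \<Rightarrow> int"
  assumes "finite J" "\<And>j. j \<in> J \<Longrightarrow> norm (y j) < 1"
  shows "exp (\<Sum>j\<in>J. of_int (s j) * Ln (1 - y j)) = (\<Prod>j\<in>J. (1 - y j) powi s j)"
proof -
  have "exp (of_int (s j) * Ln (1 - y j)) = (1 - y j) powi s j" if "j \<in> J" for j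
  proof -
    have "y j \<noteq> 1" using assms(2)[OF that] by auto
    then have "1 - y j = exp (Ln (1 - y j))" by (simp add: exp_Ln)
    then show ?thesis by (metis exp_power_int mult.commute)
  qed
  then show ?thesis using assms(1) by (simp add: exp_sum)
qed

lemma one_minus_notin_nonpos: "norm (y :: complex) < 1 \<Longrightarrow> 1 - y \<notin> \<real>\<^sub>\<le>\<^sub>0"
  using abs_Re_le_cmod[of y] by (auto simp: complex_nonpos_Reals_iff)

text \<open>With the product written as exp H, the derivative is c u^(dd-1) exp(H) (dd + u H').
  Smallness of \<open>k\<close> gives |H'| <= 1/10 and |exp H| <= 11/10, and the condition on
  \<open>c\<close> then bounds the derivative by 1; since g 0 = 0, the disc is preserved.\<close>

lemma disc_map:
  fixes \<beta> :: "'i \<Rightarrow> complex" and s :: "'i \<Rightarrow> int" and N :: "'i \<Rightarrow> nat" and c :: complex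
  assumes J: "finite J" and s: "\<And>j. j \<in> J \<Longrightarrow> s j = 1 \<or> s j = -1"
    and N: "\<And>j. j \<in> J \<Longrightarrow> 1 \<le> N j \<and> real (N j) \<le> M"
    and \<beta>: "\<And>j. j \<in> J \<Longrightarrow> norm (\<beta> j) \<le> k"
    and k: "0 \<le> k" "20 * real (card J) * M * k \<le> 1" "k \<le> 1/10" "1 \<le> M"
    and dd: "1 \<le> dd" and c: "norm c * ((real dd + 1/10) * (11/10)) \<le> 1"
  defines "g \<equiv> \<lambda>u. c * u ^ dd * (\<Prod>j\<in>J. (1 - (u * \<beta> j) ^ N j) powi s j)"
  shows "\<And>u v. u \<in> ball 0 1 \<Longrightarrow> v \<in> ball 0 1 \<Longrightarrow> dist (g u) (g v) \<le> dist u v"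
    and "\<And>u. u \<in> ball 0 1 \<Longrightarrow> g u \<in> ball 0 1"
proof -
  define H where "H u = (\<Sum>j\<in>J. of_int (s j) * Ln (1 - (u * \<beta> j) ^ N j))" for u
  define H' where "H' u = (\<Sum>j\<in>J. of_int (s j) * (- (of_nat (N j) * (u * \<beta> j) ^ (N j - 1) * \<beta> j) / (1 - (u * \<beta> j) ^ N j)))" for u
  \<comment> \<open>The value 1/11 is chosen because 1 / (1 - 1/11) = 11/10.\<close>
  have cardk: "real (card J) * k \<le> 1/11"
  proof -
    have "real (card J) * k * 1 \<le> real (card J) * k * M" using k by (intro mult_left_mono) auto
    then show ?thesis using k(2) by (simp add: mult_ac)
  qed
  have y: "norm ((u * \<beta> j) ^ m) \<le> k" "norm ((u * \<beta> j) ^ m) < 1" if "u \<in> ball 0 1" "j \<in> J" "1 \<le> m" for u j m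
  proof -
    have "norm (u * \<beta> j) \<le> 1 * k"
      unfolding norm_mult using that \<beta> by (intro mult_mono) auto
    then have "norm (u * \<beta> j) ^ m \<le> k ^ m" by (intro power_mono) auto
    also have "k ^ m \<le> k ^ 1" using k that by (intro power_decreasing) auto
    finally show "norm ((u * \<beta> j) ^ m) \<le> k" by (simp add: norm_power)
    then show "norm ((u * \<beta> j) ^ m) < 1" using k by linarith
  qed
  have g_exp: "g u = c * u ^ dd * exp (H u)" if "u \<in> ball 0 1" for u
    unfolding g_def H_def using exp_sum_Ln[OF J, of "\<lambda>j. (u * \<beta> j) ^ N j" s] y[OF that] N by simp
  have H_deriv: "(H has_field_derivative H' u) (at u)" if u: "u \<in> ball 0 1" for u
    unfolding H_def H'_def
  proof (rule DERIV_sum)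
    fix j assume j: "j \<in> J"
    then have "1 - (u * \<beta> j) ^ N j \<notin> \<real>\<^sub>\<le>\<^sub>0" using N[OF j] by (intro one_minus_notin_nonpos y(2)[OF u j]) auto
    then show "((\<lambda>u. of_int (s j) * Ln (1 - (u * \<beta> j) ^ N j)) has_field_derivative
        of_int (s j) * (- (of_nat (N j) * (u * \<beta> j) ^ (N j - 1) * \<beta> j) / (1 - (u * \<beta> j) ^ N j))) (at u)"
      by (auto intro!: derivative_eq_intros simp: divide_inverse mult_ac)
  qed
  have expH: "norm (exp (H u)) \<le> 11/10" if u: "u \<in> ball 0 1" for u
  proof -
    have "(\<Sum>j\<in>J. norm ((u * \<beta> j) ^ N j)) \<le> (\<Sum>j\<in>J. k)"
      using y[OF u] N by (intro sum_mono) auto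
    then have "(\<Sum>j\<in>J. norm ((u * \<beta> j) ^ N j)) \<le> 1/11" using cardk by simp
    from norm_prod_one_minus_powi(2)[OF J s this] show ?thesis
      unfolding H_def using exp_sum_Ln[OF J, of "\<lambda>j. (u * \<beta> j) ^ N j" s] y(2)[OF u] N by simp
  qed
  have H'_le: "norm (H' u) \<le> 1/10" if u: "u \<in> ball 0 1" for u
  proof -
    have "norm (of_int (s j) * (- (of_nat (N j) * (u * \<beta> j) ^ (N j - 1) * \<beta> j) / (1 - (u * \<beta> j) ^ N j))) \<le> 2 * M * k"
      if j: "j \<in> J" for j
    proof -
      have "norm ((u * \<beta> j) ^ (N j - 1)) \<le> 1"
        using y(2)[OF u j, of "N j - 1"] by (cases "N j - 1 = 0") (auto intro: less_imp_le)
      then have "real (N j) * norm ((u * \<beta> j) ^ (N j - 1)) * norm (\<beta> j) \<le> M * 1 * k"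
        using N[OF j] \<beta>[OF j] k by (intro mult_mono) auto
      moreover have "1/2 \<le> norm (1 - (u * \<beta> j) ^ N j)"
        using norm_triangle_ineq2[of 1 "(u * \<beta> j) ^ N j"] y(1)[OF u j, of "N j"] N[OF j] k by simp
      ultimately have "real (N j) * norm ((u * \<beta> j) ^ (N j - 1)) * norm (\<beta> j) / norm (1 - (u * \<beta> j) ^ N j) \<le> (M * k) / (1/2)"
        using k by (intro frac_le) auto
      then show ?thesis using s[OF j] by (auto simp: norm_mult norm_divide)
    qed
    then have "norm (H' u) \<le> (\<Sum>j\<in>J. 2 * M * k)" unfolding H'_def by (rule sum_norm_le)
    also have "\<dots> = 2 * (real (card J) * M * k)" by simp
    also have "\<dots> \<le> 1/10" using k(2) by linarith
    finally show ?thesis .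
  qed
  have g_deriv: "((\<lambda>u. c * u ^ dd * exp (H u)) has_field_derivative
      c * u ^ (dd - 1) * exp (H u) * (of_nat dd + u * H' u)) (at u)" if u: "u \<in> ball 0 1" for u
  proof -
    have "u ^ dd = u * u ^ (dd - 1)" using dd by (cases dd) auto
    then show ?thesis
      by (auto intro!: derivative_eq_intros H_deriv[OF u] simp: algebra_simps)
  qed
  have bound: "norm (c * u ^ (dd - 1) * exp (H u) * (of_nat dd + u * H' u)) \<le> 1" if u: "u \<in> ball 0 1" for u
  proof -
    have "norm (of_nat dd + u * H' u) \<le> real dd + norm u * norm (H' u)"
      using norm_triangle_ineq[of "of_nat dd" "u * H' u"] by (simp add: norm_mult)
    also have "norm u * norm (H' u) \<le> 1 * (1/10)" using u H'_le[OF u] by (intro mult_mono) auto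
    finally have 1: "norm (of_nat dd + u * H' u) \<le> real dd + 1/10" by simp
    have "norm u ^ (dd - 1) \<le> 1" using u by (intro power_le_one) auto
    then have "norm c * norm u ^ (dd - 1) * norm (exp (H u)) * norm (of_nat dd + u * H' u)
        \<le> norm c * 1 * (11/10) * (real dd + 1/10)"
      using 1 expH[OF u] by (intro mult_mono) auto
    also have "\<dots> \<le> 1" using c by (simp add: mult_ac)
    finally show ?thesis by (simp add: norm_mult norm_power)
  qed
  show lip: "dist (g u) (g v) \<le> dist u v" if "u \<in> ball 0 1" "v \<in> ball 0 1" for u v
  proof -
    have "norm (c * u ^ dd * exp (H u) - c * v ^ dd * exp (H v)) \<le> 1 * norm (u - v)"
      by (rule field_differentiable_bound[OF convex_ball has_field_derivative_at_within[OF g_deriv] bound that])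
    then show ?thesis using that by (simp add: g_exp dist_norm)
  qed
  show "g u \<in> ball 0 1" if "u \<in> ball 0 1" for u
  proof -
    have "g 0 = 0" using dd by (simp add: g_def)
    then show ?thesis using lip[OF that, of 0] that by (simp add: dist_norm)
  qed
qed

text \<open>The branch solves D w + C + h w = v as a fixed point of w = (v - C - h w) / D, a
  contraction with constant L. Conditions \<open>pos\<close> and \<open>neg\<close> say that the
  affine part carries the two sides of the strip across lr and lR with reserve e, so the strip is
  mapped into itself. The bound L < 1/2 makes 1 / (2 (1 - L)) less than 1.\<close>

lemma inverse_branch:
  fixes h :: "complex \<Rightarrow> complex" and D :: int and C :: complex
  assumes D: "2 \<le> \<bar>D\<bar>" and L: "0 \<le> L" "L < 1/2" and lrR: "lr \<le> lR"
    and lip: "\<And>w w'. w \<in> vstrip lo hi \<Longrightarrow> w' \<in> vstrip lo hi \<Longrightarrow> norm (h w - h w') \<le> L * \<bar>of_int D\<bar> * norm (w - w')"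
    and per: "\<And>w m. h (w + tau * of_int m) = h w"
    and bnd: "\<And>w. w \<in> vstrip lo hi \<Longrightarrow> \<bar>Re (h w)\<bar> \<le> e" "\<And>w. w \<in> vstrip lo hi \<Longrightarrow> norm (h w) \<le> B" and e: "0 \<le> e"
    and pos: "D > 0 \<Longrightarrow> of_int D * lo + Re C + e \<le> lr \<and> lR \<le> of_int D * hi + Re C - e"
    and neg: "D < 0 \<Longrightarrow> lR \<le> of_int D * lo + Re C - e \<and> of_int D * hi + Re C + e \<le> lr"
  obtains G where
    "\<And>v. v \<in> vstrip lr lR \<Longrightarrow> G v \<in> vstrip lo hi"
    "\<And>v. v \<in> vstrip lr lR \<Longrightarrow> of_int D * G v + C + h (G v) = v"
    "\<And>w. w \<in> vstrip lo hi \<Longrightarrow> of_int D * w + C + h w \<in> vstrip lr lR \<Longrightarrow> G (of_int D * w + C + h w) = w"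
    "\<And>v v'. v \<in> vstrip lr lR \<Longrightarrow> v' \<in> vstrip lr lR \<Longrightarrow> dist (G v) (G v') \<le> 1 / (2 * (1 - L)) * dist v v'"
    "\<And>v m. v \<in> vstrip lr lR \<Longrightarrow> G (v + tau * of_int (D * m)) = G v + tau * of_int m"
    "\<And>v. v \<in> vstrip lr lR \<Longrightarrow> norm (G v - v / of_int D) \<le> norm C + B"
proof -
  define d :: real where "d = of_int D"
  have d: "2 \<le> \<bar>d\<bar>" using D unfolding d_def by linarith
  then have d0: "d \<noteq> 0" by auto
  have D0: "(of_int D :: complex) = of_real d" by (simp add: d_def)
  let ?T = "vstrip lo hi" and ?S = "vstrip lr lR"
  define \<Phi> where "\<Phi> v w = (v - C - h w) / of_int D" for v w
  have fix_iff: "\<Phi> v w = w \<longleftrightarrow> of_int D * w + C + h w = v" for v w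
    unfolding \<Phi>_def D0 using d0 by (auto simp: field_simps)
  have Re\<Phi>: "Re (\<Phi> v w) = (Re v - Re C - Re (h w)) / d" for v w
    unfolding \<Phi>_def D0 by simp
  have in_T: "\<Phi> v w \<in> ?T" if v: "v \<in> ?S" and w: "w \<in> ?T" for v w
  proof -
    have hv: "lr \<le> Re v" "Re v \<le> lR" using v by (auto simp: vstrip_def)
    have hw: "- e \<le> Re (h w)" "Re (h w) \<le> e" using bnd(1)[OF w] by linarith+
    show ?thesis
    proof (cases "D > 0")
      case True
      then have "d > 0" by (simp add: d_def)
      moreover have "d * lo + Re C + e \<le> lr" "lR \<le> d * hi + Re C - e" using pos[OF True] by (auto simp: d_def)
      ultimately show ?thesis using hv hw
        by (simp add: vstrip_def Re\<Phi> pos_le_divide_eq pos_divide_le_eq mult.commute)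
    next
      case False
      then have D: "D < 0" using d0 by (auto simp: d_def)
      then have "d < 0" by (simp add: d_def)
      moreover have "d * hi + Re C + e \<le> lr" "lR \<le> d * lo + Re C - e" using neg[OF D] by (auto simp: d_def)
      ultimately show ?thesis using hv hw
        by (simp add: vstrip_def Re\<Phi> neg_le_divide_eq neg_divide_le_eq mult.commute)
    qed
  qed
  have lohi: "lo \<le> hi"
  proof (cases "D > 0")
    case True
    then have "d * lo \<le> d * hi" using pos lrR e unfolding d_def by linarith
    then show ?thesis using True by (simp add: d_def)
  next
    case False
    then have "D < 0" using d0 by (auto simp: d_def)
    then have "d * hi \<le> d * lo" "d < 0" using neg lrR e unfolding d_def by linarith+
    then show ?thesis by simp
  qed
  have contr: "dist (\<Phi> v w) (\<Phi> v w') \<le> L * dist w w'" if "w \<in> ?T" "w' \<in> ?T" for v w w'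
  proof -
    have "dist (\<Phi> v w) (\<Phi> v w') = norm (h w - h w') / \<bar>d\<bar>"
      unfolding \<Phi>_def dist_norm D0 by (simp add: norm_divide norm_minus_commute flip: diff_divide_distrib)
    also have "\<dots> \<le> (L * \<bar>d\<bar> * norm (w - w')) / \<bar>d\<bar>"
      using lip[OF that] by (intro divide_right_mono) (auto simp: d_def)
    finally show ?thesis using d0 by (simp add: dist_norm)
  qed
  have ex1: "\<exists>!w. w \<in> ?T \<and> \<Phi> v w = w" if v: "v \<in> ?S" for v
  proof (rule Banach_fix[where c = L])
    show "complete ?T" by (simp add: closed_vstrip complete_eq_closed)
    show "?T \<noteq> {}" using lohi by (auto simp: vstrip_def intro!: exI[of _ "of_real lo"])
  qed (use L in_T[OF v] contr in auto)
  define G where "G v = (THE w. w \<in> ?T \<and> \<Phi> v w = w)" for v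
  have G: "G v \<in> ?T" "\<Phi> v (G v) = G v" if "v \<in> ?S" for v
    using theI'[OF ex1[OF that]] by (auto simp: G_def)
  have G_uniq: "G v = w" if "v \<in> ?S" "w \<in> ?T" "\<Phi> v w = w" for v w
    unfolding G_def using that ex1[OF that(1)] by (intro the1_equality) auto
  have Geq: "of_int D * G v + C + h (G v) = v" if "v \<in> ?S" for v
    using G(2)[OF that] fix_iff by blast
  show thesis
  proof (rule that)
    fix v assume v: "v \<in> ?S"
    show "G v \<in> ?T" by (rule G(1)[OF v])
    show "of_int D * G v + C + h (G v) = v" by (rule Geq[OF v])
    have "G v - v / of_int D = - (C + h (G v)) / of_int D"
      unfolding D0 using d0 arg_cong[OF Geq[OF v], of "\<lambda>x. x / of_int D"] by (simp add: D0 field_simps)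
    then have "norm (G v - v / of_int D) = norm (C + h (G v)) / \<bar>d\<bar>"
      by (simp add: norm_divide D0 norm_minus_commute del: minus_add_distrib)
    also have "\<dots> \<le> norm (C + h (G v)) / 1" using d by (intro divide_left_mono) auto
    also have "\<dots> \<le> norm C + B"
      using norm_triangle_ineq[of C "h (G v)"] bnd(2)[OF G(1)[OF v]] by simp
    finally show "norm (G v - v / of_int D) \<le> norm C + B" .
  next
    fix w assume w: "w \<in> ?T" "of_int D * w + C + h w \<in> ?S"
    show "G (of_int D * w + C + h w) = w" by (rule G_uniq[OF w(2,1)]) (simp add: fix_iff)
  next
    fix v m assume v: "v \<in> ?S"
    \<comment> \<open>Since \<open>h\<close> is periodic, the shifted point solves the shifted
      equation; uniqueness of the fixed point does the rest.\<close>
    show "G (v + tau * of_int (D * m)) = G v + tau * of_int m"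
    proof (rule G_uniq)
      show "v + tau * of_int (D * m) \<in> ?S" using v by (simp add: vstrip_def)
      show "G v + tau * of_int m \<in> ?T" using G(1)[OF v] by (simp add: vstrip_def)
      show "\<Phi> (v + tau * of_int (D * m)) (G v + tau * of_int m) = G v + tau * of_int m"
        unfolding fix_iff per using Geq[OF v] by (simp add: algebra_simps)
    qed
  next
    fix v v' assume v: "v \<in> ?S" "v' \<in> ?S"
    let ?x = "dist (G v) (G v')"
    have "of_int D * (G v - G v') = (v - v') - (h (G v) - h (G v'))"
      using arg_cong2[OF Geq[OF v(1)] Geq[OF v(2)], of minus] by (simp add: algebra_simps)
    then have "\<bar>d\<bar> * ?x = norm ((v - v') - (h (G v) - h (G v')))"
      by (metis D0 dist_norm norm_mult norm_of_real)
    also have "\<dots> \<le> dist v v' + L * \<bar>d\<bar> * ?x"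
      using norm_triangle_ineq4[of "v - v'" "h (G v) - h (G v')"] lip[OF G(1)[OF v(1)] G(1)[OF v(2)]]
      by (simp add: dist_norm d_def)
    finally have "\<bar>d\<bar> * ((1 - L) * ?x) \<le> dist v v'" by (simp add: algebra_simps)
    moreover have "2 * ((1 - L) * ?x) \<le> \<bar>d\<bar> * ((1 - L) * ?x)" using d L by (intro mult_right_mono) auto
    ultimately have "?x * (2 * (1 - L)) \<le> dist v v'" by (simp add: algebra_simps)
    then show "?x \<le> 1 / (2 * (1 - L)) * dist v v'" using L by (simp add: pos_le_divide_eq)
  qed
qed

section \<open>The rational map\<close>

text \<open>At a pole the map is the inversion of Q / P, which is continuous there, and inversion
  preserves the chordal distance.\<close>

lemma rat_ext_chordal_cont:
  assumes "poly P z \<noteq> 0 \<or> poly Q z \<noteq> 0"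
  shows "chordal_cont (rat_ext P Q) (Some z)"
  unfolding chordal_cont_def
proof (intro allI impI)
  fix e :: real assume e: "e > 0"
  have loc: "\<exists>\<delta>>0. \<forall>v. chordal_dist v (Some z) < \<delta> \<longrightarrow> chordal_dist (rat_ext P Q v) (rat_ext P Q (Some z)) < e"
    if "\<And>w. dist w z < \<epsilon> \<Longrightarrow> chordal_dist (rat_ext P Q (Some w)) (rat_ext P Q (Some z)) < e" "\<epsilon> > 0" for \<epsilon>
    using chordal_near_Some[OF that(2), of z] that(1) by metis
  have tend: "\<exists>\<epsilon>>0. \<forall>w. dist w z < \<epsilon> \<longrightarrow> poly B w \<noteq> 0 \<and> chordal_dist (Some (poly A w / poly B w)) (Some (poly A z / poly B z)) < e"
    if "poly B z \<noteq> 0" for A B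
  proof -
    define g where "g w = to_sphere (Some (poly A w / poly B w))" for w
    have "isCont (\<lambda>w. poly A w / poly B w) z" using that by (intro continuous_intros) auto
    moreover have "isCont (\<lambda>z. to_sphere (Some z)) (poly A z / poly B z)"
      using continuous_on_to_sphere_Some[of UNIV] by (simp add: continuous_on_eq_continuous_at)
    ultimately have "isCont g z"
      unfolding g_def by (rule isCont_o2)
    then have "(g \<longlongrightarrow> g z) (nhds z)" by (simp only: isCont_def tendsto_at_iff_tendsto_nhds)
    then have "\<forall>\<^sub>F w in nhds z. dist (g w) (g z) < e"
      using e by (rule tendstoD)
    moreover have "isCont (poly B) z" by simp
    then have "\<forall>\<^sub>F w in nhds z. poly B w \<noteq> 0"
      using that by (metis isCont_def t1_space_nhds tendsto_at_iff_tendsto_nhds tendsto_imp_eventually_ne)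
    ultimately show ?thesis
      unfolding eventually_nhds_metric chordal_dist_def g_def by (metis min_less_iff_conj)
  qed
  show "\<exists>\<delta>>0. \<forall>v. chordal_dist v (Some z) < \<delta> \<longrightarrow> chordal_dist (rat_ext P Q v) (rat_ext P Q (Some z)) < e"
  proof (cases "poly Q z = 0")
    case False
    then obtain \<epsilon> where \<epsilon>: "\<epsilon> > 0" "\<And>w. dist w z < \<epsilon> \<Longrightarrow> poly Q w \<noteq> 0 \<and>
        chordal_dist (Some (poly P w / poly Q w)) (Some (poly P z / poly Q z)) < e"
      using tend[of Q P] by blast
    have "rat_ext P Q (Some w) = Some (poly P w / poly Q w)" if "dist w z < \<epsilon>" for w
      using \<epsilon>(2)[OF that] by (auto simp: rat_ext_def)
    then show ?thesis using \<epsilon> loc[of \<epsilon>] by (metis dist_self)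
  next
    case True
    then have P: "poly P z \<noteq> 0" using assms by simp
    obtain \<epsilon> where \<epsilon>: "\<epsilon> > 0" "\<And>w. dist w z < \<epsilon> \<Longrightarrow> poly P w \<noteq> 0 \<and>
        chordal_dist (Some (poly Q w / poly P w)) (Some (poly Q z / poly P z)) < e"
      using tend[OF P, of Q] by blast
    have "rat_ext P Q (Some w) = inv_pt (Some (poly Q w / poly P w))" if "dist w z < \<epsilon>" for w
      using \<epsilon>(2)[OF that] by (auto simp: rat_ext_def inv_pt_def)
    then show ?thesis using \<epsilon> loc[of \<epsilon>] by (metis chordal_dist_inv_pt dist_self)
  qed
qed

locale circle_poly =
  fixes n p :: nat and d :: "nat \<Rightarrow> nat" and a :: "nat \<Rightarrow> complex"
  assumes n2: "2 \<le> n" and p1: "p \<le> 1"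
    and d2: "\<And>i. i \<in> {1..n} \<Longrightarrow> 2 \<le> d i"
    and a0: "\<And>j. j \<in> {1..<n} \<Longrightarrow> a j \<noteq> 0"
begin

text \<open>For j < n and p at most 1 the natural subtraction is exact, so this is the exponent of
  the j-th factor, and \<open>sg 0\<close> is the sign in the exponent of the leading power of
  z.\<close>

definition sg :: "nat \<Rightarrow> int" where "sg j = (if even (n - j - p) then 1 else -1)"

lemma sg_cases: "sg j = 1 \<or> sg j = -1" by (simp add: sg_def)

lemma sg_Suc: "Suc j < n \<Longrightarrow> sg (Suc j) = - sg j"
proof -
  assume "Suc j < n"
  then have eq: "n - j - p = Suc (n - Suc j - p)" using p1 by linarith
  show ?thesis unfolding sg_def eq
    by (cases "even (n - Suc j - p)"; simp only: even_Suc if_True if_False simp_thms minus_minus)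
qed

lemma sg_last: "sg (n - 1) = (if p = 1 then 1 else -1)"
proof -
  have "n - (n - 1) - p = 1 - p" using n2 p1 by linarith
  moreover have "p = 0 \<or> p = 1" using p1 by auto
  ultimately show ?thesis unfolding sg_def by auto
qed

definition N :: "nat \<Rightarrow> nat" where "N j = d j + d (Suc j)"

text \<open>The factorisation \<open>ff_eq\<close> exhibits the map, between the circles of radius \<open>\<bar>a (i - 1)\<bar>\<close> and \<open>\<bar>a i\<bar>\<close>, as the
  monomial with coefficient \<open>cc i\<close> times factors \<open>1 - yy i j z\<close> that are close to 1.\<close>

definition cc :: "nat \<Rightarrow> complex" where "cc i = (\<Prod>j\<in>{i..<n}. (- (a j ^ N j)) powi sg j)"

definition yy :: "nat \<Rightarrow> nat \<Rightarrow> complex \<Rightarrow> complex" where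
  "yy i j z = (if j < i then (a j / z) ^ N j else (z / a j) ^ N j)"

definition num :: "complex poly" where "num = f_num p n d a"
definition den :: "complex poly" where "den = f_den p n d a"
definition ff :: "complex \<Rightarrow> complex" where "ff z = poly num z / poly den z"
abbreviation "FF \<equiv> fmap p n d a"

lemma FF_Some: "FF (Some z) = (if poly den z = 0 then None else Some (ff z))"
  by (simp add: fmap_def rat_ext_def ff_def num_def den_def)

lemma poly_fac: "poly (fac d a j) z = z ^ N j - a j ^ N j"
  by (simp add: fac_def N_def poly_monom)

text \<open>The signs alternate, so in the sum of the d j + d (j+1) each interior degree cancels and
  only the last one remains. This is the local degree between two consecutive circles, and for i = n
  the degree at infinity.\<close>

lemma telescope: "1 \<le> i \<Longrightarrow> i \<le> n \<Longrightarrow> sg 0 * int (d 1) + (\<Sum>j\<in>{1..<i}. sg j * int (N j)) = sg (i - 1) * int (d i)"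
proof (induction i rule: dec_induct)
  case (step i)
  then have "sg i = - sg (i - 1)" using sg_Suc[of "i - 1"] by simp
  then show ?case using step by (simp add: N_def algebra_simps)
qed simp

lemma poly_num: "poly num z = (if sg 0 = 1 then z ^ d 1 else 1) * (\<Prod>j\<in>{j\<in>{1..<n}. sg j = 1}. z ^ N j - a j ^ N j)"
proof -
  have "{j\<in>{1..<n}. sg j = 1} = {i\<in>{1..<n}. even (n - i - p)}" by (auto simp: sg_def split: if_splits)
  then show ?thesis by (simp add: num_def f_num_def poly_prod poly_fac poly_monom sg_def)
qed

lemma poly_den: "poly den z = (if sg 0 = 1 then 1 else z ^ d 1) * (\<Prod>j\<in>{j\<in>{1..<n}. sg j = -1}. z ^ N j - a j ^ N j)"
proof -
  have "{j\<in>{1..<n}. sg j = -1} = {i\<in>{1..<n}. odd (n - i - p)}" by (auto simp: sg_def split: if_splits)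
  then show ?thesis by (simp add: den_def f_den_def poly_prod poly_fac poly_monom sg_def)
qed

text \<open>Valid at zeros of the denominator as well: both sides are then 0, because inverse 0 =
  0.\<close>

lemma ff_powi: "ff z = z powi (sg 0 * int (d 1)) * (\<Prod>j\<in>{1..<n}. (z ^ N j - a j ^ N j) powi sg j)"
proof -
  let ?w = "\<lambda>j. z ^ N j - a j ^ N j"
  have un: "{1..<n} = {j\<in>{1..<n}. sg j = 1} \<union> {j\<in>{1..<n}. sg j = -1}" using sg_cases by auto
  have "(\<Prod>j\<in>{1..<n}. ?w j powi sg j) = (\<Prod>j\<in>{j\<in>{1..<n}. sg j = 1}. ?w j powi sg j) * (\<Prod>j\<in>{j\<in>{1..<n}. sg j = -1}. ?w j powi sg j)"
    by (subst un, rule prod.union_disjoint) auto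
  also have "\<dots> = (\<Prod>j\<in>{j\<in>{1..<n}. sg j = 1}. ?w j) * inverse (\<Prod>j\<in>{j\<in>{1..<n}. sg j = -1}. ?w j)"
    by (simp add: power_int_minus prod_inversef[unfolded o_def, symmetric])
  finally have 1: "(\<Prod>j\<in>{1..<n}. ?w j powi sg j) = (\<Prod>j\<in>{j\<in>{1..<n}. sg j = 1}. ?w j) * inverse (\<Prod>j\<in>{j\<in>{1..<n}. sg j = -1}. ?w j)" .
  show ?thesis
    unfolding ff_def poly_num poly_den 1 using sg_cases[of 0]
    by (auto simp: divide_inverse power_int_minus)
qed

lemma ff_eq:
  assumes i: "1 \<le> i" "i \<le> n" and z: "z \<noteq> 0"
  shows "ff z = cc i * z powi (sg (i - 1) * int (d i)) * (\<Prod>j\<in>{1..<n}. (1 - yy i j z) powi sg j)"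
proof -
  have f: "(z ^ N j - a j ^ N j) powi sg j = (if j < i then z powi (sg j * int (N j)) else (- (a j ^ N j)) powi sg j) * (1 - yy i j z) powi sg j"
    if "j \<in> {1..<n}" for j
  proof (cases "j < i")
    case True
    have "z ^ N j - a j ^ N j = z ^ N j * (1 - (a j / z) ^ N j)" using z by (simp add: field_simps)
    moreover have "(z ^ N j) powi sg j = z powi (sg j * int (N j))" using sg_cases[of j] by (auto simp: power_int_minus)
    ultimately show ?thesis using True by (simp add: yy_def power_int_mult_distrib)
  next
    case False
    have "z ^ N j - a j ^ N j = - (a j ^ N j) * (1 - (z / a j) ^ N j)" using a0[OF that] by (simp add: field_simps)
    then show ?thesis using False by (simp only: yy_def if_False power_int_mult_distrib)
  qed
  have p1: "(\<Prod>j\<in>{1..<n}. if j < i then z powi (sg j * int (N j)) else (- (a j ^ N j)) powi sg j)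
      = (\<Prod>j\<in>{1..<i}. z powi (sg j * int (N j))) * cc i"
  proof -
    have "{1..<n} \<inter> {j. j < i} = {1..<i}" "{1..<n} \<inter> - {j. j < i} = {i..<n}" using i by auto
    then show ?thesis unfolding cc_def by (subst prod.If_cases) auto
  qed
  have p2: "z powi (sg 0 * int (d 1)) * (\<Prod>j\<in>{1..<i}. z powi (sg j * int (N j))) = z powi (sg (i - 1) * int (d i))"
  proof -
    have "(\<Prod>j\<in>A. z powi (sg j * int (N j))) = z powi (\<Sum>j\<in>A. sg j * int (N j))" if "finite A" for A
      using that by (induction A rule: finite_induct) (auto simp: power_int_add z)
    then show ?thesis using telescope[OF i] z by (simp flip: power_int_add)
  qed
  have p3: "(\<Prod>j\<in>{1..<n}. (z ^ N j - a j ^ N j) powi sg j) =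
      (\<Prod>j\<in>{1..<n}. if j < i then z powi (sg j * int (N j)) else (- (a j ^ N j)) powi sg j) * (\<Prod>j\<in>{1..<n}. (1 - yy i j z) powi sg j)"
    unfolding prod.distrib[symmetric] by (rule prod.cong[OF refl f])
  show ?thesis
    unfolding ff_powi p3 p1 p2[symmetric] by (simp only: mult_ac)
qed

lemma factor_nonzero_iff:
  assumes "j \<in> {1..<n}" "j < i \<longrightarrow> z \<noteq> 0"
  shows "z ^ N j - a j ^ N j = 0 \<longleftrightarrow> yy i j z = 1"
  using a0[OF assms(1)] assms(2) by (auto simp: yy_def power_divide field_simps)

lemma regular:
  assumes "z \<noteq> 0 \<or> i = 1 \<and> sg 0 = 1" "\<And>j. j \<in> {1..<n} \<Longrightarrow> yy i j z \<noteq> 1"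
  shows "FF (Some z) = Some (ff z)"
proof -
  have "poly den z \<noteq> 0"
    unfolding poly_den using assms factor_nonzero_iff[of _ i z] by auto
  then show ?thesis by (simp add: FF_Some)
qed

lemma FF_pole: "sg 0 = -1 \<Longrightarrow> FF (Some 0) = None"
  using d2[of 1] n2 by (simp add: FF_Some poly_den)

lemma ff_zero: "sg 0 = 1 \<Longrightarrow> ff 0 = 0"
  using d2[of 1] n2 by (simp add: ff_def poly_num)

lemma cc_nonzero: "1 \<le> i \<Longrightarrow> cc i \<noteq> 0"
  unfolding cc_def using a0 by (auto simp: power_int_eq_0_iff)

lemma cc_n: "cc n = 1" by (simp add: cc_def)

lemma cc_Suc: "i < n \<Longrightarrow> cc i = (- (a i ^ N i)) powi sg i * cc (Suc i)"
  unfolding cc_def by (simp add: prod.atLeast_Suc_lessThan)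

lemma yy_shift: "yy i j (exp (w + tau * of_int m)) = yy i j (exp w)"
  by (simp only: exp_shift)

lemma degree_fac: assumes "j \<in> {1..<n}" shows "degree (fac d a j) = N j"
proof -
  have "N j > 0" using d2[of j] assms by (simp add: N_def)
  then have "degree [:a j ^ N j:] < degree (monom (1::complex) (N j))" by (simp add: degree_monom_eq)
  then have "degree (monom (1::complex) (N j) + - [:a j ^ N j:]) = N j"
    by (subst degree_add_eq_left) (simp_all add: degree_monom_eq)
  moreover have "fac d a j = monom 1 (N j) + - [:a j ^ N j:]" by (simp add: fac_def N_def)
  ultimately show ?thesis by (simp only:)
qed

lemma degree_prod_fac: "A \<subseteq> {1..<n} \<Longrightarrow> degree (\<Prod>j\<in>A. fac d a j) = (\<Sum>j\<in>A. N j)"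
proof -
  assume A: "A \<subseteq> {1..<n}"
  have "fac d a j \<noteq> 0" if "j \<in> A" for j
  proof -
    have "j \<in> {1..<n}" using A that by auto
    then have "degree (fac d a j) > 0" using d2[of j] by (simp add: degree_fac N_def)
    then show ?thesis by auto
  qed
  then show ?thesis using A degree_fac by (subst degree_prod_eq_sum_degree) (auto intro!: sum.cong)
qed

lemma prod_fac_nonzero: "A \<subseteq> {1..<n} \<Longrightarrow> (\<Prod>j\<in>A. fac d a j) \<noteq> 0"
proof -
  assume A: "A \<subseteq> {1..<n}"
  have "fac d a j \<noteq> 0" if "j \<in> {1..<n}" for j
    using d2[of j] that degree_fac[OF that] by (auto simp: N_def)
  then show ?thesis using A finite_subset[OF A] by auto
qed

lemma degree_diff: "int (degree num) - int (degree den) = sg (n - 1) * int (d n)"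
proof -
  define A where "A = {i\<in>{1..<n}. even (n - i - p)}"
  define B where "B = {i\<in>{1..<n}. odd (n - i - p)}"
  have A: "A \<subseteq> {1..<n}" and B: "B \<subseteq> {1..<n}" by (auto simp: A_def B_def)
  have nz: "(if P then monom (1::complex) (d 1) else 1) \<noteq> 0"
    and deg: "degree (if P then monom (1::complex) (d 1) else 1) = (if P then d 1 else 0)" for P
    by (simp_all add: degree_monom_eq)
  have e: "even (n - p) \<longleftrightarrow> sg 0 = 1" by (simp add: sg_def)
  have num: "degree num = (if sg 0 = 1 then d 1 else 0) + (\<Sum>j\<in>A. N j)"
    unfolding num_def f_num_def A_def[symmetric]
    by (simp only: degree_mult_eq[OF nz prod_fac_nonzero[OF A]] degree_prod_fac[OF A] deg e)
  have den: "degree den = (if sg 0 \<noteq> 1 then d 1 else 0) + (\<Sum>j\<in>B. N j)"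
    unfolding den_def f_den_def B_def[symmetric]
    by (simp only: degree_mult_eq[OF nz prod_fac_nonzero[OF B]] degree_prod_fac[OF B] deg e)
  have "{1..<n} = A \<union> B" "A \<inter> B = {}" "finite A" "finite B" by (auto simp: A_def B_def)
  then have "(\<Sum>j\<in>{1..<n}. sg j * int (N j)) = (\<Sum>j\<in>A. sg j * int (N j)) + (\<Sum>j\<in>B. sg j * int (N j))"
    by (simp add: sum.union_disjoint)
  moreover have "(\<Sum>j\<in>A. sg j * int (N j)) = (\<Sum>j\<in>A. int (N j))"
    by (rule sum.cong[OF refl]) (simp add: sg_def A_def)
  moreover have "(\<Sum>j\<in>B. sg j * int (N j)) = (\<Sum>j\<in>B. - int (N j))"
    by (rule sum.cong[OF refl], simp only: B_def mem_Collect_eq sg_def) simp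
  ultimately have "(\<Sum>j\<in>{1..<n}. sg j * int (N j)) = int (\<Sum>j\<in>A. N j) - int (\<Sum>j\<in>B. N j)"
    by (simp add: sum_negf)
  then show ?thesis using telescope[of n] n2 sg_cases[of 0] unfolding num den by auto
qed

lemma FF_None: "FF None = (if sg (n - 1) = 1 then None else Some 0)"
proof -
  have "0 < int (d n)" using d2[of n] n2 by simp
  then show ?thesis using degree_diff sg_cases[of "n - 1"]
    by (auto simp: fmap_def rat_ext_def num_def den_def)
qed

text \<open>\<open>V j\<close> is the modulus on the circle \<open>\<bar>z\<bar> = \<bar>a j\<bar>\<close> of either of the two adjacent monomials.\<close>

definition V :: "nat \<Rightarrow> real" where
  "V j = norm (cc j) * norm (a j) powi (sg (j - 1) * int (d j))"

lemma V_match: assumes j: "j \<in> {1..<n}" shows "V j = norm (cc (Suc j)) * norm (a j) powi (sg j * int (d (Suc j)))"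
proof -
  have a: "0 < norm (a j)" using a0[OF j] by simp
  have "norm (cc j) = (norm (a j) ^ N j) powi sg j * norm (cc (Suc j))"
    using cc_Suc[of j] j by (simp add: norm_mult norm_power_int norm_power)
  also have "(norm (a j) ^ N j) powi sg j = norm (a j) powi (int (N j) * sg j)"
    by (simp add: power_int_mult)
  finally have "V j = norm (cc (Suc j)) * (norm (a j) powi (int (N j) * sg j) * norm (a j) powi (sg (j - 1) * int (d j)))"
    by (simp add: V_def)
  also have "norm (a j) powi (int (N j) * sg j) * norm (a j) powi (sg (j - 1) * int (d j))
      = norm (a j) powi (int (N j) * sg j + sg (j - 1) * int (d j))"
    using a by (simp add: power_int_add)
  also have "int (N j) * sg j + sg (j - 1) * int (d j) = sg j * int (d (Suc j))"
    using sg_Suc[of "j - 1"] j by (simp add: N_def algebra_simps)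
  finally show ?thesis .
qed

end

section \<open>Zones and critical circles\<close>

text \<open>The two signs of \<kappa> cover the terms (z / a)^N and (a / z)^N. The derivative has
  modulus N |y| / |1 - y|, where y is the N-th power.\<close>

lemma Ln_term_lipschitz:
  fixes \<alpha> \<kappa> :: complex
  assumes "convex S" and \<kappa>: "norm \<kappa> = 1" and t: "0 \<le> t" "t < 1"
    and le: "\<And>w. w \<in> S \<Longrightarrow> norm ((exp (\<kappa> * w) * \<alpha>) ^ N) \<le> t"
    and "w \<in> S" "w' \<in> S"
  shows "norm (Ln (1 - (exp (\<kappa> * w) * \<alpha>) ^ N) - Ln (1 - (exp (\<kappa> * w') * \<alpha>) ^ N)) \<le> real N * t / (1 - t) * norm (w - w')"
proof (rule field_differentiable_bound[OF \<open>convex S\<close> _ _ \<open>w \<in> S\<close> \<open>w' \<in> S\<close>])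
  fix z assume z: "z \<in> S"
  let ?y = "(exp (\<kappa> * z) * \<alpha>) ^ N"
  have y1: "norm ?y < 1" using le[OF z] t by linarith
  define y where "y w = (exp (\<kappa> * w) * \<alpha>) ^ N" for w
  have dy: "(y has_field_derivative of_nat N * \<kappa> * y z) (at z within S)"
  proof -
    have eq: "(exp (\<kappa> * w) * \<alpha>) ^ N = exp (of_nat N * (\<kappa> * w)) * \<alpha> ^ N" for w
      by (simp add: power_mult_distrib exp_of_nat_mult)
    show ?thesis unfolding y_def eq by (auto intro!: derivative_eq_intros)
  qed
  then show "((\<lambda>w. Ln (1 - (exp (\<kappa> * w) * \<alpha>) ^ N)) has_field_derivative - (of_nat N * \<kappa> * ?y) / (1 - ?y)) (at z within S)"
    using one_minus_notin_nonpos[OF y1] unfolding y_def[symmetric]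
    by (auto intro!: derivative_eq_intros dy simp: divide_inverse mult_ac)
  have "1 - t \<le> norm (1 - ?y)" using norm_triangle_ineq2[of 1 ?y] le[OF z] by simp
  moreover have "real N * norm ?y \<le> real N * t" using le[OF z] by (intro mult_left_mono) auto
  ultimately have "real N * norm ?y / norm (1 - ?y) \<le> real N * t / (1 - t)"
    using t by (intro frac_le) auto
  then show "norm (- (of_nat N * \<kappa> * ?y) / (1 - ?y)) \<le> real N * t / (1 - t)"
    using \<kappa> by (simp add: norm_divide norm_mult)
qed

text \<open>The ratio \<open>K powr (2 / dd)\<close> to the radii of the critical circles is chosen so that the perturbation of
  the monomial changes its logarithmic derivative by at most one eighth of \<open>dd\<close> on either side.\<close>

lemma tight_bound:
  fixes K :: real and dd d' :: nat
  assumes K: "3 \<le> K" and dd: "1 \<le> dd"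
  defines "t \<equiv> (K powr (- 2 / real dd)) ^ (dd + d')"
  shows "0 \<le> t" "t \<le> 1/9" "real (dd + d') * t / (1 - t) \<le> real dd / 8"
proof -
  \<comment> \<open>With this ratio, (dd + d') t = dd (1 + \<rho>) K^(-2 \<rho>) / K^2, and 1 +
    \<rho> <= K^(2 \<rho>) as soon as ln K >= 1/2. A large neighbouring degree d' therefore does no
    harm.\<close>
  define \<rho> where "\<rho> = real d' / real dd"
  have \<rho>: "0 \<le> \<rho>" by (simp add: \<rho>_def)
  have "t = K powr (- 2 / real dd * real (dd + d'))"
    unfolding t_def using K by (simp add: powr_powr powr_realpow[symmetric])
  also have "- 2 / real dd * real (dd + d') = - 2 + - (2 * \<rho>)"
    using dd by (simp add: \<rho>_def field_simps)
  also have "K powr \<dots> = K powr (-2) * K powr (- (2 * \<rho>))" by (rule powr_add)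
  also have "K powr (-2) = 1 / K^2" using K by (simp add: powr_minus powr_numeral divide_inverse)
  finally have t: "t = 1 / K^2 * K powr (- (2 * \<rho>))" .
  have "exp (1/2) \<le> exp (1::real)" by simp
  then have "exp (1/2) \<le> K" using exp_le K by linarith
  then have "1/2 \<le> ln K" using K by (subst ln_ge_iff) auto
  then have "1 + \<rho> \<le> 1 + 2 * \<rho> * ln K" using \<rho> mult_left_mono[of "1/2" "ln K" "2 * \<rho>"] by simp
  also have "\<dots> \<le> exp (2 * \<rho> * ln K)" by (rule exp_ge_add_one_self)
  also have "\<dots> = K powr (2 * \<rho>)" using K by (simp add: powr_def)
  finally have e: "1 + \<rho> \<le> K powr (2 * \<rho>)" .
  then have Kp: "(1 + \<rho>) * K powr (- (2 * \<rho>)) \<le> 1"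
    using K by (simp add: powr_minus field_simps)
  have K9: "9 \<le> K^2" using power_mono[of 3 K 2] K by simp
  have Kp1: "K powr (- (2 * \<rho>)) \<le> 1" using K \<rho> by (simp add: powr_minus inverse_le_1_iff ge_one_powr_ge_zero)
  show t0: "0 \<le> t" unfolding t by simp
  have "t \<le> 1 / K^2 * 1" unfolding t by (intro mult_left_mono Kp1) auto
  also have "\<dots> \<le> 1/9" using K9 by (simp add: divide_simps)
  finally show t9: "t \<le> 1/9" .
  have "real (dd + d') * t = real dd * ((1 + \<rho>) * K powr (- (2 * \<rho>))) / K^2"
  proof -
    have "real (dd + d') = real dd * (1 + \<rho>)" using dd by (simp add: \<rho>_def field_simps)
    then show ?thesis unfolding t by simp
  qed
  also have "\<dots> \<le> real dd * 1 / K^2" by (intro divide_right_mono mult_left_mono Kp) auto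
  also have "\<dots> \<le> real dd / 9" unfolding mult_1_right using K9 by (intro divide_left_mono) auto
  finally have "real (dd + d') * t / (1 - t) \<le> (real dd / 9) / (8/9)"
    using t9 t0 by (intro frac_le) auto
  then show "real (dd + d') * t / (1 - t) \<le> real dd / 8" by simp
qed

text \<open>Here x stands for |z| / |a j| in a critical ring, whose widths are encoded by the two
  K^2 hypotheses. Division by x^d, the modulus of the monomial, yields the loss 1 + K^2 that appears
  in \<open>low\<close> and \<open>high\<close>.\<close>

lemma ratio_bound:
  fixes x K :: real and d d' :: nat
  assumes "0 < x" "1 \<le> K^2 * x ^ d" "x ^ d' \<le> K^2"
  shows "1 + x ^ (d + d') \<le> (1 + K^2) * x ^ d"
proof (cases "x \<le> 1")
  case True
  then have "x ^ d * x ^ d' \<le> x ^ d * 1" using assms(1) by (intro mult_left_mono power_le_one) auto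
  then show ?thesis using assms(2) by (simp add: power_add algebra_simps)
next
  case False
  then have "1 \<le> x ^ d" by (intro one_le_power) auto
  moreover have "x ^ d' * x ^ d \<le> K^2 * x ^ d" using assms by (intro mult_right_mono) auto
  moreover have "x ^ (d + d') = x ^ d' * x ^ d" by (simp add: power_add)
  ultimately show ?thesis by (simp only: distrib_right mult_1)
qed

text \<open>The circles are separated by the factor \<open>1 / k\<close>; \<open>low\<close> and \<open>high\<close> push the neighbourhoods of the critical
  circles out of the annulus \<open>r \<le> \<bar>z\<bar> \<le> R\<close>, and the last four conditions keep its complement invariant.\<close>

locale circle_map = circle_poly n p d a
  for n p :: nat and d :: "nat \<Rightarrow> nat" and a :: "nat \<Rightarrow> complex" +
  fixes K k r R :: real
  assumes K3: "3 \<le> K" and dK: "\<And>i. i \<in> {1..n} \<Longrightarrow> real (d i) \<le> K"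
    and k0: "0 < k" and k_small: "100 * real n * K^2 * k \<le> 1" and r0: "0 < r"
    and sep_first: "r \<le> k * norm (a 1)"
    and sep_mid: "\<And>j. j \<in> {1..<n-1} \<Longrightarrow> norm (a j) \<le> k * norm (a (Suc j))"
    and sep_last: "norm (a (n - 1)) \<le> k * R"
    and low: "\<And>j. j \<in> {1..<n} \<Longrightarrow> sg j = 1 \<Longrightarrow>
       V j * (1 + K^2) * (4/3) \<le> r"
    and high: "\<And>j. j \<in> {1..<n} \<Longrightarrow> sg j = -1 \<Longrightarrow>
       R * (1 + K^2) * (4/3) \<le> V j"
    and inner_pos: "sg 0 = 1 \<Longrightarrow> norm (cc 1) * r ^ d 1 * (2 * K) \<le> r"
    and inner_neg: "sg 0 = -1 \<Longrightarrow> 2 * K * R * r ^ d 1 \<le> norm (cc 1)"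
    and outer_pos: "sg (n - 1) = 1 \<Longrightarrow> (real (d n) + 1/10) * (11/10) * R \<le> R ^ d n"
    and outer_neg: "sg (n - 1) = -1 \<Longrightarrow> (real (d n) + 1/10) * (11/10) \<le> r * R ^ d n"
begin

text \<open>Adds r and R to the critical radii as numbers 0 and n, so that the i-th monomial always
  governs the region between b (i-1) and b i.\<close>

definition b :: "nat \<Rightarrow> real" where "b j = (if j = 0 then r else if j = n then R else norm (a j))"

lemma b_step: "j < n \<Longrightarrow> b j \<le> k * b (Suc j)"
proof -
  assume j: "j < n"
  consider "j = 0" | "j \<in> {1..<n-1}" | "j = n - 1" "j \<noteq> 0" using j by force
  then show ?thesis
  proof cases
    case 1
    then show ?thesis using sep_first n2 by (simp add: b_def)
  next
    case 2
    then show ?thesis using sep_mid[OF 2] by (auto simp: b_def)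
  next
    case 3
    then show ?thesis using sep_last n2 by (auto simp: b_def)
  qed
qed

lemma b_a: "j \<in> {1..<n} \<Longrightarrow> b j = norm (a j)" by (auto simp: b_def)

lemma b_pos: "j \<le> n \<Longrightarrow> 0 < b j"
proof (induction j)
  case 0
  then show ?case using r0 by (simp add: b_def)
next
  case (Suc j)
  then have "0 < b j" "b j \<le> k * b (Suc j)" using b_step by auto
  then have "0 < k * b (Suc j)" by linarith
  then show ?case using k0 by (simp add: zero_less_mult_iff)
qed

lemma k_bounds: "k \<le> 1/1800" "K * k \<le> 1/600" "real n * k \<le> 1/900" "real n * K * k \<le> 1/300"
proof -
  have n: "2 \<le> real n" using n2 by simp
  have K2: "3 * K \<le> K^2" "9 \<le> K^2" using K3 by (auto simp: power2_eq_square intro: mult_mono[of 3 K 3 K, simplified])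
  have "100 * 2 * 9 * k \<le> 100 * real n * K^2 * k"
    using n K2 k0 by (intro mult_right_mono mult_mono) auto
  then show "k \<le> 1/1800" using k_small by linarith
  have "100 * 2 * (3 * K) * k \<le> 100 * real n * K^2 * k"
    using n K2 k0 K3 by (intro mult_right_mono mult_mono) auto
  then show "K * k \<le> 1/600" using k_small by linarith
  have "100 * real n * 9 * k \<le> 100 * real n * K^2 * k"
    using n K2 k0 by (intro mult_right_mono mult_left_mono) auto
  then show "real n * k \<le> 1/900" using k_small by linarith
  have "100 * real n * (3 * K) * k \<le> 100 * real n * K^2 * k"
    using n K2 k0 by (intro mult_right_mono mult_left_mono) auto
  then show "real n * K * k \<le> 1/300" using k_small by (simp add: mult_ac)
qed

lemma b_mono: "i \<le> j \<Longrightarrow> j \<le> n \<Longrightarrow> b i \<le> b j"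
proof (induction j rule: dec_induct)
  case (step j)
  have "b j \<le> k * b (Suc j)" using b_step step by auto
  also have "\<dots> \<le> 1 * b (Suc j)" using k_bounds(1) b_pos[of "Suc j"] step by (intro mult_right_mono) auto
  finally show ?case using step by auto
qed simp

lemma b_less: "i < j \<Longrightarrow> j \<le> n \<Longrightarrow> b i \<le> k * b j"
proof -
  assume ij: "i < j" "j \<le> n"
  then have "b i \<le> k * b (Suc i)" using b_step by auto
  also have "\<dots> \<le> k * b j" using k0 b_mono[of "Suc i" j] ij by (intro mult_left_mono) auto
  finally show ?thesis .
qed

lemma R_gt: "r < R"
proof -
  have "b 0 \<le> k * b n" using b_less[of 0 n] n2 by auto
  moreover have "k * b n < 1 * b n" using k_bounds(1) b_pos[of n] by (intro mult_strict_right_mono) auto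
  ultimately show ?thesis using n2 by (simp add: b_def)
qed

lemma R0: "0 < R" using R_gt r0 by simp

section \<open>Zones: regions where the map is a small perturbation of one monomial\<close>

definition lo :: "nat \<Rightarrow> real" where "lo i = (if i = 1 then r else b (i - 1) * K powr (2 / real (d i)))"
definition hi :: "nat \<Rightarrow> real" where "hi i = (if i = n then R else b i * K powr (- 2 / real (d i)))"
abbreviation zone :: "nat \<Rightarrow> complex set" where "zone i \<equiv> vstrip (ln (lo i)) (ln (hi i))"

text \<open>A bound for |yy i j z| on zone i. Only the two adjacent circles contribute more than k;
  for i = 1 or i = n one of them is absent from the index range.\<close>

definition t :: "nat \<Rightarrow> nat \<Rightarrow> real" where
  "t i j = (if j = i - 1 \<or> j = i then (K powr (- 2 / real (d i))) ^ N j else k)"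

lemma K_powr: "i \<in> {1..n} \<Longrightarrow> 1 < K powr (2 / real (d i))" "i \<in> {1..n} \<Longrightarrow> K powr (2 / real (d i)) \<le> K"
  "i \<in> {1..n} \<Longrightarrow> K powr (- 2 / real (d i)) = 1 / K powr (2 / real (d i))"
  "i \<in> {1..n} \<Longrightarrow> (K powr (2 / real (d i))) ^ d i = K^2"
proof -
  assume i: "i \<in> {1..n}"
  then have d: "2 \<le> real (d i)" using d2 by force
  show "1 < K powr (2 / real (d i))" using d K3 by (simp add: gr_one_powr)
  have "K powr (2 / real (d i)) \<le> K powr 1" using d K3 by (intro powr_mono) auto
  then show "K powr (2 / real (d i)) \<le> K" using K3 by simp
  show "K powr (- 2 / real (d i)) = 1 / K powr (2 / real (d i))" by (simp add: powr_minus divide_inverse)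
  have "(K powr (2 / real (d i))) ^ d i = K powr (2 / real (d i) * real (d i))"
    using K3 by (simp add: powr_powr powr_realpow[symmetric])
  then show "(K powr (2 / real (d i))) ^ d i = K^2" using d K3 by (simp add: powr_numeral)
qed

lemma lo_ge: assumes "i \<in> {1..n}" shows "b (i - 1) \<le> lo i"
proof -
  have "i - 1 \<le> n" using assms by auto
  then have "b (i - 1) * 1 \<le> b (i - 1) * K powr (2 / real (d i))"
    using K_powr(1)[OF assms] b_pos[of "i - 1"] by (intro mult_left_mono) auto
  then show ?thesis by (auto simp: lo_def b_def)
qed

lemma lo_gt: assumes "i \<in> {2..n}" shows "b (i - 1) < lo i"
proof -
  have "b (i - 1) * 1 < b (i - 1) * K powr (2 / real (d i))"
    using K_powr(1)[of i] b_pos[of "i - 1"] assms by (intro mult_strict_left_mono) auto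
  then show ?thesis using assms by (auto simp: lo_def)
qed

lemma hi_le: assumes "i \<in> {1..n}" shows "hi i \<le> b i"
proof -
  have "b i * (1 / K powr (2 / real (d i))) \<le> b i * 1"
    using K_powr(1)[OF assms] b_pos[of i] assms by (intro mult_left_mono) (auto simp: divide_le_eq_1)
  then show ?thesis using K_powr(3)[OF assms] assms by (auto simp: hi_def b_def)
qed

lemma lo_pos: "i \<in> {1..n} \<Longrightarrow> 0 < lo i"
  using lo_ge[of i] b_pos[of "i - 1"] by force

lemma hi_pos: "i \<in> {1..n} \<Longrightarrow> 0 < hi i"
  using b_pos[of i] R0 K3 by (auto simp: hi_def)

lemma yy_le:
  assumes i: "i \<in> {1..n}" and j: "j \<in> {1..<n}" and z: "lo i \<le> norm z" "norm z \<le> hi i"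
  shows "norm (yy i j z) \<le> t i j"
proof -
  have nz: "0 < norm z" using z lo_pos[OF i] by linarith
  have bj: "b j = norm (a j)" "0 < b j" using b_a[OF j] b_pos[of j] j by auto
  have N1: "1 \<le> N j" using d2[of j] j by (simp add: N_def)
  consider "j < i - 1" "j < i" | "j = i - 1" "j < i" | "j = i" | "i < j" by linarith
  then show ?thesis
  proof cases
    case 1
    have "b j \<le> k * b (i - 1)" using b_less[of j "i - 1"] 1 i by auto
    also have "\<dots> \<le> k * norm z" using lo_ge[OF i] z k0 by (intro mult_left_mono) auto
    finally have "b j / norm z \<le> k" using nz by (simp add: pos_divide_le_eq)
    then have "(b j / norm z) ^ N j \<le> k ^ N j" using bj nz by (intro power_mono) auto
    also have "\<dots> \<le> k ^ 1" using k0 k_bounds(1) N1 by (intro power_decreasing) auto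
    finally show ?thesis using 1 bj by (simp add: yy_def t_def norm_power norm_divide)
  next
    case 2
    then have "lo i = b j * K powr (2 / real (d i))" using j by (auto simp: lo_def)
    then have "b j / norm z \<le> 1 / K powr (2 / real (d i))" using z nz K3 by (simp add: field_simps)
    then have "(b j / norm z) ^ N j \<le> (K powr (- 2 / real (d i))) ^ N j"
      unfolding K_powr(3)[OF i] using bj nz by (intro power_mono) auto
    then show ?thesis using 2 bj by (simp add: yy_def t_def norm_power norm_divide)
  next
    case 3
    then have "hi i = b j * K powr (- 2 / real (d i))" using j by (auto simp: hi_def)
    then have "norm z / b j \<le> K powr (- 2 / real (d i))" using z bj by (simp add: field_simps)
    then have "(norm z / b j) ^ N j \<le> (K powr (- 2 / real (d i))) ^ N j"
      using bj nz by (intro power_mono) auto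
    then show ?thesis using 3 bj by (simp add: yy_def t_def norm_power norm_divide)
  next
    case 4
    have "norm z \<le> b i" using z hi_le[OF i] by linarith
    also have "\<dots> \<le> k * b j" using b_less[of i j] 4 j by auto
    finally have "norm z / b j \<le> k" using bj by (simp add: pos_divide_le_eq)
    then have "(norm z / b j) ^ N j \<le> k ^ N j" using bj nz by (intro power_mono) auto
    also have "\<dots> \<le> k ^ 1" using k0 k_bounds(1) N1 by (intro power_decreasing) auto
    finally show ?thesis using 4 bj by (simp add: yy_def t_def norm_power norm_divide)
  qed
qed

lemma t_bounds:
  assumes i: "i \<in> {1..n}" and j: "j \<in> {1..<n}"
  shows "0 \<le> t i j" "t i j \<le> 1/9" "t i j \<le> (if j = i - 1 \<or> j = i then 1/9 else k)"
    "real (N j) * t i j / (1 - t i j) \<le> (if j = i - 1 \<or> j = i then real (d i) / 8 else 3 * K * k)"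
proof -
  have "0 \<le> t i j \<and> t i j \<le> 1/9 \<and> t i j \<le> (if j = i - 1 \<or> j = i then 1/9 else k) \<and>
    real (N j) * t i j / (1 - t i j) \<le> (if j = i - 1 \<or> j = i then real (d i) / 8 else 3 * K * k)"
  proof (cases "j = i - 1 \<or> j = i")
    case True
    have d1: "1 \<le> d i" using d2[OF i] by simp
    obtain d' where N: "N j = d i + d'"
    proof (cases "j = i")
      case False
      then have "Suc j = i" using True i j by auto
      then show ?thesis using that[of "d j"] by (simp add: N_def)
    qed (use that in \<open>simp add: N_def\<close>)
    show ?thesis using tight_bound[OF K3 d1, of d'] True by (simp add: t_def N)
  next
    case False
    then have t: "t i j = k" by (simp add: t_def)
    have "real (N j) \<le> 2 * K" using dK[of j] dK[of "Suc j"] j by (simp add: N_def)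
    then have "real (N j) * k \<le> 2 * K * k" using k0 by (intro mult_right_mono) auto
    moreover have "2/3 \<le> 1 - k" using k_bounds(1) by simp
    ultimately have "real (N j) * k / (1 - k) \<le> (2 * K * k) / (2/3)"
      using K3 k0 by (intro frac_le) auto
    then show ?thesis using False t k0 k_bounds(1) by simp
  qed
  then show "0 \<le> t i j" "t i j \<le> 1/9" "t i j \<le> (if j = i - 1 \<or> j = i then 1/9 else k)"
    "real (N j) * t i j / (1 - t i j) \<le> (if j = i - 1 \<or> j = i then real (d i) / 8 else 3 * K * k)" by auto
qed

lemma sum_le_two_special:
  fixes f :: "nat \<Rightarrow> real"
  assumes "\<And>j. j \<in> {1..<n} \<Longrightarrow> f j \<le> (if j = i - 1 \<or> j = i then A else B)" "0 \<le> A" "0 \<le> B"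
  shows "(\<Sum>j\<in>{1..<n}. f j) \<le> 2 * A + real n * B"
proof -
  have "(\<Sum>j\<in>{1..<n}. f j) \<le> (\<Sum>j\<in>{1..<n}. (if j = i - 1 then A else 0) + (if j = i then A else 0) + B)"
    using assms by (intro sum_mono) fastforce
  also have "\<dots> = (\<Sum>j\<in>{1..<n}. if j = i - 1 then A else 0) + (\<Sum>j\<in>{1..<n}. if j = i then A else 0) + real (n - 1) * B"
    by (simp add: sum.distrib)
  also have "\<dots> \<le> A + A + real n * B"
    using assms(2,3) by (intro add_mono mult_right_mono) (auto simp: sum.delta)
  finally show ?thesis by simp
qed

text \<open>The logarithm of the perturbing product in \<open>ff_eq\<close>. On a zone every factor
  lies in a small disc around 1, so the principal branch applies; as a function of exp w it is
  periodic.\<close>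

definition h :: "nat \<Rightarrow> complex \<Rightarrow> complex" where
  "h i w = (\<Sum>j\<in>{1..<n}. of_int (sg j) * Ln (1 - yy i j (exp w)))"

lemma zone_norm:
  assumes "i \<in> {1..n}" "w \<in> zone i"
  shows "lo i \<le> norm (exp w)" "norm (exp w) \<le> hi i"
proof -
  have "exp (ln (lo i)) \<le> exp (Re w)" "exp (Re w) \<le> exp (ln (hi i))" using assms(2) by (auto simp: vstrip_def)
  then show "lo i \<le> norm (exp w)" "norm (exp w) \<le> hi i"
    using lo_pos[OF assms(1)] hi_pos[OF assms(1)] by simp_all
qed

lemma sum_yy: assumes "i \<in> {1..n}" "lo i \<le> norm z" "norm z \<le> hi i"
  shows "(\<Sum>j\<in>{1..<n}. norm (yy i j z)) \<le> 1/4"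
proof -
  have "(\<Sum>j\<in>{1..<n}. norm (yy i j z)) \<le> 2 * (1/9) + real n * k"
    using k0 by (intro sum_le_two_special[where i = i]
        order_trans[OF yy_le[OF assms(1) _ assms(2,3)] t_bounds(3)[OF assms(1)]]) auto
  then show ?thesis using k_bounds(3) by simp
qed

lemma yy_less_1: assumes "i \<in> {1..n}" "lo i \<le> norm z" "norm z \<le> hi i" "j \<in> {1..<n}"
  shows "norm (yy i j z) < 1" "norm (yy i j z) < 1/2"
  using yy_le[OF assms(1,4,2,3)] t_bounds(2)[OF assms(1,4)] by linarith+

lemma h_per: "h i (w + tau * of_int m) = h i w"
  by (simp only: h_def yy_shift)

text \<open>The two adjacent circles contribute d i / 8 each. The others give 3 n K k in total, less
  than d i / 16. The sum 5/16 is below the 1/2 required by \<open>inverse_branch\<close>.\<close>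

lemma h_lip:
  assumes i: "i \<in> {1..n}" and w: "w \<in> zone i" "w' \<in> zone i"
  shows "norm (h i w - h i w') \<le> 5/16 * real (d i) * norm (w - w')"
proof -
  have "norm (Ln (1 - yy i j (exp w)) - Ln (1 - yy i j (exp w'))) \<le> real (N j) * t i j / (1 - t i j) * norm (w - w')"
    if j: "j \<in> {1..<n}" for j
  proof -
    define \<kappa> \<alpha> where "\<kappa> = (if j < i then -1 else 1 :: complex)" and "\<alpha> = (if j < i then a j else 1 / a j)"
    have y: "yy i j (exp w) = (exp (\<kappa> * w) * \<alpha>) ^ N j" for w
      by (simp add: yy_def \<kappa>_def \<alpha>_def exp_minus divide_inverse mult.commute)
    have le: "norm ((exp (\<kappa> * w) * \<alpha>) ^ N j) \<le> t i j" if "w \<in> zone i" for w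
      unfolding y[symmetric] by (rule yy_le[OF i j zone_norm[OF i that]])
    have "t i j < 1" using t_bounds(2)[OF i j] by linarith
    then show ?thesis unfolding y
      by (intro Ln_term_lipschitz[OF convex_vstrip _ t_bounds(1)[OF i j] _ le w]) (auto simp: \<kappa>_def)
  qed
  moreover have "norm (of_int (sg j) * x - of_int (sg j) * y) = norm (x - y)" for j and x y :: complex
    using sg_cases[of j] by (auto simp: norm_minus_commute)
  ultimately have "norm (h i w - h i w') \<le> (\<Sum>j\<in>{1..<n}. real (N j) * t i j / (1 - t i j) * norm (w - w'))"
    unfolding h_def sum_subtractf[symmetric] by (intro sum_norm_le) simp
  also have "\<dots> = (\<Sum>j\<in>{1..<n}. real (N j) * t i j / (1 - t i j)) * norm (w - w')"
    by (simp add: sum_distrib_right)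
  also have "\<dots> \<le> (2 * (real (d i) / 8) + real n * (3 * K * k)) * norm (w - w')"
    using t_bounds(4)[OF i] K3 k0 by (intro mult_right_mono sum_le_two_special[where i = i]) auto
  also have "\<dots> \<le> 5/16 * real (d i) * norm (w - w')"
  proof (rule mult_right_mono)
    have "2 \<le> real (d i)" using d2[OF i] by simp
    then show "2 * (real (d i) / 8) + real n * (3 * K * k) \<le> 5/16 * real (d i)"
      using k_bounds(4) by simp
  qed simp
  finally show ?thesis .
qed

lemma exp_h:
  assumes "i \<in> {1..n}" "w \<in> zone i"
  shows "exp (h i w) = (\<Prod>j\<in>{1..<n}. (1 - yy i j (exp w)) powi sg j)"
  unfolding h_def using yy_less_1(1)[OF assms(1) zone_norm[OF assms]] by (intro exp_sum_Ln) auto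

text \<open>As 2/9 + n k <= 1/4, the product lies between 3/4 and 4/3 in modulus. This is the source
  of the reserve 4/3 in \<open>low\<close> and \<open>high\<close>.\<close>

lemma h_Re:
  assumes "i \<in> {1..n}" "w \<in> zone i"
  shows "\<bar>Re (h i w)\<bar> \<le> ln (4/3)"
proof -
  have "1 - 1/4 \<le> norm (exp (h i w))" "norm (exp (h i w)) \<le> 1 / (1 - 1/4)"
    unfolding exp_h[OF assms]
    using norm_prod_one_minus_powi[of "{1..<n}" sg, OF _ sg_cases sum_yy[OF assms(1) zone_norm[OF assms]]] by auto
  then have "3/4 \<le> exp (Re (h i w))" "exp (Re (h i w)) \<le> 4/3" by simp_all
  then have "ln (3/4) \<le> ln (exp (Re (h i w)))" "ln (exp (Re (h i w))) \<le> ln (4/3)"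
    by (subst ln_le_cancel_iff; simp)+
  then have "ln (3/4) \<le> Re (h i w)" "Re (h i w) \<le> ln (4/3)" by simp_all
  moreover have "ln (3/4) = - ln (4/3 :: real)" using ln_inverse[of "4/3::real"] by simp
  ultimately show ?thesis by linarith
qed

lemma h_norm:
  assumes "i \<in> {1..n}" "w \<in> zone i"
  shows "norm (h i w) \<le> 1"
proof -
  have "norm (h i w) \<le> (\<Sum>j\<in>{1..<n}. 2 * norm (yy i j (exp w)))"
    unfolding h_def
  proof (rule sum_norm_le)
    fix j assume j: "j \<in> {1..<n}"
    have "norm (Ln (1 + - yy i j (exp w))) \<le> 2 * norm (- yy i j (exp w))"
      using yy_less_1(2)[OF assms(1) zone_norm[OF assms] j] by (intro norm_Ln_le) simp
    then show "norm (of_int (sg j) * Ln (1 - yy i j (exp w))) \<le> 2 * norm (yy i j (exp w))"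
      using sg_cases[of j] by (auto simp: norm_mult)
  qed
  also have "\<dots> \<le> 2 * (1/4)"
    unfolding sum_distrib_left[symmetric] using sum_yy[OF assms(1) zone_norm[OF assms]] by (intro mult_left_mono) auto
  finally show ?thesis by simp
qed

section \<open>Moduli of the monomials and the inverse branches over the zones\<close>

definition D :: "nat \<Rightarrow> int" where "D i = sg (i - 1) * int (d i)"
definition m :: "nat \<Rightarrow> real \<Rightarrow> real" where "m i x = norm (cc i) * x powi D i"

lemma D_pos: "sg (i - 1) = 1 \<Longrightarrow> D i = int (d i)" by (simp add: D_def)
lemma D_neg: "sg (i - 1) = -1 \<Longrightarrow> D i = - int (d i)" by (simp add: D_def)

lemma m_pos: "1 \<le> i \<Longrightarrow> 0 < x \<Longrightarrow> 0 < m i x"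
  unfolding m_def using cc_nonzero by simp

lemma sg_pred: "j \<in> {1..<n} \<Longrightarrow> sg j = - sg (j - 1)"
  using sg_Suc[of "j - 1"] by auto

lemma m_V: "j \<in> {1..<n} \<Longrightarrow> m j (b j) = V j" by (simp add: m_def V_def D_def b_a)

lemma m_match: "j \<in> {1..<n} \<Longrightarrow> m j (b j) = m (Suc j) (b j)"
  unfolding m_V by (simp add: V_match m_def D_def b_a)

lemma m_scale: assumes "0 < x" shows "m i (x * y) = m i x * y powi D i"
  by (simp add: m_def power_int_mult_distrib)

lemma m_low: "j \<in> {1..<n} \<Longrightarrow> sg j = 1 \<Longrightarrow> m j (b j) * (1 + K^2) * (4/3) \<le> r"
  using low[of j] by (simp add: m_V)

lemma m_high: "j \<in> {1..<n} \<Longrightarrow> sg j = -1 \<Longrightarrow> R * (1 + K^2) * (4/3) \<le> m j (b j)"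
  using high[of j] by (simp add: m_V)

lemma K2: "9 \<le> K^2" using power_mono[of 3 K 2] K3 by simp

text \<open>Moving from the critical circle to the edge of an adjacent zone changes the monomial by
  exactly K^2, in the direction of the annulus; the factor 1 + K^2 in \<open>low\<close> and
  \<open>high\<close> pays for it and leaves 4/3.\<close>

lemma near_circle:
  assumes j: "j \<in> {1..<n}" and q: "q ^ e = K^2"
  shows "sg j = 1 \<Longrightarrow> m j (b j) * q powi (sg j * int e) * (4/3) \<le> r"
    and "sg j = -1 \<Longrightarrow> R * (4/3) \<le> m j (b j) * q powi (sg j * int e)"
proof -
  have mp: "0 < m j (b j)" using j by (intro m_pos b_pos) auto
  assume s: "sg j = 1"
  have "m j (b j) * K^2 * (4/3) \<le> m j (b j) * (1 + K^2) * (4/3)" using mp by simp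
  then have "m j (b j) * K^2 * (4/3) \<le> r" using m_low[OF j s] by linarith
  then show "m j (b j) * q powi (sg j * int e) * (4/3) \<le> r" using q by (simp add: s)
next
  assume s: "sg j = -1"
  have K0: "0 < K^2" using K3 by simp
  have "R * (4/3) * K^2 \<le> R * (1 + K^2) * (4/3)" using R0 by simp
  then have "R * (4/3) \<le> m j (b j) / K^2" using m_high[OF j s] by (subst pos_le_divide_eq[OF K0]) linarith
  moreover have "q powi (sg j * int e) = 1 / K^2" unfolding s using q by (simp add: power_int_minus divide_inverse)
  ultimately show "R * (4/3) \<le> m j (b j) * q powi (sg j * int e)" by (simp only: times_divide_eq_right mult_1_right)
qed

text \<open>Together with \<open>zone_hi\<close>: the two boundary circles of a zone go to opposite
  sides of the annulus, with the reserve 4/3 that the perturbation may consume. The conditions on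
  the inner and outer ends replace those on critical circles at the extreme zones.\<close>

lemma zone_lo:
  assumes i: "i \<in> {1..n}"
  shows "sg (i - 1) = 1 \<longrightarrow> m i (lo i) * (4/3) \<le> r" "sg (i - 1) = -1 \<longrightarrow> R * (4/3) \<le> m i (lo i)"
proof -
  have "(sg (i - 1) = 1 \<longrightarrow> m i (lo i) * (4/3) \<le> r) \<and> (sg (i - 1) = -1 \<longrightarrow> R * (4/3) \<le> m i (lo i))"
  proof (cases "i = 1")
    case True
    have rd: "0 < r ^ d 1" using r0 by simp
    have "norm (cc 1) * r ^ d 1 * (4/3) \<le> norm (cc 1) * r ^ d 1 * (2 * K)"
      using K3 rd by (intro mult_left_mono) auto
    then have "sg 0 = 1 \<Longrightarrow> norm (cc 1) * r ^ d 1 * (4/3) \<le> r" using inner_pos by linarith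
    moreover have "R * (4/3) \<le> norm (cc 1) / r ^ d 1" if "sg 0 = -1"
    proof -
      have "R * (4/3) * r ^ d 1 \<le> 2 * K * R * r ^ d 1" using K3 R0 rd by (intro mult_right_mono) auto
      then have "R * (4/3) * r ^ d 1 \<le> norm (cc 1)" using inner_neg[OF that] by linarith
      then show ?thesis using rd by (simp add: pos_le_divide_eq)
    qed
    moreover have "sg 0 = 1 \<Longrightarrow> m 1 r = norm (cc 1) * r ^ d 1" by (simp add: m_def D_pos)
    moreover have "sg 0 = -1 \<Longrightarrow> m 1 r = norm (cc 1) / r ^ d 1"
      by (simp add: m_def D_neg power_int_minus divide_inverse)
    moreover have "lo i = r" using True by (simp add: lo_def)
    ultimately show ?thesis using True by (simp only: diff_self_eq_0) metis
  next
    case False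
    then have j: "i - 1 \<in> {1..<n}" "Suc (i - 1) = i" using i by auto
    define q where "q = K powr (2 / real (d i))"
    have "lo i = b (i - 1) * q" using False by (simp add: lo_def q_def)
    moreover have "0 < b (i - 1)" using b_pos[of "i - 1"] j by auto
    ultimately have "m i (lo i) = m (i - 1) (b (i - 1)) * q powi (sg (i - 1) * int (d i))"
      using m_match[OF j(1)] j(2) by (simp add: m_scale D_def)
    then show ?thesis using near_circle[OF j(1) K_powr(4)[OF i]] unfolding q_def by metis
  qed
  then show "sg (i - 1) = 1 \<longrightarrow> m i (lo i) * (4/3) \<le> r" "sg (i - 1) = -1 \<longrightarrow> R * (4/3) \<le> m i (lo i)" by auto
qed

lemma zone_hi:
  assumes i: "i \<in> {1..n}"
  shows "sg (i - 1) = 1 \<longrightarrow> R * (4/3) \<le> m i (hi i)" "sg (i - 1) = -1 \<longrightarrow> m i (hi i) * (4/3) \<le> r"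
proof -
  have "(sg (i - 1) = 1 \<longrightarrow> R * (4/3) \<le> m i (hi i)) \<and> (sg (i - 1) = -1 \<longrightarrow> m i (hi i) * (4/3) \<le> r)"
  proof (cases "i = n")
    case True
    have dn: "2 \<le> real (d n)" using d2[of n] n2 by simp
    have Rd: "0 < R ^ d n" using R0 by simp
    have f: "4/3 \<le> (real (d n) + 1/10) * (11/10)" using dn by simp
    have "R * (4/3) \<le> R ^ d n" if "sg (n - 1) = 1"
    proof -
      have "(4/3) * R \<le> ((real (d n) + 1/10) * (11/10)) * R" using f R0 by (intro mult_right_mono) auto
      then show ?thesis using outer_pos[OF that] by linarith
    qed
    moreover have "1 / R ^ d n * (4/3) \<le> r" if "sg (n - 1) = -1"
      using f outer_neg[OF that] Rd by (simp add: divide_simps mult_ac)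
    moreover have "sg (n - 1) = 1 \<Longrightarrow> m n R = R ^ d n" by (simp add: m_def D_pos cc_n)
    moreover have "sg (n - 1) = -1 \<Longrightarrow> m n R = 1 / R ^ d n"
      by (simp add: m_def D_neg cc_n power_int_minus divide_inverse)
    moreover have "hi n = R" by (simp add: hi_def)
    ultimately show ?thesis unfolding True by metis
  next
    case False
    then have j: "i \<in> {1..<n}" using i by auto
    define q where "q = K powr (2 / real (d i))"
    have "hi i = b i * inverse q" using False K_powr(3)[OF i] by (simp add: hi_def q_def divide_inverse)
    moreover have "0 < b i" using b_pos[of i] i by auto
    moreover have "inverse q powi D i = q powi (sg i * int (d i))"
      using sg_pred[OF j] by (simp add: D_def power_int_inverse power_int_minus)
    ultimately have "m i (hi i) = m i (b i) * q powi (sg i * int (d i))" by (simp add: m_scale)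
    moreover have "sg (i - 1) = - sg i" using sg_pred[OF j] by simp
    ultimately show ?thesis using near_circle[OF j K_powr(4)[OF i]] unfolding q_def by auto
  qed
  then show "sg (i - 1) = 1 \<longrightarrow> R * (4/3) \<le> m i (hi i)" "sg (i - 1) = -1 \<longrightarrow> m i (hi i) * (4/3) \<le> r" by auto
qed

lemma ln_m: "1 \<le> i \<Longrightarrow> 0 < x \<Longrightarrow> ln (m i x) = ln (norm (cc i)) + of_int (D i) * ln x"
proof -
  assume i: "1 \<le> i" and x: "0 < x"
  have "ln (x powi D i) = of_int (D i) * ln x"
    using x sg_cases[of "i - 1"] by (auto simp: D_def power_int_minus ln_inverse ln_realpow)
  moreover have "ln (m i x) = ln (norm (cc i)) + ln (x powi D i)"
    unfolding m_def by (rule ln_mult_pos) (use x cc_nonzero[OF i] in auto)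
  ultimately show ?thesis by simp
qed

lemma ff_exp:
  assumes i: "i \<in> {1..n}" and w: "w \<in> zone i"
  shows "FF (Some (exp w)) = Some (exp (of_int (D i) * w + Ln (cc i) + h i w))"
proof -
  have "FF (Some (exp w)) = Some (ff (exp w))"
    by (rule regular[where i = i]) (use yy_less_1(1)[OF i zone_norm[OF i w]] in force)+
  moreover have "ff (exp w) = cc i * exp w powi D i * exp (h i w)"
    using ff_eq[of i "exp w"] i exp_h[OF i w] by (simp add: D_def)
  moreover have "exp (Ln (cc i)) = cc i" using cc_nonzero i by (simp add: exp_Ln)
  moreover have "exp w powi D i = exp (of_int (D i) * w)" by (metis exp_power_int mult.commute)
  ultimately show ?thesis by (simp add: exp_add mult_ac)
qed

lemma abs_D: "\<bar>D i\<bar> = int (d i)"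
  using sg_cases[of "i - 1"] by (auto simp: D_def)

text \<open>The conclusions of \<open>inverse_branch\<close> gathered into one predicate, so that
  branches for all i can be chosen at once. The constant 8/11 is 1 / (2 (1 - L)) for L =
  5/16.\<close>

definition is_branch :: "nat \<Rightarrow> (complex \<Rightarrow> complex) \<Rightarrow> bool" where
  "is_branch i G \<longleftrightarrow> (\<forall>v\<in>vstrip (ln r) (ln R). G v \<in> zone i
      \<and> of_int (D i) * G v + Ln (cc i) + h i (G v) = v
      \<and> (\<forall>v'\<in>vstrip (ln r) (ln R). dist (G v) (G v') \<le> 8/11 * dist v v')
      \<and> (\<forall>m. G (v + tau * of_int (D i * m)) = G v + tau * of_int m)
      \<and> norm (G v - v / of_int (D i)) \<le> norm (Ln (cc i)) + 1)
    \<and> (\<forall>w\<in>zone i. of_int (D i) * w + Ln (cc i) + h i w \<in> vstrip (ln r) (ln R) \<longrightarrow>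
        G (of_int (D i) * w + Ln (cc i) + h i w) = w)"

lemma branch_exists:
  assumes i: "i \<in> {1..n}"
  shows "\<exists>G. is_branch i G"
proof (rule inverse_branch[of "D i" "5/16" "ln r" "ln R" "ln (lo i)" "ln (hi i)" "h i" "ln (4/3)" 1 "Ln (cc i)"], goal_cases)
  case 1
  then show ?case using abs_D[of i] d2[OF i] by simp
next
  case 4
  then show ?case using r0 R_gt by simp
next
  case (5 w w')
  then show ?case using h_lip[OF i 5] abs_D[of i] by (simp flip: of_int_abs)
next
  case (6 w m)
  then show ?case by (rule h_per)
next
  case (7 w)
  then show ?case by (rule h_Re[OF i])
next
  case (8 w)
  then show ?case by (rule h_norm[OF i])
next
  case 10
  then have s: "sg (i - 1) = 1" using sg_cases[of "i - 1"] by (auto simp: D_def)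
  have i1: "1 \<le> i" using i by simp
  have Re: "Re (Ln (cc i)) = ln (norm (cc i))" using cc_nonzero[OF i1] by simp
  have "ln (m i (lo i) * (4/3)) \<le> ln r" "ln (R * (4/3)) \<le> ln (m i (hi i))"
    using zone_lo(1)[OF i, rule_format, OF s] zone_hi(1)[OF i, rule_format, OF s] m_pos[OF i1] lo_pos[OF i] hi_pos[OF i] r0 R0
    by (subst ln_le_cancel_iff; simp)+
  then show ?case
    using ln_m[OF i1 lo_pos[OF i]] ln_m[OF i1 hi_pos[OF i]] ln_mult_pos[OF m_pos[OF i1 lo_pos[OF i]], of "4/3"]
      ln_mult_pos[OF R0, of "4/3"] unfolding Re by linarith
next
  case 11
  then have s: "sg (i - 1) = -1" using sg_cases[of "i - 1"] by (auto simp: D_def)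
  have i1: "1 \<le> i" using i by simp
  have Re: "Re (Ln (cc i)) = ln (norm (cc i))" using cc_nonzero[OF i1] by simp
  have "ln (m i (hi i) * (4/3)) \<le> ln r" "ln (R * (4/3)) \<le> ln (m i (lo i))"
    using zone_lo(2)[OF i, rule_format, OF s] zone_hi(2)[OF i, rule_format, OF s] m_pos[OF i1] lo_pos[OF i] hi_pos[OF i] r0 R0
    by (subst ln_le_cancel_iff; simp)+
  then show ?case
    using ln_m[OF i1 lo_pos[OF i]] ln_m[OF i1 hi_pos[OF i]] ln_mult_pos[OF m_pos[OF i1 hi_pos[OF i]], of "4/3"]
      ln_mult_pos[OF R0, of "4/3"] unfolding Re by linarith
next
  case (12 G)
  then show ?case unfolding is_branch_def by (intro exI[of _ G]) simp
qed simp_all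

text \<open>In the ring around circle i all factors but the i-th together stay between 10/11 and
  11/10. The i-th factor and the monomial are controlled by \<open>ratio_bound\<close>, and since
  4/3 > 11/10 the image falls strictly below r or above R; poles go to infinity.\<close>

lemma critical_escape:
  assumes i: "i \<in> {1..<n}" and z: "hi i < norm z" "norm z < lo (Suc i)"
  shows "FF (Some z) = None \<or> (\<exists>y. FF (Some z) = Some y \<and> (norm y < r \<or> R < norm y))"
proof (cases "poly den z = 0")
  case True
  then show ?thesis by (simp add: FF_Some)
next
  case False
  then have FF: "FF (Some z) = Some (ff z)" by (simp add: FF_Some)
  have i1: "i \<in> {1..n}" "Suc i \<in> {1..n}" "1 \<le> i" using i by auto
  have b0: "0 < b i" using b_pos[of i] i by auto
  have nz: "0 < norm z" using z(1) hi_pos[OF i1(1)] by linarith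
  define q q' where "q = K powr (2 / real (d i))" and "q' = K powr (2 / real (d (Suc i)))"
  have q: "1 < q" "q \<le> K" "q ^ d i = K^2" using K_powr[OF i1(1)] by (auto simp: q_def)
  have q': "1 < q'" "q' \<le> K" "q' ^ d (Suc i) = K^2" using K_powr[OF i1(2)] by (auto simp: q'_def)
  have hi: "hi i = b i / q" using K_powr(3)[OF i1(1)] i by (auto simp: hi_def q_def)
  have lo: "lo (Suc i) = b i * q'" using i by (auto simp: lo_def q'_def)
  \<comment> \<open>In this variable the ring becomes 1/q < x < q', and both q and q' are at most
    K.\<close>
  define x where "x = norm z / b i"
  have x0: "0 < x" using nz b0 by (simp add: x_def)
  have zx: "norm z = b i * x" using b0 by (simp add: x_def)
  have "1 \<le> q * x" using z(1) b0 q unfolding hi zx by (simp add: field_simps)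
  then have "1 \<le> (q * x) ^ d i" by (rule one_le_power)
  then have x1: "1 \<le> K^2 * x ^ d i" using q by (simp add: power_mult_distrib)
  have "x \<le> q'" using z(2) b0 unfolding lo zx by simp
  then have "x ^ d (Suc i) \<le> q' ^ d (Suc i)" using x0 by (intro power_mono) auto
  then have x2: "x ^ d (Suc i) \<le> K^2" using q' by simp
  have rb: "1 + x ^ N i \<le> (1 + K^2) * x ^ d i"
    using ratio_bound[OF x0 x1 x2] by (simp add: N_def)
  have xK: "1 \<le> K * x" "x \<le> K"
    using \<open>1 \<le> q * x\<close> mult_right_mono[OF q(2), of x] x0 \<open>x \<le> q'\<close> q'(2) by linarith+
  let ?y = "yy i i z"
  have ny: "norm ?y = x ^ N i" using b_a[OF i] by (simp add: yy_def norm_power norm_divide x_def)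
  define Q where "Q = norm (\<Prod>j\<in>{1..<n} - {i}. (1 - yy i j z) powi sg j)"
  have "norm (yy i j z) \<le> K * k" if j: "j \<in> {1..<n} - {i}" for j
  proof -
    have bj: "b j = norm (a j)" "0 < b j" using b_a[of j] b_pos[of j] j by auto
    have N1: "1 \<le> N j" using d2[of j] j by (simp add: N_def)
    have Kk: "0 \<le> K * k" "K * k \<le> 1" using k0 K3 k_bounds(2) by auto
    have pw: "u ^ N j \<le> K * k" if "0 \<le> u" "u \<le> K * k" for u
    proof -
      have "u ^ N j \<le> u ^ 1" using that Kk N1 by (intro power_decreasing) auto
      then show ?thesis using that by simp
    qed
    show ?thesis
    proof (cases "j < i")
      case True
      have "b j \<le> k * b i" using b_less[of j i] True i by auto
      also have "\<dots> \<le> k * (b i * (K * x))" using xK b0 k0 by (intro mult_left_mono) auto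
      finally have "b j / norm z \<le> K * k" using nz unfolding zx by (simp add: pos_divide_le_eq mult_ac)
      then have "(b j / norm z) ^ N j \<le> K * k" using bj nz by (intro pw) auto
      then show ?thesis using True bj by (simp add: yy_def norm_power norm_divide)
    next
      case False
      then have ij: "i < j" using j by auto
      have "norm z \<le> b i * K" unfolding zx using xK b0 by (intro mult_left_mono) auto
      also have "\<dots> \<le> (k * b j) * K" using b_less[OF ij] j K3 by (intro mult_right_mono) auto
      finally have "norm z / b j \<le> K * k" using bj by (simp add: pos_divide_le_eq mult_ac)
      then have "(norm z / b j) ^ N j \<le> K * k" using bj nz by (intro pw) auto
      then show ?thesis using False bj by (simp add: yy_def norm_power norm_divide)
    qed
  qed
  then have "(\<Sum>j\<in>{1..<n} - {i}. norm (yy i j z)) \<le> (\<Sum>j\<in>{1..<n} - {i}. K * k)" by (rule sum_mono)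
  also have "\<dots> \<le> real n * (K * k)"
  proof -
    have "card ({1..<n} - {i}) \<le> card {1..<n}" by (intro card_mono) auto
    then show ?thesis using k0 K3 by (simp del: card_Diff_insert)
  qed
  finally have sum: "(\<Sum>j\<in>{1..<n} - {i}. norm (yy i j z)) \<le> 1/11" using k_bounds(4) by (simp add: mult.assoc)
  have Q: "10/11 \<le> Q" "Q \<le> 11/10"
    using norm_prod_one_minus_powi[of "{1..<n} - {i}" sg, OF _ sg_cases sum] by (auto simp: Q_def)
  have "ff z = cc i * z powi D i * ((1 - ?y) powi sg i * (\<Prod>j\<in>{1..<n} - {i}. (1 - yy i j z) powi sg j))"
    using ff_eq[of i z] i nz prod.remove[OF _ i, of "\<lambda>j. (1 - yy i j z) powi sg j"] by (simp add: D_def)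
  then have "norm (ff z) = m i (norm z) * (norm (1 - ?y) powi sg i * Q)"
    by (simp add: norm_mult norm_power_int m_def Q_def)
  also have "m i (norm z) = m i (b i) * x powi D i" unfolding zx by (rule m_scale[OF b0])
  finally have nf: "norm (ff z) = m i (b i) * x powi D i * (norm (1 - ?y) powi sg i * Q)" .
  have mp: "0 < m i (b i)" by (rule m_pos[OF i1(3) b0])
  have up: "norm (1 - ?y) \<le> (1 + K^2) * x ^ d i"
    using norm_triangle_ineq4[of 1 ?y] ny rb by simp
  have xd: "0 < x ^ d i" using x0 by simp
  show ?thesis
  proof (cases "sg i = 1")
    case True
    then have s: "sg (i - 1) = -1" using sg_pred[OF i] by simp
    have "norm (1 - ?y) / x ^ d i \<le> 1 + K^2" using up xd by (simp add: pos_divide_le_eq)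
    then have "norm (1 - ?y) / x ^ d i * Q \<le> (1 + K^2) * (11/10)" using Q by (intro mult_mono) auto
    moreover have "x powi D i = 1 / x ^ d i" using s by (simp add: D_neg power_int_minus divide_inverse)
    then have "norm (ff z) = m i (b i) * (norm (1 - ?y) / x ^ d i * Q)"
      unfolding nf True by simp
    ultimately have "norm (ff z) \<le> m i (b i) * ((1 + K^2) * (11/10))"
      using mp by (simp only: mult_left_mono less_imp_le)
    also have "\<dots> < m i (b i) * (1 + K^2) * (4/3)" using mp K2 by (simp add: mult.assoc)
    also have "\<dots> \<le> r" by (rule m_low[OF i True])
    finally show ?thesis using FF by simp
  next
    case False
    then have si: "sg i = -1" using sg_cases[of i] by auto
    then have s: "sg (i - 1) = 1" using sg_pred[OF i] by simp
    have "?y \<noteq> 1"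
    proof
      assume "?y = 1"
      then have "z ^ N i - a i ^ N i = 0" using factor_nonzero_iff[OF i, of i z] by simp
      then have "poly den z = 0" unfolding poly_den using i si by (auto simp: prod_zero_iff)
      with False \<open>poly den z \<noteq> 0\<close> show False by simp
    qed
    then have p: "0 < norm (1 - ?y)" by simp
    have K1: "0 < 1 + K^2" using K2 by linarith
    have "norm (1 - ?y) / (1 + K^2) \<le> x ^ d i"
      using up K1 by (simp only: pos_divide_le_eq mult.commute)
    then have "1 / (1 + K^2) \<le> x ^ d i / norm (1 - ?y)"
      using p by (simp add: pos_le_divide_eq)
    then have "1 / (1 + K^2) * (10/11) \<le> x ^ d i / norm (1 - ?y) * Q" using Q K2 xd p by (intro mult_mono) auto
    then have "m i (b i) * (1 / (1 + K^2) * (10/11)) \<le> m i (b i) * (x ^ d i / norm (1 - ?y) * Q)"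
      using mp by (intro mult_left_mono) auto
    also have "\<dots> = norm (ff z)"
    proof -
      have "x powi D i = x ^ d i" using s by (simp add: D_pos)
      then show ?thesis unfolding nf si by (simp add: power_int_minus divide_inverse)
    qed
    finally have 1: "m i (b i) * (1 / (1 + K^2) * (10/11)) \<le> norm (ff z)" .
    have "R < R * (4/3) * (10/11)" using R0 by simp
    also have "\<dots> = R * (1 + K^2) * (4/3) * (1 / (1 + K^2) * (10/11))"
      using K2 by (simp add: field_simps)
    also have "\<dots> \<le> m i (b i) * (1 / (1 + K^2) * (10/11))"
      using K2 by (intro mult_right_mono m_high[OF i si]) auto
    finally show ?thesis using 1 FF by simp
  qed
qed

section \<open>The two ends are mapped into ends without expansion\<close>

lemma disc_side:
  fixes \<beta> :: "nat \<Rightarrow> complex" and s :: "nat \<Rightarrow> int"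
  assumes s: "\<And>j. j \<in> {1..<n} \<Longrightarrow> s j = 1 \<or> s j = -1"
    and \<beta>: "\<And>j. j \<in> {1..<n} \<Longrightarrow> norm (\<beta> j) \<le> k"
    and i: "i \<in> {1..n}" and c: "norm c * ((real (d i) + 1/10) * (11/10)) \<le> 1"
    and eq: "\<And>u. u \<in> ball 0 1 \<Longrightarrow> FF (chart r R e u) =
      chart r R e' (c * u ^ d i * (\<Prod>j\<in>{1..<n}. (1 - (u * \<beta> j) ^ N j) powi s j))"
  shows "nonexp_between r R FF e e'"
proof -
  have N: "1 \<le> N j \<and> real (N j) \<le> 2 * K" if "j \<in> {1..<n}" for j
    using d2[of j] dK[of j] dK[of "Suc j"] that by (auto simp: N_def)
  have "real (card {1..<n}) * (K * k) \<le> real n * (K * k)" using K3 k0 by (intro mult_right_mono) auto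
  then have "20 * real (card {1..<n}) * (2 * K) * k \<le> 1" using k_bounds(4) by (simp add: mult_ac)
  from disc_map[OF _ s N \<beta> less_imp_le[OF k0] this _ _ _ c]
  show ?thesis
    unfolding nonexp_between_def using eq k_bounds(1) K3 d2[OF i]
    by (intro exI[of _ "\<lambda>u. c * u ^ d i * (\<Prod>j\<in>{1..<n}. (1 - (u * \<beta> j) ^ N j) powi s j)"]) auto
qed

lemma inner_beta: "j \<in> {1..<n} \<Longrightarrow> norm (of_real r / a j) \<le> k"
  using b_less[of 0 j] b_a[of j] b_pos[of j] r0 by (auto simp: norm_divide b_def pos_divide_le_eq)

lemma outer_beta: "j \<in> {1..<n} \<Longrightarrow> norm (a j / of_real R) \<le> k"
  using b_less[of j n] b_a[of j] R0 n2 by (auto simp: norm_divide b_def pos_divide_le_eq)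

lemma small_factor: "norm (x :: complex) \<le> k \<Longrightarrow> norm u < 1 \<Longrightarrow> j \<in> {1..<n} \<Longrightarrow> (u * x) ^ N j \<noteq> 1"
proof
  assume x: "norm x \<le> k" "norm u < 1" "j \<in> {1..<n}" "(u * x) ^ N j = 1"
  have "norm (u * x) \<le> 1 * k" unfolding norm_mult using x by (intro mult_mono) auto
  then have "norm (u * x) < 1" using k_bounds(1) by linarith
  moreover have "N j \<noteq> 0" using d2[of j] x(3) by (simp add: N_def)
  ultimately have "norm (u * x) ^ N j < 1" by (simp add: power_less_one_iff)
  then show False using x(4) by (metis norm_one norm_power less_irrefl)
qed

text \<open>Both ends are treated at once: in the disc coordinate the map is C u^(s d i) times a
  product near 1. For s = 1 it lands in the inner end. For s = -1 it lands in the outer end, where a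
  value y has coordinate R / y, so all exponents change sign.\<close>

lemma end_of_monomial:
  fixes \<beta> :: "nat \<Rightarrow> complex" and s :: int
  assumes \<beta>: "\<And>j. j \<in> {1..<n} \<Longrightarrow> norm (\<beta> j) \<le> k" and i: "i \<in> {1..n}" and s: "s = 1 \<or> s = -1" and C: "C \<noteq> 0"
    and at0: "FF (chart r R e 0) = (if s = 1 then Some 0 else None)"
    and eq: "\<And>u. u \<in> ball 0 1 \<Longrightarrow> u \<noteq> 0 \<Longrightarrow> FF (chart r R e u) =
      Some (C * u powi (s * int (d i)) * (\<Prod>j\<in>{1..<n}. (1 - (u * \<beta> j) ^ N j) powi sg j))"
    and bnd: "if s = 1 then (real (d i) + 1/10) * (11/10) * norm C \<le> r else (real (d i) + 1/10) * (11/10) * R \<le> norm C"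
  shows "\<exists>e'. nonexp_between r R FF e e'"
proof (cases "s = 1")
  case True
  have "nonexp_between r R FF e True"
  proof (rule disc_side[OF sg_cases \<beta> i, where c = "C / of_real r"])
    have "norm (C / of_real r) * ((real (d i) + 1/10) * (11/10)) = (real (d i) + 1/10) * (11/10) * norm C / r"
      using r0 by (simp only: norm_divide norm_of_real abs_of_pos times_divide_eq_left mult.commute)
    also have "\<dots> \<le> 1" using bnd True r0 by (subst pos_divide_le_eq) simp_all
    finally show "norm (C / of_real r) * ((real (d i) + 1/10) * (11/10)) \<le> 1" .
  next
    fix u :: complex assume u: "u \<in> ball 0 1"
    show "FF (chart r R e u) = chart r R True (C / of_real r * u ^ d i * (\<Prod>j\<in>{1..<n}. (1 - (u * \<beta> j) ^ N j) powi sg j))"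
      using eq[OF u] at0 True r0 d2[OF i] by (cases "u = 0") (simp_all add: chart_def)
  qed
  then show ?thesis by blast
next
  case False
  then have s: "s = -1" using s by simp
  have "nonexp_between r R FF e False"
  proof (rule disc_side[OF _ \<beta> i, where c = "of_real R / C" and s = "\<lambda>j. - sg j"])
    show "- sg j = 1 \<or> - sg j = -1" for j using sg_cases[of j] by auto
    have "norm (of_real R / C) * ((real (d i) + 1/10) * (11/10)) = (real (d i) + 1/10) * (11/10) * R / norm C"
      using R0 by (simp only: norm_divide norm_of_real abs_of_pos times_divide_eq_left mult.commute)
    also have "\<dots> \<le> 1" using bnd False C by (subst pos_divide_le_eq) simp_all
    finally show "norm (of_real R / C) * ((real (d i) + 1/10) * (11/10)) \<le> 1" .
  next
    fix u :: complex assume u: "u \<in> ball 0 1"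
    let ?P = "\<Prod>j\<in>{1..<n}. (1 - (u * \<beta> j) ^ N j) powi sg j"
    have P: "(\<Prod>j\<in>{1..<n}. (1 - (u * \<beta> j) ^ N j) powi (- sg j)) = inverse ?P"
      by (simp add: power_int_minus prod_inversef[unfolded o_def])
    have P0: "?P \<noteq> 0" using small_factor[OF \<beta>] u by (auto simp: power_int_eq_0_iff)
    show "FF (chart r R e u) = chart r R False (of_real R / C * u ^ d i * (\<Prod>j\<in>{1..<n}. (1 - (u * \<beta> j) ^ N j) powi (- sg j)))"
    proof (cases "u = 0")
      case True
      then show ?thesis using at0 s d2[OF i] by (simp add: chart_def inv_pt_def)
    next
      case False
      have "of_real R / C * u ^ d i * inverse ?P / of_real R = 1 / (C * u powi (s * int (d i)) * ?P)"
        using R0 by (simp add: s power_int_minus field_simps)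
      then show ?thesis unfolding P eq[OF u False] using False C P0
        by (simp add: chart_def inv_pt_def s power_int_minus)
    qed
  qed
  then show ?thesis by blast
qed

lemma end_inner: "\<exists>e'. nonexp_between r R FF True e'"
proof (rule end_of_monomial[OF inner_beta, where i = 1 and s = "sg 0" and C = "cc 1 * of_real r powi (sg 0 * int (d 1))"])
  have yy: "yy 1 j (of_real r * u) = (u * (of_real r / a j)) ^ N j" if "j \<in> {1..<n}" for j u
    using that by (simp add: yy_def mult.commute)
  show "FF (chart r R True 0) = (if sg 0 = 1 then Some 0 else None)"
  proof (cases "sg 0 = 1")
    case True
    have "yy 1 j 0 \<noteq> 1" if "j \<in> {1..<n}" for j using d2[of j] that by (auto simp: yy_def N_def power_0_left)
    then have "FF (Some 0) = Some (ff 0)" using True by (intro regular[where i = 1]) auto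
    then show ?thesis using True ff_zero by (simp add: chart_def)
  qed (use FF_pole sg_cases[of 0] in \<open>auto simp: chart_def\<close>)
  fix u :: complex assume u: "u \<in> ball 0 1" "u \<noteq> 0"
  have "FF (Some (of_real r * u)) = Some (ff (of_real r * u))"
    by (rule regular[where i = 1]) (use u r0 small_factor[OF inner_beta] yy in auto)
  then show "FF (chart r R True u) = Some (cc 1 * of_real r powi (sg 0 * int (d 1)) * u powi (sg 0 * int (d 1)) *
      (\<Prod>j\<in>{1..<n}. (1 - (u * (of_real r / a j)) ^ N j) powi sg j))"
    using ff_eq[of 1 "of_real r * u"] r0 n2 u(2) yy[of _ u] by (simp add: chart_def power_int_mult_distrib)
next
  have "2 \<le> real (d 1)" "real (d 1) \<le> K" using d2[of 1] dK[of 1] n2 by auto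
  then have K: "(real (d 1) + 1/10) * (11/10) \<le> 2 * K" using K3 by simp
  show "if sg 0 = 1 then (real (d 1) + 1/10) * (11/10) * norm (cc 1 * of_real r powi (sg 0 * int (d 1))) \<le> r
    else (real (d 1) + 1/10) * (11/10) * R \<le> norm (cc 1 * of_real r powi (sg 0 * int (d 1)))"
  proof (cases "sg 0 = 1")
    case True
    have "(real (d 1) + 1/10) * (11/10) * (norm (cc 1) * r ^ d 1) \<le> 2 * K * (norm (cc 1) * r ^ d 1)"
      using r0 K by (intro mult_right_mono) auto
    also have "\<dots> \<le> r" using inner_pos[OF True] by (simp only: mult_ac)
    finally show ?thesis using True r0 by (simp add: norm_mult norm_power)
  next
    case False
    then have s: "sg 0 = -1" using sg_cases[of 0] by auto
    have "(real (d 1) + 1/10) * (11/10) * (R * r ^ d 1) \<le> 2 * K * (R * r ^ d 1)"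
      using r0 R0 K by (intro mult_right_mono) auto
    also have "\<dots> \<le> norm (cc 1)" using inner_neg[OF s] by (simp only: mult_ac)
    finally have "(real (d 1) + 1/10) * (11/10) * R \<le> norm (cc 1) / r ^ d 1"
      using r0 by (subst pos_le_divide_eq) (simp_all only: mult.assoc zero_less_power)
    moreover have "norm (cc 1 * of_real r powi (sg 0 * int (d 1))) = norm (cc 1) / r ^ d 1"
      unfolding s norm_mult norm_power_int using r0 by (simp add: power_int_minus divide_inverse)
    ultimately show ?thesis using False by (simp only: if_False)
  qed
qed (use n2 r0 cc_nonzero[of 1] sg_cases in auto)

lemma end_outer: "\<exists>e'. nonexp_between r R FF False e'"
proof (rule end_of_monomial[OF outer_beta, where i = n and s = "- sg (n - 1)" and C = "of_real R powi (sg (n - 1) * int (d n))"])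
  have yy: "yy n j (of_real R / u) = (u * (a j / of_real R)) ^ N j" if "j \<in> {1..<n}" "u \<noteq> 0" for j u
    using that R0 by (simp add: yy_def mult.commute)
  show "FF (chart r R False 0) = (if - sg (n - 1) = 1 then Some 0 else None)"
    using FF_None sg_cases[of "n - 1"] by (auto simp: chart_def inv_pt_def)
  fix u :: complex assume u: "u \<in> ball 0 1" "u \<noteq> 0"
  have "FF (Some (of_real R / u)) = Some (ff (of_real R / u))"
    by (rule regular[where i = n]) (use u R0 small_factor[OF outer_beta] yy in auto)
  moreover have "(of_real R / u) powi (sg (n - 1) * int (d n)) = of_real R powi (sg (n - 1) * int (d n)) * u powi (- sg (n - 1) * int (d n))"
    unfolding power_int_divide_distrib by (simp add: power_int_minus divide_inverse)
  ultimately show "FF (chart r R False u) = Some (of_real R powi (sg (n - 1) * int (d n)) * u powi (- sg (n - 1) * int (d n)) *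
      (\<Prod>j\<in>{1..<n}. (1 - (u * (a j / of_real R)) ^ N j) powi sg j))"
    using ff_eq[of n "of_real R / u"] R0 n2 u(2) yy[of _ u] by (simp add: chart_def inv_pt_def cc_n)
next
  show "if - sg (n - 1) = 1 then (real (d n) + 1/10) * (11/10) * norm (complex_of_real R powi (sg (n - 1) * int (d n))) \<le> r
    else (real (d n) + 1/10) * (11/10) * R \<le> norm (complex_of_real R powi (sg (n - 1) * int (d n)))"
  proof (cases "sg (n - 1) = 1")
    case True
    then show ?thesis using outer_pos R0 by (simp add: norm_power)
  next
    case False
    then have s: "sg (n - 1) = -1" using sg_cases[of "n - 1"] by auto
    have "(real (d n) + 1/10) * (11/10) / R ^ d n \<le> r"
      using outer_neg[OF s] R0 by (subst pos_divide_le_eq) simp_all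
    moreover have "norm (complex_of_real R powi (sg (n - 1) * int (d n))) = 1 / R ^ d n"
      unfolding s norm_power_int using R0 by (simp add: power_int_minus divide_inverse)
    ultimately show ?thesis using s by (simp only: minus_minus if_True simp_thms mult_1_right times_divide_eq_right)
  qed
qed (use n2 R0 sg_cases[of "n - 1"] in auto)

text \<open>Numerator and denominator could vanish together at z only if |z| equalled the radii of
  two different critical circles, and these are separated.\<close>

lemma FF_cont: assumes "z \<noteq> 0" shows "chordal_cont FF (Some z)"
  unfolding fmap_def
proof (rule rat_ext_chordal_cont)
  have "poly num z \<noteq> 0 \<or> poly den z \<noteq> 0"
  proof (rule ccontr)
    assume "\<not> ?thesis"
    then obtain j j' where j: "j \<in> {1..<n}" "j' \<in> {1..<n}" "sg j = 1" "sg j' = -1"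
      "z ^ N j = a j ^ N j" "z ^ N j' = a j' ^ N j'"
      unfolding poly_num poly_den using assms by (auto split: if_splits)
    have eq: "norm z = b l" if "l \<in> {1..<n}" "z ^ N l = a l ^ N l" for l
    proof -
      have "N l > 0" using d2[of l] that(1) by (simp add: N_def)
      moreover have "norm z ^ N l = norm (a l) ^ N l" using that(2) by (metis norm_power)
      ultimately show ?thesis using power_eq_imp_eq_base[of "norm z" "N l" "norm (a l)"] b_a[OF that(1)] by simp
    qed
    have ne: "b i \<noteq> b l" if "i < l" "l \<le> n" for i l
    proof -
      have "b i \<le> k * b l" using b_less that by auto
      also have "\<dots> < 1 * b l" using k_bounds(1) b_pos[of l] that by (intro mult_strict_right_mono) auto
      finally show ?thesis by simp
    qed
    have "j \<noteq> j'" using j by auto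
    then show False using ne[of j j'] ne[of j' j] eq[of j] eq[of j'] j by (metis atLeastLessThan_iff less_imp_le nat_neq_iff)
  qed
  then show "poly (f_num p n d a) z \<noteq> 0 \<or> poly (f_den p n d a) z \<noteq> 0" by (simp add: num_def den_def)
qed

sublocale attracting_ends FF r R
proof
  show "0 < r" "r < R" by (rule r0, rule R_gt)
  show "\<exists>e'. nonexp_between r R FF e e'" for e
    using end_inner end_outer by (cases e) auto
  show "chordal_cont FF (Some z)" if "r \<le> norm z" "norm z \<le> R" for z
    using that r0 by (intro FF_cont) auto
qed

lemma zone_or_critical:
  assumes "r \<le> x" "x \<le> R"
  shows "(\<exists>i\<in>{1..n}. lo i \<le> x \<and> x \<le> hi i) \<or> (\<exists>i\<in>{1..<n}. hi i < x \<and> x < lo (Suc i))"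
proof -
  \<comment> \<open>Take the first zone whose outer radius reaches x: either x lies in it, or x lies
    in the ring just inside it.\<close>
  define i where "i = (LEAST i. i \<in> {1..n} \<and> x \<le> hi i)"
  have "n \<in> {1..n} \<and> x \<le> hi n" using assms n2 by (simp add: hi_def)
  then have i: "i \<in> {1..n}" "x \<le> hi i" unfolding i_def by (metis (mono_tags, lifting) LeastI)+
  have least: "\<not> x \<le> hi l" if "l \<in> {1..n}" "l < i" for l
    using not_less_Least[of l "\<lambda>i. i \<in> {1..n} \<and> x \<le> hi i"] that unfolding i_def by blast
  show ?thesis
  proof (cases "lo i \<le> x")
    case True
    then show ?thesis using i by blast
  next
    case False
    then have "i \<noteq> 1" using assms by (auto simp: lo_def)
    then have "i - 1 \<in> {1..<n}" "Suc (i - 1) = i" using i by auto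
    moreover from this have "hi (i - 1) < x" using least[of "i - 1"] by auto
    ultimately have "i - 1 \<in> {1..<n}" "Suc (i - 1) = i" "hi (i - 1) < x" by blast+
    then show ?thesis using False by (intro disjI2 bexI[of _ "i - 1"]) auto
  qed
qed

lemma zone_subset: "i \<in> {1..n} \<Longrightarrow> zone i \<subseteq> vstrip (ln r) (ln R)"
proof -
  assume i: "i \<in> {1..n}"
  have "b 0 \<le> b (i - 1)" "b i \<le> b n" by (rule b_mono; use i in auto)+
  moreover have "b 0 = r" "b n = R" using n2 by (auto simp: b_def)
  ultimately have "r \<le> lo i" "hi i \<le> R" using lo_ge[OF i] hi_le[OF i] by linarith+
  then have "ln r \<le> ln (lo i)" "ln (hi i) \<le> ln R" using r0 hi_pos[OF i] by auto
  then show ?thesis by (auto simp: vstrip_def)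
qed

theorem cantor_set_of_circles_julia: "cantor_set_of_circles (julia_set FF)"
proof -
  let ?S = "vstrip (ln r) (ln R)"
  obtain G where "\<forall>i\<in>{1..n}. is_branch i (G i)"
    using bchoice[of "{1..n}" is_branch] branch_exists by blast
  then have G: "\<And>i v. i \<in> {1..n} \<Longrightarrow> v \<in> ?S \<Longrightarrow> G i v \<in> zone i"
    "\<And>i v. i \<in> {1..n} \<Longrightarrow> v \<in> ?S \<Longrightarrow> of_int (D i) * G i v + Ln (cc i) + h i (G i v) = v"
    "\<And>i v v'. i \<in> {1..n} \<Longrightarrow> v \<in> ?S \<Longrightarrow> v' \<in> ?S \<Longrightarrow> dist (G i v) (G i v') \<le> 8/11 * dist v v'"
    "\<And>i v m. i \<in> {1..n} \<Longrightarrow> v \<in> ?S \<Longrightarrow> G i (v + tau * of_int (D i * m)) = G i v + tau * of_int m"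
    "\<And>i v. i \<in> {1..n} \<Longrightarrow> v \<in> ?S \<Longrightarrow> norm (G i v - v / of_int (D i)) \<le> norm (Ln (cc i)) + 1"
    "\<And>i w. i \<in> {1..n} \<Longrightarrow> w \<in> zone i \<Longrightarrow> of_int (D i) * w + Ln (cc i) + h i w \<in> ?S \<Longrightarrow>
        G i (of_int (D i) * w + Ln (cc i) + h i w) = w"
    unfolding is_branch_def by blast+
  obtain sym E where sE: "continuous_on cantor sym" "continuous_on cantor E"
    "\<And>x. x \<in> cantor \<Longrightarrow> sym x \<in> {1..n} \<and> E x \<in> cantor"
    "\<And>i y. i \<in> {1..n} \<Longrightarrow> y \<in> cantor \<Longrightarrow> \<exists>x\<in>cantor. sym x = i \<and> E x = y"
    "\<And>x x'. x \<in> cantor \<Longrightarrow> x' \<in> cantor \<Longrightarrow> sym x = sym x' \<Longrightarrow> 3 * \<bar>x - x'\<bar> \<le> \<bar>E x - E x'\<bar>"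
    by (rule cantor_full_shift[OF n2], rule that)
  \<comment> \<open>Between two zones there is always a critical circle, and strictness comes from
    the lower edge of the outer zone.\<close>
  have disj: "\<not> i < j" if ij: "i \<in> {1..n}" "j \<in> {1..n}" and v: "v \<in> ?S" "v' \<in> ?S" "Re (G i v) = Re (G j v')" for i j v v'
  proof
    assume "i < j"
    have "hi i \<le> b i" by (rule hi_le[OF ij(1)])
    also have "\<dots> \<le> b (j - 1)" using \<open>i < j\<close> ij by (intro b_mono) auto
    also have "\<dots> < lo j" using \<open>i < j\<close> ij by (intro lo_gt) auto
    finally have "ln (hi i) < ln (lo j)" using hi_pos[OF ij(1)] by simp
    then show False using G(1)[OF ij(1) v(1)] G(1)[OF ij(2) v(2)] v(3) by (simp add: vstrip_def)
  qed
  \<comment> \<open>The sum of all the constants \<open>norm (Ln (cc i))\<close>, plus 1 for the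
    bound on \<open>h\<close>, is a distance bound valid for every branch simultaneously.\<close>
  interpret annular_ifs FF r R n D G "8/11" "(\<Sum>i\<in>{1..n}. norm (Ln (cc i))) + 1" sym E
  proof
    fix i v assume i: "i \<in> {1..n}" and v: "v \<in> ?S"
    show "G i v \<in> ?S" using G(1)[OF i v] zone_subset[OF i] by blast
    have "norm (Ln (cc i)) \<le> (\<Sum>i\<in>{1..n}. norm (Ln (cc i)))"
      using i by (intro member_le_sum) auto
    then show "norm (G i v - v / of_int (D i)) \<le> (\<Sum>i\<in>{1..n}. norm (Ln (cc i))) + 1"
      using G(5)[OF i v] by linarith
    show "FF (Some (exp (G i v))) = Some (exp v)"
      using ff_exp[OF i G(1)[OF i v]] G(2)[OF i v] by simp
  next
    fix i assume i: "i \<in> {1..n}"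
    show "2 \<le> \<bar>D i\<bar>" using abs_D[of i] d2[OF i] by simp
    show "inj_on (G i) ?S" using G(2)[OF i] by (metis inj_onI)
  next
    fix i j v v' assume "i \<in> {1..n}" "j \<in> {1..n}" "v \<in> ?S" "v' \<in> ?S" "Re (G i v) = Re (G j v')"
    then show "i = j" using disj[of i j v v'] disj[of j i v' v] by auto
  next
    fix w assume w: "w \<in> ?S" and X: "FF (Some (exp w)) \<notin> X"
    have "exp (ln r) \<le> exp (Re w)" "exp (Re w) \<le> exp (ln R)" using w by (auto simp: vstrip_def)
    then have "r \<le> norm (exp w)" "norm (exp w) \<le> R" using r0 R0 by auto
    moreover have "\<not> (hi i < norm (exp w) \<and> norm (exp w) < lo (Suc i))" if "i \<in> {1..<n}" for i
    proof
      assume "hi i < norm (exp w) \<and> norm (exp w) < lo (Suc i)"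
      then show False using critical_escape[OF that, of "exp w"] X None_in_X Some_in_X_iff by auto
    qed
    ultimately obtain i where i: "i \<in> {1..n}" "lo i \<le> norm (exp w)" "norm (exp w) \<le> hi i"
      using zone_or_critical[of "norm (exp w)"] by blast
    have "ln (lo i) \<le> ln (norm (exp w))" "ln (norm (exp w)) \<le> ln (hi i)"
      using i lo_pos[OF i(1)] hi_pos[OF i(1)] by (simp_all del: norm_exp_eq_Re)
    then have wz: "w \<in> zone i" by (simp add: vstrip_def)
    define v where "v = of_int (D i) * w + Ln (cc i) + h i w"
    have F: "FF (Some (exp w)) = Some (exp v)" unfolding v_def by (rule ff_exp[OF i(1) wz])
    then have "r \<le> exp (Re v)" "exp (Re v) \<le> R" using X by (auto simp: Some_in_X_iff)
    then have "v \<in> ?S" using r0 R0 by (simp add: vstrip_def ln_ge_iff) (metis exp_gt_zero ln_exp ln_le_cancel_iff)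
    then show "\<exists>i\<in>{1..n}. \<exists>v\<in>?S. w = G i v"
      using G(6)[OF i(1) wz] i(1) unfolding v_def by metis
  qed (use G(3,4) sE in auto)
  show ?thesis by (rule cantor_circles)
qed

end

section \<open>Choice of the parameters\<close>

context circle_poly
begin

lemma powr_inverse_power: "0 < W \<Longrightarrow> i \<in> {1..n} \<Longrightarrow> (W powr (1 / real (d i))) ^ d i = W"
proof -
  assume W: "0 < W" and i: "i \<in> {1..n}"
  have "(W powr (1 / real (d i))) ^ d i = W powr (1 / real (d i) * real (d i))"
    using W by (simp add: powr_powr powr_realpow[symmetric])
  then show ?thesis using W d2[OF i] by simp
qed

text \<open>On the outermost critical circle the value is W or 1 / W. One step inwards multiplies it
  by \<rho> or by 1 / \<rho>, alternately, so only two levels occur.\<close>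

lemma V_values:
  assumes W: "0 < W" and \<rho>: "0 < \<rho>"
    and last: "norm (a (n - 1)) = W powr (1 / real (d n))"
    and step: "\<And>i. i \<in> {1..n-2} \<Longrightarrow> norm (a i) = \<rho> powr (1 / real (d (Suc i))) * norm (a (Suc i))"
    and low: "vl = vh * \<rho>" and base: "if sg (n - 1) = 1 then vl = W else vh = 1 / W"
    and j: "j \<in> {1..<n}"
  shows "V j = (if sg j = 1 then vl else vh)"
proof -
  have "j \<le> n - 1" using j by auto
  then show ?thesis
  proof (induction rule: inc_induct)
    case base
    have "n - 1 \<in> {1..<n}" "Suc (n - 1) = n" using n2 by auto
    then have "V (n - 1) = norm (a (n - 1)) powi (sg (n - 1) * int (d n))"
      using V_match[of "n - 1"] by (simp add: cc_n)
    moreover have "norm (a (n - 1)) ^ d n = W"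
      unfolding last using n2 by (intro powr_inverse_power[OF W]) auto
    ultimately show ?case using \<open>if sg (n - 1) = 1 then vl = W else vh = 1 / W\<close> sg_cases[of "n - 1"]
      by (auto simp: power_int_minus divide_inverse)
  next
    case (step l)
    then have l: "l \<in> {1..<n}" "Suc l \<in> {1..n}" "l \<in> {1..n-2}" "Suc l < n" using j by auto
    have IH: "V (Suc l) = (if sg (Suc l) = 1 then vl else vh)" using step by simp
    have "V l = norm (cc (Suc l)) * norm (a l) powi (sg l * int (d (Suc l)))" by (rule V_match[OF l(1)])
    also have "norm (a l) = \<rho> powr (1 / real (d (Suc l))) * norm (a (Suc l))" by (rule assms(4)[OF l(3)])
    also have "(\<rho> powr (1 / real (d (Suc l))) * norm (a (Suc l))) powi (sg l * int (d (Suc l)))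
        = (\<rho> powr (1 / real (d (Suc l)))) powi (sg l * int (d (Suc l))) * norm (a (Suc l)) powi (sg l * int (d (Suc l)))"
      by (rule power_int_mult_distrib)
    also have "(\<rho> powr (1 / real (d (Suc l)))) powi (sg l * int (d (Suc l))) = \<rho> powi sg l"
      using powr_inverse_power[OF \<rho> l(2)] sg_cases[of l] by (auto simp: power_int_minus)
    finally have "V l = V (Suc l) * \<rho> powi sg l" by (simp add: V_def)
    then show ?case unfolding IH sg_Suc[OF l(4)] using sg_cases[of l] \<rho> low by (auto simp: power_int_minus)
  qed
qed

text \<open>Composing the ratios inwards from the last circle uses the reciprocals of d 2, ..., d
  (n-1), that is, all but the first and the last.\<close>

lemma norm_a_1:
  assumes W: "0 < W" and \<rho>: "0 < \<rho>"
    and last: "norm (a (n - 1)) = W powr (1 / real (d n))"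
    and step: "\<And>i. i \<in> {1..n-2} \<Longrightarrow> norm (a i) = \<rho> powr (1 / real (d (Suc i))) * norm (a (Suc i))"
  shows "norm (a 1) = W powr (1 / real (d n)) * \<rho> powr ((\<Sum>i=1..n. 1 / real (d i)) - 1 / real (d 1) - 1 / real (d n))"
proof -
  have "norm (a j) = W powr (1 / real (d n)) * \<rho> powr (\<Sum>i\<in>{Suc j..<n}. 1 / real (d i))" if "j \<in> {1..<n}" for j
  proof -
    have "j \<le> n - 1" using that by auto
    then show ?thesis
    proof (induction rule: inc_induct)
      case base
      then show ?case using last n2 \<rho> by simp
    next
      case (step l)
      then have l: "l \<in> {1..n-2}" "Suc l < n" using that by auto
      have "(\<Sum>i\<in>{Suc l..<n}. 1 / real (d i)) = 1 / real (d (Suc l)) + (\<Sum>i\<in>{Suc (Suc l)..<n}. 1 / real (d i))"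
        using l(2) by (simp add: sum.atLeast_Suc_lessThan)
      then show ?case using assms(4)[OF l(1)] step by (simp add: powr_add mult_ac)
    qed
  qed
  from this[of 1] have "norm (a 1) = W powr (1 / real (d n)) * \<rho> powr (\<Sum>i\<in>{Suc 1..<n}. 1 / real (d i))" using n2 by simp
  moreover have "(\<Sum>i=1..n. 1 / real (d i)) = 1 / real (d 1) + (\<Sum>i\<in>{Suc 1..<n}. 1 / real (d i)) + 1 / real (d n)"
  proof -
    have "{1..n} = insert 1 (insert n {Suc 1..<n})" using n2 by auto
    then show ?thesis using n2 by simp
  qed
  ultimately show ?thesis by simp
qed

end

text \<open>The two-level form of V gives |cc 1| = vh / bo^(d 1) or vl bo^(d 1), according to the
  sign at 0, so \<open>c6\<close> and \<open>c7\<close> are the inner conditions for the two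
  parities. By \<open>c1\<close> all ratios of consecutive radii are at most k, because d i <= K and
  \<rho> <= 1. For p = 1 and n = 2 the only critical circle has the low level; hence the guard in
  \<open>c5\<close>.\<close>

lemma cantor_circles_criterion:
  fixes n p :: nat and d :: "nat \<Rightarrow> nat" and a :: "nat \<Rightarrow> complex" and K r R W \<rho> vl vh k bo :: real
  assumes n2: "2 \<le> n" and p1: "p \<le> 1" and d2: "\<And>i. i \<in> {1..n} \<Longrightarrow> 2 \<le> d i"
    and K3: "3 \<le> K" and dK: "\<And>i. i \<in> {1..n} \<Longrightarrow> real (d i) \<le> K"
    and k: "0 < k" "100 * real n * K^2 * k \<le> 1"
    and W: "0 < W" and \<rho>: "0 < \<rho>" "\<rho> \<le> 1" and r: "0 < r"
    and last: "norm (a (n - 1)) = W powr (1 / real (d n))"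
    and step: "\<And>i. i \<in> {1..n-2} \<Longrightarrow> norm (a i) = \<rho> powr (1 / real (d (Suc i))) * norm (a (Suc i))"
    and low: "vl = vh * \<rho>" and base: "if p = 1 then vl = W else vh = 1 / W"
    and bo: "bo = W powr (1 / real (d n)) * \<rho> powr ((\<Sum>i=1..n. 1 / real (d i)) - 1 / real (d 1) - 1 / real (d n))"
    and c1: "\<rho> powr (1 / K) \<le> k" and c2: "r \<le> k * bo" and c3: "W powr (1 / real (d n)) \<le> k * R"
    and c4: "vl * (1 + K^2) * (4/3) \<le> r" and c5: "p = 0 \<or> 3 \<le> n \<Longrightarrow> R * (1 + K^2) * (4/3) \<le> vh"
    and c6: "vh * (r / bo) ^ d 1 * (2 * K) \<le> r" and c7: "2 * K * R * (r / bo) ^ d 1 \<le> vl"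
    and c8: "if p = 1 then (real (d n) + 1/10) * (11/10) * R \<le> R ^ d n else (real (d n) + 1/10) * (11/10) \<le> r * R ^ d n"
  shows "cantor_set_of_circles (julia_set (fmap p n d a)) \<and> 0 < norm (a 1) \<and>
    (\<forall>i\<in>{1..<n-1}. norm (a i) < norm (a (Suc i)))"
proof -
  have pos: "0 < norm (a j)" if "j \<in> {1..<n}" for j
  proof -
    have "j \<le> n - 1" using that by auto
    then show ?thesis
    proof (induction rule: inc_induct)
      case base
      then show ?case using last W by simp
    next
      case (step l)
      then have "l \<in> {1..n-2}" using that by auto
      then show ?case using assms(13)[of l] step \<rho> by simp
    qed
  qed
  interpret P: circle_poly n p d a
    using n2 p1 d2 pos by unfold_locales force+
  have p: "p = 0 \<or> p = 1" using p1 by auto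
  have sg_last: "P.sg (n - 1) = 1 \<longleftrightarrow> p = 1" using P.sg_last by simp
  have base': "if P.sg (n - 1) = 1 then vl = W else vh = 1 / W" using base sg_last by simp
  have V: "P.V j = (if P.sg j = 1 then vl else vh)" if "j \<in> {1..<n}" for j
    by (rule P.V_values[OF W \<rho>(1) last _ low base' that]) (rule step)
  have bo': "norm (a 1) = bo" unfolding bo by (rule P.norm_a_1[OF W \<rho>(1) last step])
  have "0 < norm (a 1)" using pos[of 1] n2 by auto
  then have bo_pos: "0 < bo" by (simp only: bo')
  have V1: "norm (P.cc 1) * bo powi (P.sg 0 * int (d 1)) = (if P.sg 1 = 1 then vl else vh)"
  proof -
    have "P.V 1 = (if P.sg 1 = 1 then vl else vh)" by (rule V) (use n2 in auto)
    then show ?thesis unfolding P.V_def bo' by (simp only: diff_self_eq_0)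
  qed
  have sg1: "P.sg 1 = - P.sg 0" using P.sg_Suc[of 0] n2 by simp
  have k1: "k < 1"
  proof -
    have "9 \<le> K^2" using power_mono[of 3 K 2] K3 by simp
    then have "100 * 2 * 9 * k \<le> 100 * real n * K^2 * k"
      using n2 k(1) by (intro mult_right_mono mult_mono) auto
    then show ?thesis using k(2) by linarith
  qed
  have ratio: "norm (a i) \<le> k * norm (a (Suc i))" if i: "i \<in> {1..<n-1}" for i
  proof -
    have i': "i \<in> {1..n-2}" "Suc i \<in> {1..n}" using i by auto
    have "1 / K \<le> 1 / real (d (Suc i))" using dK[OF i'(2)] d2[OF i'(2)] K3 by (intro divide_left_mono) auto
    then have "\<rho> powr (1 / real (d (Suc i))) \<le> \<rho> powr (1 / K)" using \<rho> by (intro powr_mono') auto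
    then have "\<rho> powr (1 / real (d (Suc i))) \<le> k" using c1 by linarith
    then show ?thesis unfolding step[OF i'(1)] by (intro mult_right_mono) auto
  qed
  interpret circle_map n p d a K k r R
  proof
    show "P.sg 0 = 1 \<Longrightarrow> norm (P.cc 1) * r ^ d 1 * (2 * K) \<le> r"
    proof -
      assume "P.sg 0 = 1"
      then have "norm (P.cc 1) = vh / bo ^ d 1" using V1 sg1 bo_pos by (simp add: field_simps)
      then show ?thesis using c6 by (simp add: power_divide)
    qed
    show "P.sg 0 = -1 \<Longrightarrow> 2 * K * R * r ^ d 1 \<le> norm (P.cc 1)"
    proof -
      assume "P.sg 0 = -1"
      then have "norm (P.cc 1) = vl * bo ^ d 1" using V1 sg1 bo_pos by (simp add: power_int_minus field_simps)
      moreover have "2 * K * R * (r / bo) ^ d 1 * bo ^ d 1 \<le> vl * bo ^ d 1" using c7 bo_pos by (intro mult_right_mono) auto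
      ultimately show ?thesis using bo_pos by (simp add: power_divide)
    qed
    fix j assume j: "j \<in> {1..<n}"
    show "P.sg j = 1 \<Longrightarrow> P.V j * (1 + K^2) * (4/3) \<le> r"
      using V[OF j] c4 by simp
    show "P.sg j = -1 \<Longrightarrow> R * (1 + K^2) * (4/3) \<le> P.V j"
    proof -
      assume s: "P.sg j = -1"
      have "p = 0 \<or> 3 \<le> n"
      proof (rule ccontr)
        assume "\<not> ?thesis"
        then have "p = 1" "n = 2" using p n2 by auto
        then have "j = n - 1" using j by auto
        then show False using s sg_last \<open>p = 1\<close> by simp
      qed
      then show ?thesis using V[OF j] c5 s by simp
    qed
  next
    show "P.sg (n - 1) = 1 \<Longrightarrow> (real (d n) + 1/10) * (11/10) * R \<le> R ^ d n" using c8 sg_last by simp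
    show "P.sg (n - 1) = -1 \<Longrightarrow> (real (d n) + 1/10) * (11/10) \<le> r * R ^ d n" using c8 sg_last by (auto split: if_splits)
  qed (use K3 dK k r c2 c3 bo' last ratio in auto)
  have "norm (a i) < norm (a (Suc i))" if "i \<in> {1..<n-1}" for i
  proof -
    have "norm (a i) \<le> k * norm (a (Suc i))" by (rule ratio[OF that])
    also have "\<dots> < 1 * norm (a (Suc i))" by (intro mult_strict_right_mono k1 pos) (use that in auto)
    finally show ?thesis by simp
  qed
  moreover have "0 < norm (a 1)" by (rule pos) (use n2 in auto)
  ultimately show ?thesis using cantor_set_of_circles_julia by blast
qed

section \<open>Small-parameter asymptotics\<close>

lemma eventually_powr_le: assumes "0 < \<alpha>" shows "\<forall>\<^sub>F s in at_right 0. C * s powr \<alpha> \<le> (1::real)"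
proof -
  have "((\<lambda>s::real. C * s powr \<alpha>) \<longlongrightarrow> C * 0 powr \<alpha>) (at_right 0)"
    using assms by (intro tendsto_intros tendsto_powr') (auto simp: eventually_at_right_field intro!: exI[of _ 1])
  then have "((\<lambda>s::real. C * s powr \<alpha>) \<longlongrightarrow> 0) (at_right 0)" using assms by simp
  then have "\<forall>\<^sub>F s in at_right 0. C * s powr \<alpha> < 1" by (rule order_tendstoD) simp
  then show ?thesis by (rule eventually_mono) simp
qed

text \<open>For p = 1 the outer radius is 5/2. At m = 2 the inequality asks for a radius of at least
  2.31, while \<open>K_cube\<close> at K = 4 allows at most 48/17; 5/2 lies between.\<close>

lemma five_halves_power: "2 \<le> (m::nat) \<Longrightarrow> (real m + 1/10) * (11/10) * (5/2) \<le> (5/2) ^ m"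
proof (induction m rule: dec_induct)
  case base
  then show ?case by (simp add: power2_eq_square)
next
  case (step m)
  have "(real (Suc m) + 1/10) * (11/10) * (5/2) \<le> 5/2 * ((real m + 1/10) * (11/10) * (5/2))"
    using step(1) by simp
  also have "\<dots> \<le> 5/2 * (5/2) ^ m" using step by (intro mult_left_mono) auto
  finally show ?case by simp
qed

lemma powr_div_le: fixes s :: real
  assumes "0 < s" "C * s powr (x - y) \<le> 1" shows "C * s powr x \<le> s powr y"
proof -
  have "C * s powr x = C * s powr (x - y) * s powr y" using assms(1) by (simp add: powr_diff)
  also have "\<dots> \<le> 1 * s powr y" using assms(2) by (intro mult_right_mono) auto
  finally show ?thesis by simp
qed

section \<open>The two families of moduli and their exponents\<close>

locale circle_degrees =
  fixes n :: nat and d :: "nat \<Rightarrow> nat"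
  assumes n2: "2 \<le> n" and d_pos: "\<forall>i\<in>{1..n}. d i > 0" and sum_less: "(\<Sum>i=1..n. 1 / real (d i)) < 1"
begin

definition \<xi> :: real where "\<xi> = (\<Sum>i=1..n. 1 / real (d i))"
definition K :: real where "K = real (Max (d ` {1..n}))"
definition k :: real where "k = 1 / (100 * real n * K^2)"
definition \<delta> :: real where "\<delta> = (1 - \<xi>) / 3"

definition circles_at :: "nat \<Rightarrow> (nat \<Rightarrow> complex) \<Rightarrow> bool" where
  "circles_at p a \<longleftrightarrow> cantor_set_of_circles (julia_set (fmap p n d a)) \<and> 0 < norm (a 1) \<and>
     (\<forall>i\<in>{1..<n-1}. norm (a i) < norm (a (Suc i))) \<and> norm (a (n - 1)) < 1"

definition moduli1 :: "real \<Rightarrow> (nat \<Rightarrow> complex) \<Rightarrow> bool" where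
  "moduli1 s a \<longleftrightarrow> norm (a (n - 1)) = (s * K powr (-2)) powr (1 / real (d n)) \<and>
     (\<forall>i\<in>{1..n-2}. norm (a i) = (s * K powr (-5)) powr (1 / real (d (Suc i))) * norm (a (Suc i)))"

definition moduli0 :: "real \<Rightarrow> (nat \<Rightarrow> complex) \<Rightarrow> bool" where
  "moduli0 s a \<longleftrightarrow> norm (a (n - 1)) = (s powr (1 / real (d n) + (1 - \<xi>) / 3)) powr (1 / real (d n)) \<and>
     (\<forall>i\<in>{1..n-2}. norm (a i) = (s powr (1 + 1 / real (d n) + 2 * (1 - \<xi>) / 3)) powr (1 / real (d (Suc i))) * norm (a (Suc i)))"

lemma two_terms: "i \<in> {1..n} \<Longrightarrow> j \<in> {1..n} \<Longrightarrow> i \<noteq> j \<Longrightarrow> 1 / real (d i) + 1 / real (d j) \<le> \<xi>"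
proof -
  assume ij: "i \<in> {1..n}" "j \<in> {1..n}" "i \<noteq> j"
  then have "(\<Sum>i\<in>{i, j}. 1 / real (d i)) \<le> \<xi>" unfolding \<xi>_def by (intro sum_mono2) auto
  then show ?thesis using ij by simp
qed

lemma xi: "\<xi> < 1" using sum_less unfolding \<xi>_def .

lemma \<delta>_pos: "0 < \<delta>" using xi by (simp add: \<delta>_def)

lemma d2: assumes i: "i \<in> {1..n}" shows "2 \<le> d i"
proof (rule ccontr)
  assume "\<not> ?thesis"
  then have "d i = 1" using d_pos i by force
  moreover have "1 / real (d i) \<le> \<xi>" unfolding \<xi>_def using i by (intro member_le_sum) auto
  ultimately show False using xi by simp
qed

lemma dK: "i \<in> {1..n} \<Longrightarrow> real (d i) \<le> K"
  by (simp add: K_def)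

text \<open>All reciprocals are at least 1 / K, so n / K <= \<xi> < 1, and K is an integer.\<close>

lemma K_ge: "real n + 1 \<le> K"
proof -
  have K0: "0 < K" using dK[of 1] d2[of 1] n2 by fastforce
  have "(\<Sum>i=1..n. 1 / K) \<le> \<xi>"
    unfolding \<xi>_def using dK d_pos K0 by (intro sum_mono divide_left_mono) auto
  then have "real n / K < 1" using xi by simp
  then have "real n < K" using K0 by simp
  then show ?thesis by (simp add: K_def)
qed

lemma K3: "3 \<le> K" using K_ge n2 by linarith

lemma k: "0 < k" "100 * real n * K^2 * k \<le> 1"
  using n2 K3 by (auto simp: k_def)

text \<open>From n >= 3 follows K >= 4. At K = 3 the left side is 100/3 and the right side 27, so n
  = 2 cannot be included.\<close>

lemma K_cube: "3 \<le> n \<Longrightarrow> 5/2 * (1 + K^2) * (4/3) \<le> K ^ 3"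
proof -
  assume "3 \<le> n"
  then have K4: "4 \<le> K" using K_ge by linarith
  then have "4 * K^2 \<le> K * K^2" "16 \<le> K^2" using power_mono[of 4 K 2] by (auto intro: mult_right_mono)
  then show ?thesis by (simp add: power3_eq_cube power2_eq_square algebra_simps)
qed

text \<open>These two numbers are the exponents of s in |a 1| for p = 1 (up to a constant factor)
  and for p = 0.\<close>

definition \<gamma>1 :: real where "\<gamma>1 = \<xi> - 1 / real (d 1)"
definition \<gamma>0 :: real where "\<gamma>0 = (1 / real (d n) + \<delta>) / real (d n) + (1 + 1 / real (d n) + 2 * \<delta>) * (\<xi> - 1 / real (d 1) - 1 / real (d n))"

lemma d1_pos: "0 < real (d 1)" and dn_pos: "0 < real (d n)"
  using d2[of 1] d2[of n] n2 by force+

text \<open>For p = 1 the inner radius is of order s, so (r / |a 1|)^(d 1) has this exponent. It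
  exceeds 1 precisely because \<xi> < 1, and the excess d 1 (1 - \<xi>) defeats every constant in
  the inner conditions.\<close>

lemma \<gamma>1_gap: "(1 - \<gamma>1) * real (d 1) = real (d 1) * (1 - \<xi>) + 1"
  using d1_pos by (simp add: \<gamma>1_def field_simps)

text \<open>For p = 0 the inner conditions need the exponent (1 - \<gamma>0) d 1 to beat 1 + w with
  w = 1 / d n + \<delta> (\<open>c6\<close>) and 1 + \<delta> + x with x = 1 / d n + \<delta> / 2
  (\<open>c7\<close>). The second is the larger demand and is the left side here.\<close>

lemma \<gamma>0_gap: "1 + 1 / real (d n) + 3 * \<delta> / 2 < (1 - \<gamma>0) * real (d 1)"
proof -
  define x y where "x = 1 / real (d 1)" and "y = 1 / real (d n)"
  have xy: "0 < x" "0 < y" "x + y \<le> \<xi>" using two_terms[of 1 n] n2 d1_pos dn_pos by (auto simp: x_def y_def)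
  have g: "\<gamma>0 = (y + \<delta>) * y + (1 + y + 2 * \<delta>) * (\<xi> - x - y)" by (simp add: \<gamma>0_def x_def y_def)
  \<comment> \<open>After division by d 1 the claim compares with 1; the slack 3 \<delta> = 1 -
    \<xi> outweighs the term 2 \<delta> \<xi>.\<close>
  have "(1 + y + 3 * \<delta> / 2) * x \<le> (1 + y + 2 * \<delta>) * x" using xy \<delta>_pos by (intro mult_right_mono) auto
  then have "(1 + y + 3 * \<delta> / 2) * x + \<gamma>0 \<le> (y + \<delta>) * y + (1 + y + 2 * \<delta>) * (\<xi> - y)"
    by (simp add: g algebra_simps)
  also have "\<dots> = \<xi> + 2 * \<delta> * \<xi> - (1 - \<xi>) * y - \<delta> * y" by (simp add: algebra_simps)
  also have "\<dots> < 1"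
  proof -
    have "2 * \<delta> * \<xi> < 2 * \<delta> * 1" using xi \<delta>_pos by (intro mult_strict_left_mono) auto
    moreover have "0 < (1 - \<xi>) * y" "0 < \<delta> * y" using xi xy \<delta>_pos by auto
    moreover have "3 * \<delta> = 1 - \<xi>" by (simp add: \<delta>_def)
    ultimately show ?thesis using \<delta>_pos by linarith
  qed
  finally have "(1 + y + 3 * \<delta> / 2) * x < 1 - \<gamma>0" by simp
  then have "(1 + y + 3 * \<delta> / 2) * x * real (d 1) < (1 - \<gamma>0) * real (d 1)" using d1_pos by (intro mult_strict_right_mono) auto
  then show ?thesis using d1_pos by (simp add: x_def y_def)
qed

lemma case_p1:
  "\<forall>\<^sub>F s in at_right 0. \<forall>a. moduli1 s a \<longrightarrow> circles_at 1 a"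
proof -
  define e where "e = \<xi> - 1 / real (d 1) - 1 / real (d n)"
  \<comment> \<open>The constant for which |a 1| = c s^\<gamma>1.\<close>
  define c where "c = (K powr (-2)) powr (1 / real (d n)) * (K powr (-5)) powr e"
  have c0: "0 < c" using K3 by (simp add: c_def)
  have g1: "0 < 1 - \<gamma>1" using \<gamma>1_gap d1_pos xi by (metis add_pos_pos diff_gt_0_iff_gt mult_pos_pos zero_less_mult_pos2 zero_less_one)
  have dn1: "0 < 1 / real (d n)" using dn_pos by simp
  note ev = eventually_powr_le
  have exps: "0 < 1 / K" "0 < real (d 1) * (1 - \<xi>)" using K3 d1_pos xi by auto
  show ?thesis
    using eventually_at_right_less[of 0] ev[OF zero_less_one, of "K powr (-5)"]
      ev[OF exps(1), of "(K powr (-5)) powr (1 / K) / k"] ev[OF g1, of "2 / (k * c)"]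
      ev[OF dn1, of "(K powr (-2)) powr (1 / real (d n)) * (2 / (5 * k))"]
      ev[OF dn1, of "2 * (K powr (-2)) powr (1 / real (d n))"]
      ev[OF exps(2), of "K ^ 3 * (2 / c) ^ d 1 * (2 * K)"]
      ev[OF exps(2), of "2 * K * (5/2) * (2 / c) ^ d 1 * K^2"]
  proof eventually_elim
    case (elim s)
    show ?case
    proof (intro allI impI)
    fix a :: "nat \<Rightarrow> complex"
    note s = elim(1) and q1 = elim(2) and q2 = elim(3) and q3 = elim(4) and q4 = elim(5) and q4' = elim(6)
      and q5 = elim(7) and q6 = elim(8)
    assume "moduli1 s a"
    then have a: "norm (a (n - 1)) = (s * K powr (-2)) powr (1 / real (d n))"
        "\<forall>i\<in>{1..n-2}. norm (a i) = (s * K powr (-5)) powr (1 / real (d (Suc i))) * norm (a (Suc i))"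
      by (auto simp: moduli1_def)
    define b1 where "b1 = c * s powr \<gamma>1"
    have b1: "b1 = (s * K powr (-2)) powr (1 / real (d n)) * (s * K powr (-5)) powr e"
    proof -
      have "s powr \<gamma>1 = s powr (1 / real (d n)) * s powr e" by (simp add: \<gamma>1_def e_def flip: powr_add)
      then show ?thesis using s K3 by (simp add: b1_def c_def powr_mult)
    qed
    have K2: "K powr (-2) = 1 / K^2" using K3 by (simp add: powr_minus powr_numeral divide_inverse)
    have K5: "K powr (-5) = 1 / K^5" using K3 by (simp add: powr_minus powr_numeral divide_inverse)
    have rb: "(2 * s / b1) ^ d 1 = (2 / c) ^ d 1 * (s powr (real (d 1) * (1 - \<xi>)) * s)"
    proof -
      have "2 * s / b1 = (2 / c) * s powr (1 - \<gamma>1)" using s by (simp add: b1_def powr_diff)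
      then have "(2 * s / b1) ^ d 1 = (2 / c) ^ d 1 * (s powr (1 - \<gamma>1)) ^ d 1" by (simp only: power_mult_distrib)
      also have "(s powr (1 - \<gamma>1)) ^ d 1 = s powr ((1 - \<gamma>1) * real (d 1))"
        using s by (simp add: powr_powr powr_realpow[symmetric])
      also have "\<dots> = s powr (real (d 1) * (1 - \<xi>)) * s" unfolding \<gamma>1_gap using s by (simp add: powr_add)
      finally show ?thesis .
    qed
    have crit: "cantor_set_of_circles (julia_set (fmap 1 n d a)) \<and> 0 < norm (a 1) \<and> (\<forall>i\<in>{1..<n-1}. norm (a i) < norm (a (Suc i)))"
    \<comment> \<open>The lower level s K^(-2) and the ratio s K^(-5) yield the upper level K^3.
      Since (1 + K^(-2)) 4/3 is at most 40/27, the lower level times its required factor is below r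
      = 2 s.\<close>
    proof (rule cantor_circles_criterion[OF n2 order_refl d2 K3 dK k, where W = "s * K powr (-2)" and \<rho> = "s * K powr (-5)"
          and vl = "s * K powr (-2)" and vh = "K ^ 3" and r = "2 * s" and R = "5/2" and bo = b1])
      show "0 < s * K powr (-2)" "0 < s * K powr (-5)" "s * K powr (-5) \<le> 1" "0 < 2 * s"
        using s q1 K3 by (auto simp: mult.commute)
      show "norm (a (n - 1)) = (s * K powr (-2)) powr (1 / real (d n))" by (rule a)
      show "norm (a i) = (s * K powr (-5)) powr (1 / real (d (Suc i))) * norm (a (Suc i))" if "i \<in> {1..n-2}" for i
        using a(2) that by blast
      show "s * K powr (-2) = K ^ 3 * (s * K powr (-5))" unfolding K2 K5 using K3 by (simp add: field_simps power_numeral_reduce)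
      show "b1 = (s * K powr (-2)) powr (1 / real (d n)) * (s * K powr (-5)) powr ((\<Sum>i = 1..n. 1 / real (d i)) - 1 / real (d 1) - 1 / real (d n))"
        unfolding \<xi>_def[symmetric] e_def[symmetric] by (rule b1)
      show "(s * K powr (-5)) powr (1 / K) \<le> k"
        using q2 k(1) s by (simp add: powr_mult divide_simps mult.commute)
      show "2 * s \<le> k * b1"
      proof -
        have "2 / (k * c) * s powr 1 \<le> s powr \<gamma>1" by (rule powr_div_le[OF s q3])
        then show ?thesis using s k(1) c0 by (simp add: b1_def divide_simps mult_ac)
      qed
      show "(s * K powr (-2)) powr (1 / real (d n)) \<le> k * (5/2)"
        using q4 k(1) s by (simp add: powr_mult divide_simps mult.commute)
      show "s * K powr (-2) * (1 + K^2) * (4/3) \<le> 2 * s"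
      proof -
        have "9 \<le> K^2" using power_mono[of 3 K 2] K3 by simp
        then have "1 / K^2 * (1 + K^2) * (4/3) \<le> 2" by (simp add: divide_simps)
        then have "s * (1 / K^2 * (1 + K^2) * (4/3)) \<le> s * 2" using s by (intro mult_left_mono) auto
        then show ?thesis unfolding K2 by (simp add: mult_ac)
      qed
      show "5/2 * (1 + K^2) * (4/3) \<le> K ^ 3" if "1 = (0::nat) \<or> 3 \<le> n" using K_cube that by simp
      show "K ^ 3 * (2 * s / b1) ^ d 1 * (2 * K) \<le> 2 * s"
      proof -
        have "K ^ 3 * (2 * s / b1) ^ d 1 * (2 * K) = K ^ 3 * (2 / c) ^ d 1 * (2 * K) * s powr (real (d 1) * (1 - \<xi>)) * s"
          unfolding rb by (simp only: mult_ac)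
        also have "\<dots> \<le> 1 * s" using q5 s by (intro mult_right_mono) auto
        finally show ?thesis using s by simp
      qed
      show "2 * K * (5/2) * (2 * s / b1) ^ d 1 \<le> s * K powr (-2)"
      proof -
        have "2 * K * (5/2) * (2 * s / b1) ^ d 1 * K^2 = 2 * K * (5/2) * (2 / c) ^ d 1 * K^2 * s powr (real (d 1) * (1 - \<xi>)) * s"
          unfolding rb by (simp only: mult_ac)
        also have "\<dots> \<le> 1 * s" using q6 s by (intro mult_right_mono) auto
        finally show ?thesis unfolding K2 using K3 by (simp add: pos_le_divide_eq)
      qed
      show "if 1 = (1::nat) then (real (d n) + 1/10) * (11/10) * (5/2) \<le> (5/2) ^ d n else (real (d n) + 1/10) * (11/10) \<le> 2 * s * (5/2) ^ d n"
        using five_halves_power[OF d2[of n]] n2 by simp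
    qed simp_all
    moreover have "norm (a (n - 1)) < 1"
      using q4' s unfolding a(1) by (simp add: powr_mult mult_ac)
    ultimately show "circles_at 1 a" unfolding circles_at_def by blast
    qed
  qed
qed

lemma case_p0:
  "\<forall>\<^sub>F s in at_right 0. \<forall>a. moduli0 s a \<longrightarrow> circles_at 0 a"
proof -
  \<comment> \<open>W = s^w and \<rho> = s^\<theta> produce the levels s^(1 + \<delta>) and s^(-w).
    The outer radius s^(-x) has x above 1 / d n by \<delta> / 2, so that r R^(d n) tends to
    infinity, and below w by \<delta> / 2, so that it stays under the upper level.\<close>
  define w \<theta> x where "w = 1 / real (d n) + \<delta>" and "\<theta> = 1 + 1 / real (d n) + 2 * \<delta>" and "x = 1 / real (d n) + \<delta> / 2"
  define e where "e = (1 - \<gamma>0) * real (d 1)"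
  have dn1: "0 < 1 / real (d n)" using dn_pos by simp
  have pos: "0 < w" "0 < \<theta>" "0 < x" using dn1 \<delta>_pos unfolding w_def \<theta>_def x_def by linarith+
  have e: "1 + w + \<delta> / 2 < e" using \<gamma>0_gap by (simp add: e_def w_def)
  have g0: "0 < 1 - \<gamma>0"
  proof -
    have "0 < e" using e pos \<delta>_pos by linarith
    then show ?thesis unfolding e_def using d1_pos by (simp only: zero_less_mult_iff) linarith
  qed
  note ev = eventually_powr_le
  have wn: "0 < w / real (d n)" using pos dn_pos by simp
  then have wx: "0 < w / real (d n) - - x" using pos by linarith
  have wxe: "0 < - x - - w" "0 < - w + e - 1" "0 < - x + e - (1 + \<delta>)"
    using e \<delta>_pos unfolding w_def x_def by linarith+
  have exps: "0 < \<theta> / K" "0 < \<delta> / 2 * real (d n)" "0 < 1 + \<delta> - 1" using pos K3 \<delta>_pos dn_pos by simp_all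
  show ?thesis
    using eventually_at_right_less[of 0] ev[OF pos(2), of 1] ev[OF exps(1), of "1 / k"] ev[OF g0, of "1 / k"]
      ev[OF wx, of "1 / k"] ev[OF exps(3), of "(1 + K^2) * (4/3)"] ev[OF wxe(1), of "(1 + K^2) * (4/3)"]
      ev[OF wxe(2), of "2 * K"] ev[OF wxe(3), of "2 * K"] ev[OF exps(2), of "(real (d n) + 1/10) * (11/10)"]
      ev[OF wn, of 2]
  proof eventually_elim
    case (elim s)
    show ?case
    proof (intro allI impI)
    note s = elim(1) and q1 = elim(2) and q2 = elim(3) and q3 = elim(4) and q4 = elim(5) and q5 = elim(6)
      and q6 = elim(7) and q7 = elim(8) and q8 = elim(9) and q9 = elim(10) and q10 = elim(11)
    fix a :: "nat \<Rightarrow> complex"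
    assume "moduli0 s a"
    then have a: "norm (a (n - 1)) = (s powr w) powr (1 / real (d n))"
        "\<forall>i\<in>{1..n-2}. norm (a i) = (s powr \<theta>) powr (1 / real (d (Suc i))) * norm (a (Suc i))"
      by (simp_all add: moduli0_def w_def \<theta>_def \<delta>_def)
    have rb: "(s / s powr \<gamma>0) ^ d 1 = s powr e"
    proof -
      have "s / s powr \<gamma>0 = s powr (1 - \<gamma>0)" using s by (simp add: powr_diff)
      then show ?thesis using s by (simp add: powr_powr powr_realpow[symmetric] e_def)
    qed
    have crit: "cantor_set_of_circles (julia_set (fmap 0 n d a)) \<and> 0 < norm (a 1) \<and> (\<forall>i\<in>{1..<n-1}. norm (a i) < norm (a (Suc i)))"
    proof (rule cantor_circles_criterion[OF n2 zero_le_one d2 K3 dK k, where W = "s powr w" and \<rho> = "s powr \<theta>"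
          and vl = "s powr (1 + \<delta>)" and vh = "s powr (- w)" and r = s and R = "s powr (- x)" and bo = "s powr \<gamma>0"])
      show "0 < s powr w" "0 < s powr \<theta>" "s powr \<theta> \<le> 1" "0 < s"
        using s q1 by auto
      show "norm (a (n - 1)) = (s powr w) powr (1 / real (d n))" by (rule a)
      show "norm (a i) = (s powr \<theta>) powr (1 / real (d (Suc i))) * norm (a (Suc i))" if "i \<in> {1..n-2}" for i
        using a(2) that by blast
      show "s powr (1 + \<delta>) = s powr (- w) * s powr \<theta>" 
      proof -
        have "1 + \<delta> = - w + \<theta>" by (simp add: w_def \<theta>_def)
        then show ?thesis by (simp only: powr_add)
      qed
      show "if 0 = (1::nat) then s powr (1 + \<delta>) = s powr w else s powr (- w) = 1 / s powr w"
        by (simp add: powr_minus divide_inverse)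
      show "s powr \<gamma>0 = (s powr w) powr (1 / real (d n)) * (s powr \<theta>) powr ((\<Sum>i = 1..n. 1 / real (d i)) - 1 / real (d 1) - 1 / real (d n))"
        unfolding \<xi>_def[symmetric] by (simp add: powr_powr \<gamma>0_def w_def \<theta>_def flip: powr_add)
      show "(s powr \<theta>) powr (1 / K) \<le> k"
        using q2 k(1) by (simp add: powr_powr divide_simps)
      show "s \<le> k * s powr \<gamma>0"
      proof -
        have "1 / k * s powr 1 \<le> s powr \<gamma>0" by (rule powr_div_le[OF s q3])
        then show ?thesis using s k(1) by (simp add: divide_simps mult_ac)
      qed
      show "(s powr w) powr (1 / real (d n)) \<le> k * s powr (- x)"
        using powr_div_le[OF s q4] k(1) by (simp add: powr_powr divide_simps mult_ac)
      show "s powr (1 + \<delta>) * (1 + K^2) * (4/3) \<le> s"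
        using powr_div_le[OF s q5] s by (simp add: mult_ac)
      show "s powr (- x) * (1 + K^2) * (4/3) \<le> s powr (- w)"
        using powr_div_le[OF s q6] by (simp add: mult_ac)
      show "s powr (- w) * (s / s powr \<gamma>0) ^ d 1 * (2 * K) \<le> s"
        unfolding rb using powr_div_le[OF s q7] s by (simp add: mult_ac flip: powr_add)
      show "2 * K * s powr (- x) * (s / s powr \<gamma>0) ^ d 1 \<le> s powr (1 + \<delta>)"
        unfolding rb using powr_div_le[OF s q8] s by (simp add: mult_ac flip: powr_add)
      show "if 0 = (1::nat) then (real (d n) + 1/10) * (11/10) * s powr (- x) \<le> (s powr (- x)) ^ d n
        else (real (d n) + 1/10) * (11/10) \<le> s * (s powr (- x)) ^ d n"
      proof -
        have "(s powr (- x)) ^ d n = s powr (- x * real (d n))"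
          using s by (simp only: powr_realpow[symmetric] powr_gt_zero powr_powr)
        then have "s * (s powr (- x)) ^ d n = s powr (1 + - x * real (d n))"
          using s by (simp only: powr_add powr_one)
        also have "1 + - x * real (d n) = - (\<delta> / 2 * real (d n))"
          using dn_pos by (simp add: x_def field_simps)
        also have "s powr \<dots> = 1 / s powr (\<delta> / 2 * real (d n))" by (simp only: powr_minus divide_inverse mult_1)
        finally have "s * (s powr (- x)) ^ d n = 1 / s powr (\<delta> / 2 * real (d n))" .
        moreover have "0 < s powr (\<delta> / 2 * real (d n))" using s by simp
        then have "(real (d n) + 1/10) * (11/10) \<le> 1 / s powr (\<delta> / 2 * real (d n))"
          using q9 by (simp only: pos_le_divide_eq)
        ultimately show ?thesis by (simp only: zero_neq_one if_False)
      qed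
    qed simp_all
    moreover have "norm (a (n - 1)) < 1"
      using q10 s unfolding a(1) by (simp add: powr_powr)
    ultimately show "circles_at 0 a" unfolding circles_at_def by blast
    qed
  qed
qed

lemma exists_moduli:
  fixes B :: real and q :: "nat \<Rightarrow> real"
  assumes "0 \<le> B" "\<And>i. 0 \<le> q i"
  shows "\<exists>a :: nat \<Rightarrow> complex. norm (a (n - 1)) = B \<and> (\<forall>i\<in>{1..n-2}. norm (a i) = q i * norm (a (Suc i)))"
proof -
  define a :: "nat \<Rightarrow> complex" where "a i = of_real ((\<Prod>j\<in>{i..<n-1}. q j) * B)" for i
  have na: "norm (a i) = (\<Prod>j\<in>{i..<n-1}. q j) * B" for i
    unfolding a_def norm_of_real using assms by (simp add: prod_nonneg)
  have "norm (a i) = q i * norm (a (Suc i))" if "i \<in> {1..n-2}" for i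
  proof -
    have "i < n - 1" using that by auto
    then show ?thesis unfolding na by (simp add: prod.atLeast_Suc_lessThan)
  qed
  then show ?thesis using na[of "n - 1"] by (intro exI[of _ a]) auto
qed

end

theorem theorem2p5:
  fixes n :: nat and d :: "nat \<Rightarrow> nat"
  assumes "n \<ge> 2"
    and "\<forall>i\<in>{1..n}. d i > 0"
    and "(\<Sum>i=1..n. 1 / real (d i)) < 1"
  defines "\<xi> \<equiv> (\<Sum>i=1..n. 1 / real (d i))"
    and "K \<equiv> real (Max (d ` {1..n}))"
  shows
    "(\<exists>s\<^sub>s>0. \<forall>s\<^sub>1. 0 < s\<^sub>1 \<and> s\<^sub>1 < s\<^sub>s \<longrightarrow>
        (\<forall>a :: nat \<Rightarrow> complex.
           norm (a (n - 1)) = (s\<^sub>1 * K powr (-2)) powr (1 / real (d n)) \<and>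
           (\<forall>i\<in>{1..n-2}. norm (a i) = (s\<^sub>1 * K powr (-5)) powr (1 / real (d (Suc i))) * norm (a (Suc i)))
           \<longrightarrow> cantor_set_of_circles (julia_set (fmap 1 n d a))))
   \<and> (\<exists>s\<^sub>s>0. \<forall>s\<^sub>0. 0 < s\<^sub>0 \<and> s\<^sub>0 < s\<^sub>s \<longrightarrow>
        (\<forall>a :: nat \<Rightarrow> complex.
           norm (a (n - 1)) = (s\<^sub>0 powr (1 / real (d n) + (1 - \<xi>) / 3)) powr (1 / real (d n)) \<and>
           (\<forall>i\<in>{1..n-2}. norm (a i) =
              (s\<^sub>0 powr (1 + 1 / real (d n) + 2 * (1 - \<xi>) / 3)) powr (1 / real (d (Suc i))) * norm (a (Suc i)))
           \<longrightarrow> cantor_set_of_circles (julia_set (fmap 0 n d a))))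
   \<and> (\<forall>p\<in>{0::nat, 1}. \<exists>a :: nat \<Rightarrow> complex.
        0 < norm (a 1) \<and> (\<forall>i\<in>{1..<n-1}. norm (a i) < norm (a (Suc i))) \<and> norm (a (n - 1)) < 1 \<and>
        cantor_set_of_circles (julia_set (fmap p n d a)))"
proof -
  interpret circle_degrees n d using assms(1-3) by unfold_locales
  have fold: "circle_degrees.\<xi> n d = \<xi>" "circle_degrees.K n d = K"
    unfolding assms(4,5)
    by (rule circle_degrees.\<xi>_def[OF circle_degrees_axioms] circle_degrees.K_def[OF circle_degrees_axioms])+
  note moduli_defs = moduli1_def[unfolded fold] moduli0_def[unfolded fold]
  obtain t1 where t1: "t1 > 0" "\<And>s a. 0 < s \<Longrightarrow> s < t1 \<Longrightarrow> moduli1 s a \<Longrightarrow> circles_at 1 a"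
    using case_p1 unfolding eventually_at_right_field by blast
  obtain t0 where t0: "t0 > 0" "\<And>s a. 0 < s \<Longrightarrow> s < t0 \<Longrightarrow> moduli0 s a \<Longrightarrow> circles_at 0 a"
    using case_p0 unfolding eventually_at_right_field by blast
  \<comment> \<open>Half of each threshold is an admissible parameter, which gives the existence
    claim.\<close>
  have "\<exists>a. moduli1 (t1 / 2) a" "\<exists>a. moduli0 (t0 / 2) a"
    unfolding moduli1_def moduli0_def by (rule exists_moduli; simp)+
  then obtain a1 a0 where "moduli1 (t1 / 2) a1" "moduli0 (t0 / 2) a0" by blast
  then have e: "circles_at 1 a1" "circles_at 0 a0"
    using t1(2)[of "t1 / 2" a1] t0(2)[of "t0 / 2" a0] t1(1) t0(1) by auto
  show ?thesis
  proof (intro conjI)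
    show "\<forall>p\<in>{0::nat, 1}. \<exists>a :: nat \<Rightarrow> complex.
        0 < norm (a 1) \<and> (\<forall>i\<in>{1..<n-1}. norm (a i) < norm (a (Suc i))) \<and> norm (a (n - 1)) < 1 \<and>
        cantor_set_of_circles (julia_set (fmap p n d a))"
      using e unfolding circles_at_def by blast
  qed (use t0 t1 in \<open>unfold circles_at_def moduli_defs, blast\<close>)+
qed

end
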